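(* Let $\alpha>1$ be a constant, let $(M^{m},g)$ be a compact Riemannian manifold and $(N^{n},h)$ a Riemannian manifold, of dimensions $m$ and $n$ with $m>n$ and $n>2\alpha$. Let $\psi:(M,g)\to(N,h)$ be a horizontally conformal $\alpha$-harmonic map with dilation $\mu$. Then the fibers of $\psi$ are minimal submanifolds of $M$ if and only if $\mathrm{grad}\,\mu^{2}$ is vertical.
   Context: For a smooth map $\psi:(M,g)\to(N,h)$, $|d\psi|$ denotes the Hilbert–Schmidt norm of $d\psi$ with respect to $g$ and $h$. For a constant $\alpha>1$, $\psi$ is $\alpha$-harmonic if it is a critical point (with respect to smooth variations) of $E_\alpha(\psi)=\int_M(1+|d\psi|^2)^\alpha\,dV_g$; equivalently its Euler–Lagrange equation $\tau_\alpha(\psi)=2\alpha(1+|d\psi|^2)^{\alpha-1}\tau(\psi)+d\psi\big(\mathrm{grad}(2\alpha(1+|d\psi|^2)^{\alpha-1})\big)=0$ holds, where $\tau(\psi)=\mathrm{Tr}_g\nabla d\psi$ is the tension field. Assume $d\psi_p\neq0$ for each $p\in M$. The vertical space at $p$ is $V_p=\ker d\psi_p$ and the horizontal space $H_p$ is the orthogonal complement of $V_p$ in $T_pM$; the horizontal spaces have dimension $n$ (i.e. $d\psi_p$ maps $H_p$ onto $T_{\psi(p)}N$). The map $\psi$ is horizontally conformal with dilation $\mu$ if $\mu\in C^\infty(M)$ is a positive function with $h(d\psi(X),d\psi(Y))=\mu^2 g(X,Y)$ for all $X,Y\in H_p$ and $p\in M$. A vector field is vertical if its value at each $p$ lies in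 $V_p$. With a local orthonormal frame $\{e_i\}_{i=1}^m$ such that $e_1,\dots,e_n$ are horizontal and $e_{n+1},\dots,e_m$ are vertical, the mean curvature vector of the fibers is $H=\frac{1}{m-n}\sum_{j=1}^{n}\sum_{i=n+1}^{m}g(\nabla^M_{e_i}e_i,e_j)e_j$, where $\nabla^M$ is the Levi-Civita connection of $g$; the fibers are minimal if $H=0$. *)

theory Defs
  imports "HOL-Analysis.Analysis"
begin

section \<open>Smooth functions between normed spaces\<close>

text \<open>Intended for open \<open>S\<close>. Continuity of all iterated directional derivatives is the usual
  notion of being of class \<open>C\<^sup>k\<close> in finite dimension.\<close>

primrec Ck_on :: "nat \<Rightarrow> 'a::real_normed_vector set \<Rightarrow> ('a \<Rightarrow> 'b::real_normed_vector) \<Rightarrow> bool" where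
  "Ck_on 0 S f \<longleftrightarrow> continuous_on S f"
| "Ck_on (Suc k) S f \<longleftrightarrow>
     (\<forall>x\<in>S. f differentiable (at x)) \<and> (\<forall>v. Ck_on k S (\<lambda>x. frechet_derivative f (at x) v))"

definition smooth_on :: "'a::real_normed_vector set \<Rightarrow> ('a \<Rightarrow> 'b::real_normed_vector) \<Rightarrow> bool" where
  "smooth_on S f \<longleftrightarrow> (\<forall>k. Ck_on k S f)"


section \<open>Smooth manifolds\<close>

text \<open>A manifold is a whole type (Hausdorff and second countable by its sort) with a smooth atlas.
  A chart is its domain together with its coordinate map; the map is irrelevant outside the
  domain. Manifolds have no boundary, since chart images are open, and need not be connected.\<close>

type_synonym ('a, 'm) chart = "'a set \<times> ('a \<Rightarrow> real ^ 'm)"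

abbreviation cdom :: "('a, 'm) chart \<Rightarrow> 'a set" where
  "cdom c \<equiv> fst c"

abbreviation cmap :: "('a, 'm) chart \<Rightarrow> 'a \<Rightarrow> real ^ 'm" where
  "cmap c \<equiv> snd c"

definition cinv :: "('a, 'm) chart \<Rightarrow> real ^ 'm \<Rightarrow> 'a" where
  "cinv c = inv_into (cdom c) (cmap c)"

definition smooth_atlas ::
  "('a::{t2_space, second_countable_topology}, 'm::finite) chart set \<Rightarrow> bool" where
  "smooth_atlas A \<longleftrightarrow>
     (\<Union>c\<in>A. cdom c) = UNIV \<and>
     (\<forall>c\<in>A. open (cdom c) \<and> open (cmap c ` cdom c) \<and>
        homeomorphism (cdom c) (cmap c ` cdom c) (cmap c) (cinv c)) \<and>
     (\<forall>c\<in>A. \<forall>d\<in>A. smooth_on (cmap c ` (cdom c \<inter> cdom d)) (cmap d \<circ> cinv c))"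

definition smooth_function ::
  "('a::{t2_space, second_countable_topology}, 'm::finite) chart set \<Rightarrow> ('a \<Rightarrow> real) \<Rightarrow> bool" where
  "smooth_function A f \<longleftrightarrow> (\<forall>c\<in>A. smooth_on (cmap c ` cdom c) (f \<circ> cinv c))"

definition smooth_map ::
  "('a::{t2_space, second_countable_topology}, 'm::finite) chart set \<Rightarrow>
   ('b::{t2_space, second_countable_topology}, 'n::finite) chart set \<Rightarrow> ('a \<Rightarrow> 'b) \<Rightarrow> bool" where
  "smooth_map A B \<psi> \<longleftrightarrow> continuous_on UNIV \<psi> \<and>
     (\<forall>c\<in>A. \<forall>d\<in>B. smooth_on (cmap c ` (cdom c \<inter> \<psi> -` cdom d)) (cmap d \<circ> \<psi> \<circ> cinv c))"


section \<open>Tangent vectors\<close>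

text \<open>Every point \<open>p\<close> has a preferred chart \<open>chart_at A p\<close>, and the tangent space at \<open>p\<close> is
  identified with \<open>real ^ 'm\<close> by taking components in that chart. So a vector field is a function
  \<open>'a \<Rightarrow> real ^ 'm\<close> whose value at \<open>p\<close> is to be read in the chart preferred at \<open>p\<close>; such a function
  need not look continuous even when the field is, and its components in one fixed chart are
  obtained with the derivative of the chart transition (\<open>field_in_chart\<close>).\<close>

definition chart_at :: "('a, 'm::finite) chart set \<Rightarrow> 'a \<Rightarrow> ('a, 'm) chart" where
  "chart_at A p = (SOME c. c \<in> A \<and> p \<in> cdom c)"

text \<open>The differential \<open>d\<psi>\<^sub>p\<close>, and the differential of a real function.\<close>

definition tangent_map ::
  "('a, 'm::finite) chart set \<Rightarrow> ('b, 'n::finite) chart set \<Rightarrow> ('a \<Rightarrow> 'b) \<Rightarrow> 'a \<Rightarrow>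
   real ^ 'm \<Rightarrow> real ^ 'n" where
  "tangent_map A B \<psi> p =
     frechet_derivative (cmap (chart_at B (\<psi> p)) \<circ> \<psi> \<circ> cinv (chart_at A p))
       (at (cmap (chart_at A p) p))"

definition function_differential ::
  "('a, 'm::finite) chart set \<Rightarrow> ('a \<Rightarrow> real) \<Rightarrow> 'a \<Rightarrow> real ^ 'm \<Rightarrow> real" where
  "function_differential A f p =
     frechet_derivative (f \<circ> cinv (chart_at A p)) (at (cmap (chart_at A p) p))"

text \<open>The \<open>i\<close>-th coordinate vector of the chart \<open>c\<close>, as a tangent vector at \<open>p \<in> cdom c\<close>.\<close>

definition coord_vector :: "('a, 'm::finite) chart set \<Rightarrow> ('a, 'm) chart \<Rightarrow> 'm \<Rightarrow> 'a \<Rightarrow> real ^ 'm" where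
  "coord_vector A c i p =
     frechet_derivative (cmap (chart_at A p) \<circ> cinv c) (at (cmap c p)) (axis i 1)"

definition field_in_chart ::
  "('a, 'm::finite) chart set \<Rightarrow> ('a, 'm) chart \<Rightarrow> ('a \<Rightarrow> real ^ 'm) \<Rightarrow> real ^ 'm \<Rightarrow> real ^ 'm" where
  "field_in_chart A c X x =
     (let p = cinv c x
      in frechet_derivative (cmap c \<circ> cinv (chart_at A p)) (at (cmap (chart_at A p) p)) (X p))"

definition smooth_field_on ::
  "('a::{t2_space, second_countable_topology}, 'm::finite) chart set \<Rightarrow> 'a set \<Rightarrow>
   ('a \<Rightarrow> real ^ 'm) \<Rightarrow> bool" where
  "smooth_field_on A W X \<longleftrightarrow> (\<forall>c\<in>A. smooth_on (cmap c ` (W \<inter> cdom c)) (field_in_chart A c X))"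


section \<open>Riemannian metrics\<close>

type_synonym ('a, 'm) metric_tensor = "'a \<Rightarrow> real ^ 'm \<Rightarrow> real ^ 'm \<Rightarrow> real"

definition metric_matrix ::
  "('a, 'm::finite) chart set \<Rightarrow> ('a, 'm) metric_tensor \<Rightarrow> ('a, 'm) chart \<Rightarrow> real ^ 'm \<Rightarrow>
   real ^ 'm ^ 'm" where
  "metric_matrix A g c x =
     (\<chi> i j. g (cinv c x) (coord_vector A c i (cinv c x)) (coord_vector A c j (cinv c x)))"

definition riemannian_metric ::
  "('a::{t2_space, second_countable_topology}, 'm::finite) chart set \<Rightarrow> ('a, 'm) metric_tensor \<Rightarrow> bool" where
  "riemannian_metric A g \<longleftrightarrow>
     (\<forall>p. bilinear (g p) \<and> (\<forall>v w. g p v w = g p w v) \<and> (\<forall>v. v \<noteq> 0 \<longrightarrow> 0 < g p v v)) \<and>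
     (\<forall>c\<in>A. \<forall>i j. smooth_on (cmap c ` cdom c) (\<lambda>x. metric_matrix A g c x $ i $ j))"

definition riemannian_manifold ::
  "('a::{t2_space, second_countable_topology}, 'm::finite) chart set \<Rightarrow> ('a, 'm) metric_tensor \<Rightarrow> bool" where
  "riemannian_manifold A g \<longleftrightarrow> smooth_atlas A \<and> riemannian_metric A g"

text \<open>The Riemannian measure \<open>dV\<^sub>g\<close> is the unique Borel measure which in every chart has density
  \<open>sqrt (det (g\<^sub>i\<^sub>j))\<close> with respect to Lebesgue measure.\<close>

definition riemannian_measure ::
  "('a::{t2_space, second_countable_topology}, 'm::finite) chart set \<Rightarrow> ('a, 'm) metric_tensor \<Rightarrow>
   'a measure \<Rightarrow> bool" where
  "riemannian_measure A g dV \<longleftrightarrow> sets dV = sets borel \<and>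
     (\<forall>c\<in>A. \<forall>S\<in>sets borel. S \<subseteq> cdom c \<longrightarrow>
        emeasure dV S = (\<integral>\<^sup>+x\<in>cmap c ` S. ennreal (sqrt (det (metric_matrix A g c x))) \<partial>lborel))"

definition gradient ::
  "('a, 'm::finite) chart set \<Rightarrow> ('a, 'm) metric_tensor \<Rightarrow> ('a \<Rightarrow> real) \<Rightarrow> 'a \<Rightarrow> real ^ 'm" where
  "gradient A g f p = (THE v. \<forall>w. g p v w = function_differential A f p w)"

text \<open>The Levi-Civita connection, by the Christoffel symbols of the chart preferred at \<open>p\<close>:
  \<open>\<Gamma>\<^sup>k\<^sub>i\<^sub>j = 1/2 g\<^sup>k\<^sup>l (\<partial>\<^sub>i g\<^sub>j\<^sub>l + \<partial>\<^sub>j g\<^sub>i\<^sub>l - \<partial>\<^sub>l g\<^sub>i\<^sub>j)\<close> and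
  \<open>(\<nabla>\<^sub>X Y)\<^sup>k = X\<^sup>i \<partial>\<^sub>i Y\<^sup>k + \<Gamma>\<^sup>k\<^sub>i\<^sub>j X\<^sup>i Y\<^sup>j\<close>.\<close>

definition partial_deriv :: "'m::finite \<Rightarrow> (real ^ 'm \<Rightarrow> real) \<Rightarrow> real ^ 'm \<Rightarrow> real" where
  "partial_deriv i f x = frechet_derivative f (at x) (axis i 1)"

definition christoffel ::
  "('a, 'm::finite) chart set \<Rightarrow> ('a, 'm) metric_tensor \<Rightarrow> ('a, 'm) chart \<Rightarrow> real ^ 'm \<Rightarrow>
   'm \<Rightarrow> 'm \<Rightarrow> 'm \<Rightarrow> real" where
  "christoffel A g c x k i j =
     1 / 2 * (\<Sum>l\<in>UNIV. matrix_inv (metric_matrix A g c x) $ k $ l *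
       (partial_deriv i (\<lambda>y. metric_matrix A g c y $ j $ l) x +
        partial_deriv j (\<lambda>y. metric_matrix A g c y $ i $ l) x -
        partial_deriv l (\<lambda>y. metric_matrix A g c y $ i $ j) x))"

definition levi_civita ::
  "('a, 'm::finite) chart set \<Rightarrow> ('a, 'm) metric_tensor \<Rightarrow> ('a \<Rightarrow> real ^ 'm) \<Rightarrow> ('a \<Rightarrow> real ^ 'm) \<Rightarrow>
   'a \<Rightarrow> real ^ 'm" where
  "levi_civita A g X Y p =
     (let c = chart_at A p; x = cmap c p
      in frechet_derivative (field_in_chart A c Y) (at x) (X p) +
         (\<chi> k. \<Sum>i\<in>UNIV. \<Sum>j\<in>UNIV. christoffel A g c x k i j * X p $ i * Y p $ j))"


section \<open>Alpha-harmonic maps\<close>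

definition orthonormal_basis :: "('a, 'm::finite) metric_tensor \<Rightarrow> 'a \<Rightarrow> ('m \<Rightarrow> real ^ 'm) \<Rightarrow> bool" where
  "orthonormal_basis g p b \<longleftrightarrow> (\<forall>i j. g p (b i) (b j) = (if i = j then 1 else 0))"

text \<open>The Hilbert-Schmidt norm \<open>|d\<psi>\<^sub>p|\<close>; it does not depend on the orthonormal basis chosen.\<close>

definition hs_norm ::
  "('a, 'm::finite) chart set \<Rightarrow> ('a, 'm) metric_tensor \<Rightarrow> ('b, 'n::finite) chart set \<Rightarrow> ('b, 'n) metric_tensor \<Rightarrow>
   ('a \<Rightarrow> 'b) \<Rightarrow> 'a \<Rightarrow> real" where
  "hs_norm A g B h \<psi> p =
     (let b = (SOME b. orthonormal_basis g p b)
      in sqrt (\<Sum>i\<in>UNIV. h (\<psi> p) (tangent_map A B \<psi> p (b i)) (tangent_map A B \<psi> p (b i))))"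

definition alpha_energy ::
  "('a::{t2_space, second_countable_topology}, 'm::finite) chart set \<Rightarrow> ('a, 'm) metric_tensor \<Rightarrow>
   'a measure \<Rightarrow> ('b, 'n::finite) chart set \<Rightarrow> ('b, 'n) metric_tensor \<Rightarrow> real \<Rightarrow> ('a \<Rightarrow> 'b) \<Rightarrow> real" where
  "alpha_energy A g dV B h \<alpha> \<psi> = (\<integral>p. (1 + (hs_norm A g B h \<psi> p)\<^sup>2) powr \<alpha> \<partial>dV)"

text \<open>\<open>\<Psi>\<close> is smooth as a map from \<open>{-\<epsilon><..<\<epsilon>} \<times> M\<close> to \<open>N\<close>.\<close>

definition smooth_variation ::
  "('a::{t2_space, second_countable_topology}, 'm::finite) chart set \<Rightarrow>
   ('b::{t2_space, second_countable_topology}, 'n::finite) chart set \<Rightarrow>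
   ('a \<Rightarrow> 'b) \<Rightarrow> real \<Rightarrow> (real \<Rightarrow> 'a \<Rightarrow> 'b) \<Rightarrow> bool" where
  "smooth_variation A B \<psi> \<epsilon> \<Psi> \<longleftrightarrow> \<epsilon> > 0 \<and> \<Psi> 0 = \<psi> \<and>
     continuous_on ({-\<epsilon><..<\<epsilon>} \<times> UNIV) (\<lambda>(t, p). \<Psi> t p) \<and>
     (\<forall>c\<in>A. \<forall>d\<in>B.
        smooth_on {(t, x). t \<in> {-\<epsilon><..<\<epsilon>} \<and> x \<in> cmap c ` cdom c \<and> \<Psi> t (cinv c x) \<in> cdom d}
          (\<lambda>(t, x). cmap d (\<Psi> t (cinv c x))))"

text \<open>Variations are not required to have compact support, so this is meant for compact \<open>M\<close>.\<close>

definition alpha_harmonic ::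
  "('a::{t2_space, second_countable_topology}, 'm::finite) chart set \<Rightarrow> ('a, 'm) metric_tensor \<Rightarrow>
   'a measure \<Rightarrow> ('b::{t2_space, second_countable_topology}, 'n::finite) chart set \<Rightarrow>
   ('b, 'n) metric_tensor \<Rightarrow> real \<Rightarrow> ('a \<Rightarrow> 'b) \<Rightarrow> bool" where
  "alpha_harmonic A g dV B h \<alpha> \<psi> \<longleftrightarrow> smooth_map A B \<psi> \<and>
     (\<forall>\<epsilon> \<Psi>. smooth_variation A B \<psi> \<epsilon> \<Psi> \<longrightarrow>
        ((\<lambda>t. alpha_energy A g dV B h \<alpha> (\<Psi> t)) has_real_derivative 0) (at 0))"


section \<open>Horizontally conformal maps and their fibers\<close>

definition vertical_space ::
  "('a, 'm::finite) chart set \<Rightarrow> ('b, 'n::finite) chart set \<Rightarrow> ('a \<Rightarrow> 'b) \<Rightarrow> 'a \<Rightarrow>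
   (real ^ 'm) set" where
  "vertical_space A B \<psi> p = {v. tangent_map A B \<psi> p v = 0}"

definition horizontal_space ::
  "('a, 'm::finite) chart set \<Rightarrow> ('a, 'm) metric_tensor \<Rightarrow> ('b, 'n::finite) chart set \<Rightarrow> ('a \<Rightarrow> 'b) \<Rightarrow>
   'a \<Rightarrow> (real ^ 'm) set" where
  "horizontal_space A g B \<psi> p = {v. \<forall>w\<in>vertical_space A B \<psi> p. g p v w = 0}"

definition horizontally_conformal ::
  "('a::{t2_space, second_countable_topology}, 'm::finite) chart set \<Rightarrow> ('a, 'm) metric_tensor \<Rightarrow>
   ('b::{t2_space, second_countable_topology}, 'n::finite) chart set \<Rightarrow> ('b, 'n) metric_tensor \<Rightarrow>
   ('a \<Rightarrow> 'b) \<Rightarrow> ('a \<Rightarrow> real) \<Rightarrow> bool" where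
  "horizontally_conformal A g B h \<psi> \<mu> \<longleftrightarrow>
     smooth_map A B \<psi> \<and>
     (\<forall>p. tangent_map A B \<psi> p \<noteq> (\<lambda>v. 0)) \<and>
     (\<forall>p. tangent_map A B \<psi> p ` horizontal_space A g B \<psi> p = UNIV) \<and>
     smooth_function A \<mu> \<and> (\<forall>p. \<mu> p > 0) \<and>
     (\<forall>p. \<forall>X\<in>horizontal_space A g B \<psi> p. \<forall>Y\<in>horizontal_space A g B \<psi> p.
        h (\<psi> p) (tangent_map A B \<psi> p X) (tangent_map A B \<psi> p Y) = (\<mu> p)\<^sup>2 * g p X Y)"

definition vertical_field ::
  "('a, 'm::finite) chart set \<Rightarrow> ('b, 'n::finite) chart set \<Rightarrow> ('a \<Rightarrow> 'b) \<Rightarrow>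
   ('a \<Rightarrow> real ^ 'm) \<Rightarrow> bool" where
  "vertical_field A B \<psi> X \<longleftrightarrow> (\<forall>p. X p \<in> vertical_space A B \<psi> p)"

text \<open>A local orthonormal frame \<open>e 1, \<dots>, e m\<close> on \<open>W\<close>, with \<open>m = CARD('m)\<close> and \<open>n = CARD('n)\<close>,
  whose first \<open>n\<close> members are horizontal and whose remaining members are vertical.\<close>

definition adapted_frame ::
  "('a::{t2_space, second_countable_topology}, 'm::finite) chart set \<Rightarrow> ('a, 'm) metric_tensor \<Rightarrow>
   ('b, 'n::finite) chart set \<Rightarrow> ('a \<Rightarrow> 'b) \<Rightarrow> 'a set \<Rightarrow> (nat \<Rightarrow> 'a \<Rightarrow> real ^ 'm) \<Rightarrow> bool" where
  "adapted_frame A g B \<psi> W e \<longleftrightarrow> open W \<and>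
     (\<forall>i\<in>{1..CARD('m)}. smooth_field_on A W (e i)) \<and>
     (\<forall>p\<in>W.
        (\<forall>i\<in>{1..CARD('m)}. \<forall>j\<in>{1..CARD('m)}. g p (e i p) (e j p) = (if i = j then 1 else 0)) \<and>
        (\<forall>i\<in>{1..CARD('n)}. e i p \<in> horizontal_space A g B \<psi> p) \<and>
        (\<forall>i\<in>{CARD('n)+1..CARD('m)}. e i p \<in> vertical_space A B \<psi> p))"

text \<open>The value at \<open>p\<close> of the mean curvature vector of the fibers, computed with the frame \<open>e\<close>.
  It is the same for all adapted frames around \<open>p\<close>. The type argument carries \<open>n = CARD('n)\<close>.\<close>

definition fiber_mean_curvature ::
  "('a, 'm::finite) chart set \<Rightarrow> ('a, 'm) metric_tensor \<Rightarrow> 'n::finite itself \<Rightarrow>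
   (nat \<Rightarrow> 'a \<Rightarrow> real ^ 'm) \<Rightarrow> 'a \<Rightarrow> real ^ 'm" where
  "fiber_mean_curvature A g _ e p =
     (1 / (real CARD('m) - real CARD('n))) *\<^sub>R
       (\<Sum>j\<in>{1..CARD('n)}. \<Sum>i\<in>{CARD('n)+1..CARD('m)}.
          g p (levi_civita A g (e i) (e i) p) (e j p) *\<^sub>R e j p)"

definition minimal_fibers ::
  "('a::{t2_space, second_countable_topology}, 'm::finite) chart set \<Rightarrow> ('a, 'm) metric_tensor \<Rightarrow>
   ('b::{t2_space, second_countable_topology}, 'n::finite) chart set \<Rightarrow> ('a \<Rightarrow> 'b) \<Rightarrow> bool" where
  "minimal_fibers A g B \<psi> \<longleftrightarrow>
     (\<forall>W e. adapted_frame A g B \<psi> W e \<longrightarrow>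
        (\<forall>p\<in>W. fiber_mean_curvature A g TYPE('n) e p = 0))"

end

theory Submission
  imports Defs
begin

text \<open>
  Compute in charts, with \<open>u\<close> the map, \<open>G\<close>, \<open>H\<close> the metrics and \<open>M = \<mu>\<^sup>2\<close>. Since \<open>|d\<psi>|\<^sup>2 = n M\<close>,
  varying \<open>u\<close> by \<open>t \<phi> w\<close> with a bump function \<open>\<phi>\<close> and a constant vector \<open>w\<close> turns
  \<open>\<alpha>\<close>-harmonicity into a pointwise divergence equation for the adjoint field \<open>du\<^sup>* w\<close>.
  Horizontal conformality says \<open>du (du\<^sup>* w) = M w\<close>; its derivative, cyclically permuted as in the
  Koszul formula, determines the horizontal part of the second derivative of \<open>u\<close>. Subtracting this part
  from the divergence equation leaves the trace over the vertical directions, which is the mean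
  curvature: for horizontal \<open>X\<close>,
  \<open>(m - n) M g(H, X) = ((\<alpha> - 1) n M / (1 + n M) + 1 - n / 2) dM(X)\<close>.
  The coefficient is negative because \<open>n > 2 \<alpha>\<close>, so \<open>H = 0\<close> exactly when \<open>dM\<close> vanishes on
  horizontal vectors.
\<close>

section \<open>Calculus of smooth functions\<close>

text \<open>Conformality is given only on horizontal vectors, and the horizontal spaces move with
  the point. In the form du (du* w) = M w it holds on an open set for each constant vector w of the
  target chart, so it can be differentiated without extending vectors to horizontal fields. As the
  perturbations have constant directions in a target chart, neither a connection on N nor the
  tension field occurs; the derivative of \<open>H\<close> that they produce cancels against the one
  coming from conformality.

  In the coefficient, (\<alpha> - 1) n M / (1 + n M) is the logarithmic derivative of the weight (1
  + n M)^(\<alpha> - 1). For X = e_a each of the n horizontal frame vectors contributes - dM(e_a) /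
  2, and e_a itself contributes dM(e_a) besides.

  Two global points remain. Compactness makes the density of \<psi> integrable, so that the energy
  of a variation supported in a chart is a constant plus an integral over a box. Minimality speaks
  about all adapted frames, so drawing a conclusion from it requires such a frame around every
  point.\<close>

lemma frechet_derivative_has_derivative:
  "f differentiable (at x) \<Longrightarrow> (f has_derivative frechet_derivative f (at x)) (at x)"
  using frechet_derivative_works by blast

lemma frechet_derivative_eq: "(f has_derivative f') (at x) \<Longrightarrow> frechet_derivative f (at x) = f'"
  using frechet_derivative_at by blast

lemma differentiable_cong_open:
  assumes "f differentiable (at x)" "open S" "x \<in> S" "\<And>y. y \<in> S \<Longrightarrow> f y = g y"
  shows "g differentiable (at x)" "frechet_derivative g (at x) = frechet_derivative f (at x)"
proof -
  have "(g has_derivative frechet_derivative f (at x)) (at x)"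
    using has_derivative_transform_within_open[OF frechet_derivative_has_derivative[OF assms(1)]] assms(2-)
    by blast
  then show "g differentiable (at x)" "frechet_derivative g (at x) = frechet_derivative f (at x)"
    using frechet_derivative_eq by (auto simp: differentiable_def)
qed

section \<open>Locality of the classes C^k, algebraic operations and composition\<close>

lemma Ck_on_cong:
  assumes "Ck_on k S f" "open S" "\<And>y. y \<in> S \<Longrightarrow> f y = g y"
  shows "Ck_on k S g"
  using assms
proof (induction k arbitrary: f g)
  case 0
  then show ?case by (simp cong: continuous_on_cong)
next
  case (Suc k)
  have d: "f differentiable (at x)" if "x \<in> S" for x
    using Suc.prems that by auto
  have 1: "g differentiable (at x)" "frechet_derivative g (at x) = frechet_derivative f (at x)"
    if "x \<in> S" for x
    using differentiable_cong_open[OF d[OF that] Suc.prems(2) that Suc.prems(3)] by blast+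
  have "Ck_on k S (\<lambda>x. frechet_derivative g (at x) v)" for v
    by (rule Suc.IH[of "\<lambda>x. frechet_derivative f (at x) v"]) (use Suc.prems 1 in auto)
  then show ?case using 1 by simp
qed

lemma Ck_on_subset: "Ck_on k S f \<Longrightarrow> T \<subseteq> S \<Longrightarrow> Ck_on k T f"
  by (induction k arbitrary: f) (auto intro: continuous_on_subset)

text \<open>Derivatives in \<open>Ck_on\<close> are taken in full neighbourhoods, so being of class
  C^k is local. This is what makes functions glued from two formulas smooth: cut-off fields, and
  perturbed maps continued by the old map.\<close>

lemma Ck_on_local:
  assumes "\<And>x. x \<in> S \<Longrightarrow> \<exists>T. open T \<and> x \<in> T \<and> Ck_on k T f"
  shows "Ck_on k S f"
  using assms
proof (induction k arbitrary: f)
  case 0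
  have "continuous (at x within S) f" if x: "x \<in> S" for x
  proof -
    obtain T where T: "open T" "x \<in> T" "continuous_on T f" using 0[OF x] by auto
    then show ?thesis
      using continuous_on_eq_continuous_at continuous_at_imp_continuous_at_within by blast
  qed
  then show ?case by (simp add: continuous_on_eq_continuous_within)
next
  case (Suc k)
  have "f differentiable (at x)" if "x \<in> S" for x
    using Suc.prems[OF that] by auto
  moreover have "Ck_on k S (\<lambda>x. frechet_derivative f (at x) v)" for v
  proof (rule Suc.IH)
    fix x assume "x \<in> S"
    then obtain T where "open T" "x \<in> T" "Ck_on (Suc k) T f" using Suc.prems by blast
    then show "\<exists>T. open T \<and> x \<in> T \<and> Ck_on k T (\<lambda>x. frechet_derivative f (at x) v)" by auto
  qed
  ultimately show ?case by simp
qed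

lemma Ck_on_imp_continuous_on: "Ck_on k S f \<Longrightarrow> continuous_on S f"
proof (cases k)
  case (Suc n)
  assume "Ck_on k S f"
  then have "isCont f x" if "x \<in> S" for x
    using that Suc differentiable_imp_continuous_within by auto
  then show ?thesis by (simp add: continuous_at_imp_continuous_on)
qed simp

lemma Ck_on_SucD: "Ck_on (Suc k) S f \<Longrightarrow> Ck_on k S f"
proof (induction k arbitrary: f)
  case 0
  then show ?case using Ck_on_imp_continuous_on[of "Suc 0"] by (simp del: Ck_on.simps(2))
qed auto

lemma Ck_on_const: "Ck_on k S (\<lambda>x. c)"
  by (induction k arbitrary: c) auto

lemma Ck_on_bounded_linear:
  assumes "bounded_linear f"
  shows "Ck_on k S f"
proof (cases k)
  case 0
  then show ?thesis using linear_continuous_on[OF assms] by simp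
next
  case (Suc n)
  have "frechet_derivative f (at x) = f" for x
    by (rule frechet_derivative_eq) (rule bounded_linear_imp_has_derivative[OF assms])
  then show ?thesis
    using Suc Ck_on_const bounded_linear_imp_differentiable[OF assms] by auto
qed

lemma Ck_on_add:
  assumes "open S" "Ck_on k S f" "Ck_on k S g"
  shows "Ck_on k S (\<lambda>x. f x + g x)"
  using assms(2-)
proof (induction k arbitrary: f g)
  case 0
  then show ?case by (simp add: continuous_on_add)
next
  case (Suc k)
  have d: "((\<lambda>x. f x + g x) has_derivative
      (\<lambda>v. frechet_derivative f (at x) v + frechet_derivative g (at x) v)) (at x)" if "x \<in> S" for x
    using Suc.prems that
    by (intro has_derivative_add frechet_derivative_has_derivative) auto
  have "Ck_on k S (\<lambda>x. frechet_derivative f (at x) v + frechet_derivative g (at x) v)" for v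
    using Suc by auto
  then have "Ck_on k S (\<lambda>x. frechet_derivative (\<lambda>x. f x + g x) (at x) v)" for v
    by (rule Ck_on_cong[OF _ \<open>open S\<close>]) (simp add: frechet_derivative_eq[OF d])
  then show ?case using d by (auto simp: differentiable_def)
qed

text \<open>By the product rule the derivative is a sum of products of the same kind with one factor
  undifferentiated; that factor is needed one order lower, which \<open>Ck_on_SucD\<close> supplies.
  Scalar multiples, inner products and matrices acting on vectors are all instances.\<close>

lemma Ck_on_bilinear:
  assumes "bounded_bilinear b" "open S" "Ck_on k S f" "Ck_on k S g"
  shows "Ck_on k S (\<lambda>x. b (f x) (g x))"
  using assms(3-)
proof (induction k arbitrary: f g)
  case 0
  then show ?case using bounded_bilinear.continuous_on[OF assms(1)] by simp
next
  case (Suc k)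
  have d: "((\<lambda>x. b (f x) (g x)) has_derivative
      (\<lambda>v. b (f x) (frechet_derivative g (at x) v) + b (frechet_derivative f (at x) v) (g x))) (at x)"
    if "x \<in> S" for x
    using Suc.prems that
    by (intro bounded_bilinear.FDERIV[OF assms(1)] frechet_derivative_has_derivative) auto
  have "Ck_on k S (\<lambda>x. b (f x) (frechet_derivative g (at x) v) +
      b (frechet_derivative f (at x) v) (g x))" for v
    using Suc.prems Suc.prems[THEN Ck_on_SucD] by (intro Ck_on_add[OF \<open>open S\<close>] Suc.IH) auto
  then have "Ck_on k S (\<lambda>x. frechet_derivative (\<lambda>x. b (f x) (g x)) (at x) v)" for v
    by (rule Ck_on_cong[OF _ \<open>open S\<close>]) (simp add: frechet_derivative_eq[OF d])
  then show ?case using d by (auto simp: differentiable_def)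
qed

lemma Ck_on_linear_comp:
  assumes "bounded_linear L" "open S" "Ck_on k S f"
  shows "Ck_on k S (\<lambda>x. L (f x))"
  using assms(3)
proof (induction k arbitrary: f)
  case 0
  then show ?case using continuous_on_compose2[OF linear_continuous_on[OF assms(1)]] by auto
next
  case (Suc k)
  have d: "((\<lambda>x. L (f x)) has_derivative (\<lambda>v. L (frechet_derivative f (at x) v))) (at x)"
    if "x \<in> S" for x
    using Suc.prems that
    by (intro bounded_linear.has_derivative[OF assms(1)] frechet_derivative_has_derivative) auto
  have "Ck_on k S (\<lambda>x. L (frechet_derivative f (at x) v))" for v
    using Suc by auto
  then have "Ck_on k S (\<lambda>x. frechet_derivative (\<lambda>x. L (f x)) (at x) v)" for v
    by (rule Ck_on_cong[OF _ \<open>open S\<close>]) (simp add: frechet_derivative_eq[OF d])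
  then show ?case using d by (auto simp: differentiable_def)
qed

lemma Ck_on_sum:
  assumes "open S" "\<And>i. i \<in> I \<Longrightarrow> Ck_on k S (f i)"
  shows "Ck_on k S (\<lambda>x. \<Sum>i\<in>I. f i x)"
  using assms(2)
  by (induction I rule: infinite_finite_induct) (auto intro!: Ck_on_const Ck_on_add[OF assms(1)])

text \<open>In the chain rule the derivative of \<open>f\<close> is applied to a direction that
  moves with the point, whereas \<open>Ck_on\<close> controls fixed directions. Expanding the
  direction in \<open>Basis\<close> repairs this, which is why the middle space is
  Euclidean.\<close>

lemma Ck_on_compose:
  fixes g :: "'a::real_normed_vector \<Rightarrow> 'b::euclidean_space" and f :: "'b \<Rightarrow> 'c::real_normed_vector"
  assumes "open S" "g ` S \<subseteq> T" "Ck_on k T f" "Ck_on k S g"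
  shows "Ck_on k S (\<lambda>x. f (g x))"
  using assms(3-)
proof (induction k arbitrary: f)
  case 0
  then show ?case using continuous_on_compose2[of T f S g] assms(2) by simp
next
  case (Suc k)
  have d: "((\<lambda>x. f (g x)) has_derivative
      (\<lambda>v. frechet_derivative f (at (g x)) (frechet_derivative g (at x) v))) (at x)" if "x \<in> S" for x
    using Suc.prems that assms(2)
    by (intro has_derivative_compose[of g _ x UNIV f, simplified] frechet_derivative_has_derivative) auto
  have lin: "frechet_derivative f (at (g x)) w =
      (\<Sum>b\<in>Basis. (w \<bullet> b) *\<^sub>R frechet_derivative f (at (g x)) b)" if "x \<in> S" for x w
  proof -
    have "linear (frechet_derivative f (at (g x)))"
      using Suc.prems(1) that assms(2) by (intro linear_frechet_derivative) auto
    then have "frechet_derivative f (at (g x)) (\<Sum>b\<in>Basis. (w \<bullet> b) *\<^sub>R b) =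
      (\<Sum>b\<in>Basis. (w \<bullet> b) *\<^sub>R frechet_derivative f (at (g x)) b)"
      by (simp add: linear_sum linear_cmul)
    then show ?thesis by (simp add: euclidean_representation)
  qed
  have g: "Ck_on k S g" by (rule Ck_on_SucD[OF Suc.prems(2)])
  have "Ck_on k S (\<lambda>x. \<Sum>b\<in>Basis. (frechet_derivative g (at x) v \<bullet> b) *\<^sub>R
      frechet_derivative f (at (g x)) b)" for v
    using Suc.prems
    by (intro Ck_on_sum[OF \<open>open S\<close>] Ck_on_bilinear[OF bounded_bilinear_scaleR \<open>open S\<close>]
        Ck_on_linear_comp[OF bounded_linear_inner_left \<open>open S\<close>] Suc.IH g) auto
  then have "Ck_on k S (\<lambda>x. frechet_derivative (\<lambda>x. f (g x)) (at x) v)" for v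
    by (rule Ck_on_cong[OF _ \<open>open S\<close>])
      (use lin in \<open>auto simp: frechet_derivative_eq[OF d]\<close>)
  then show ?case using d by (auto simp: differentiable_def)
qed

section \<open>The same rules for smooth functions, and smoothness by coordinates\<close>

lemma smooth_on_cong:
  "smooth_on S f \<Longrightarrow> open S \<Longrightarrow> (\<And>y. y \<in> S \<Longrightarrow> f y = g y) \<Longrightarrow> smooth_on S g"
  unfolding smooth_on_def using Ck_on_cong by blast

lemma smooth_on_subset: "smooth_on S f \<Longrightarrow> T \<subseteq> S \<Longrightarrow> smooth_on T f"
  unfolding smooth_on_def using Ck_on_subset by blast

lemma smooth_on_local:
  assumes "\<And>x. x \<in> S \<Longrightarrow> \<exists>T. open T \<and> x \<in> T \<and> smooth_on T f"
  shows "smooth_on S f"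
  unfolding smooth_on_def by (intro allI Ck_on_local) (use assms smooth_on_def in blast)

lemma smooth_on_imp_continuous_on: "smooth_on S f \<Longrightarrow> continuous_on S f"
  unfolding smooth_on_def using Ck_on_imp_continuous_on by blast

lemma smooth_on_imp_differentiable: "smooth_on S f \<Longrightarrow> x \<in> S \<Longrightarrow> f differentiable (at x)"
  unfolding smooth_on_def by (drule spec[of _ "Suc 0"]) auto

lemma smooth_on_has_derivative:
  "smooth_on S f \<Longrightarrow> x \<in> S \<Longrightarrow> (f has_derivative frechet_derivative f (at x)) (at x)"
  by (rule frechet_derivative_has_derivative[OF smooth_on_imp_differentiable])

lemma smooth_on_linear: "smooth_on S f \<Longrightarrow> x \<in> S \<Longrightarrow> linear (frechet_derivative f (at x))"
  by (rule linear_frechet_derivative[OF smooth_on_imp_differentiable])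

lemma smooth_on_frechet_derivative:
  "smooth_on S f \<Longrightarrow> smooth_on S (\<lambda>x. frechet_derivative f (at x) v)"
  unfolding smooth_on_def by (metis Ck_on.simps(2))

lemma smooth_on_const: "smooth_on S (\<lambda>x. c)"
  by (simp add: smooth_on_def Ck_on_const)

lemma smooth_on_bounded_linear: "bounded_linear f \<Longrightarrow> smooth_on S f"
  by (simp add: smooth_on_def Ck_on_bounded_linear)

lemma smooth_on_ident: "smooth_on S (\<lambda>x. x)"
  by (rule smooth_on_bounded_linear) (rule bounded_linear_ident)

lemma smooth_on_linear_comp:
  "bounded_linear L \<Longrightarrow> open S \<Longrightarrow> smooth_on S f \<Longrightarrow> smooth_on S (\<lambda>x. L (f x))"
  by (simp add: smooth_on_def Ck_on_linear_comp)

lemma smooth_on_bilinear: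
  "bounded_bilinear b \<Longrightarrow> open S \<Longrightarrow> smooth_on S f \<Longrightarrow> smooth_on S g \<Longrightarrow> smooth_on S (\<lambda>x. b (f x) (g x))"
  by (simp add: smooth_on_def Ck_on_bilinear)

lemma smooth_on_add:
  "open S \<Longrightarrow> smooth_on S f \<Longrightarrow> smooth_on S g \<Longrightarrow> smooth_on S (\<lambda>x. f x + g x)"
  by (simp add: smooth_on_def Ck_on_add)

lemma smooth_on_minus:
  "open S \<Longrightarrow> smooth_on S f \<Longrightarrow> smooth_on S (\<lambda>x. - f x)"
  by (rule smooth_on_linear_comp[OF bounded_linear_minus[OF bounded_linear_ident]])

lemma smooth_on_diff:
  "open S \<Longrightarrow> smooth_on S f \<Longrightarrow> smooth_on S g \<Longrightarrow> smooth_on S (\<lambda>x. f x - g x)"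
  using smooth_on_add[of S f "\<lambda>x. - g x"] smooth_on_minus by auto

lemma smooth_on_sum:
  "open S \<Longrightarrow> (\<And>i. i \<in> I \<Longrightarrow> smooth_on S (f i)) \<Longrightarrow> smooth_on S (\<lambda>x. \<Sum>i\<in>I. f i x)"
  by (simp add: smooth_on_def Ck_on_sum)

lemmas smooth_on_scaleR = smooth_on_bilinear[OF bounded_bilinear_scaleR]
  and smooth_on_inner = smooth_on_bilinear[OF bounded_bilinear_inner]
  and smooth_on_mult = smooth_on_bilinear[OF bounded_bilinear_mult]

lemma smooth_on_prod:
  fixes f :: "'i \<Rightarrow> 'a::real_normed_vector \<Rightarrow> real"
  assumes "open S" "\<And>i. i \<in> I \<Longrightarrow> smooth_on S (f i)"
  shows "smooth_on S (\<lambda>x. \<Prod>i\<in>I. f i x)"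
  using assms(2)
proof (induction I rule: infinite_finite_induct)
  case (insert i I)
  have "smooth_on S (\<lambda>x. f i x * (\<Prod>i\<in>I. f i x))"
    using insert by (intro smooth_on_mult[OF assms(1)]) auto
  then show ?case using insert by simp
qed (simp_all add: smooth_on_const)

lemma smooth_on_compose:
  fixes g :: "'a::real_normed_vector \<Rightarrow> 'b::euclidean_space"
  shows "open S \<Longrightarrow> g ` S \<subseteq> T \<Longrightarrow> smooth_on T f \<Longrightarrow> smooth_on S g \<Longrightarrow> smooth_on S (\<lambda>x. f (g x))"
  unfolding smooth_on_def using Ck_on_compose by blast

lemma smooth_on_vec_nth:
  "open S \<Longrightarrow> smooth_on S f \<Longrightarrow> smooth_on S (\<lambda>x. f x $ i)"
  by (rule smooth_on_linear_comp[OF bounded_linear_vec_nth])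

lemma smooth_on_vec_lambda:
  fixes f :: "'a::real_normed_vector \<Rightarrow> 'i::finite \<Rightarrow> 'b::real_normed_vector"
  assumes "open S" "\<And>i. smooth_on S (\<lambda>x. f x i)"
  shows "smooth_on S (\<lambda>x. \<chi> i. f x i)"
proof -
  have eq: "(\<chi> i. f x i) = (\<Sum>i\<in>UNIV. axis i (f x i))" for x
    by (simp add: vec_eq_iff axis_def sum.delta)
  have "bounded_linear (\<lambda>y::'b. axis i y :: 'b ^ 'i)" for i :: 'i
  proof (rule bounded_linear_intro[of _ 1])
    have "(\<Sum>j\<in>UNIV. (norm (if j = i then y else 0))\<^sup>2) = (norm y)\<^sup>2" for y :: 'b
    proof -
      have "(\<Sum>j\<in>UNIV. (norm (if j = i then y else 0))\<^sup>2) = (\<Sum>j\<in>UNIV. if j = i then (norm y)\<^sup>2 else 0)"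
        by (rule sum.cong) auto
      then show ?thesis by simp
    qed
    then show "norm (axis i y :: 'b ^ 'i) \<le> norm y * 1" for y
      by (simp add: norm_vec_def L2_set_def axis_def)
  qed (auto simp: vec_eq_iff axis_def)
  then show ?thesis unfolding eq
    by (intro smooth_on_sum assms(1) smooth_on_linear_comp[OF _ assms])
qed

lemma smooth_on_vecI:
  fixes f :: "'a::real_normed_vector \<Rightarrow> 'b::real_normed_vector ^ 'i"
  shows "open S \<Longrightarrow> (\<And>i. smooth_on S (\<lambda>x. f x $ i)) \<Longrightarrow> smooth_on S f"
  using smooth_on_vec_lambda[of S "\<lambda>x i. f x $ i"] by simp

section \<open>Powers, inverses and square roots of positive functions\<close>

text \<open>Induction step for families of real functions whose derivatives are combinations of
  members of the family: the real powers and the flat functions.\<close>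

lemma Ck_on_real_derivative:
  fixes f :: "real \<Rightarrow> real"
  assumes "open S" "\<And>x. x \<in> S \<Longrightarrow> (f has_real_derivative f' x) (at x)" "Ck_on k S f'"
  shows "Ck_on (Suc k) S f"
proof -
  have "f differentiable (at x)" if "x \<in> S" for x
    by (rule differentiableI[OF has_field_derivative_imp_has_derivative[OF assms(2)[OF that]]])
  moreover have "frechet_derivative f (at x) v = f' x * v" if "x \<in> S" for x v
    by (rule fun_cong[OF frechet_derivative_eq[OF has_field_derivative_imp_has_derivative[OF assms(2)[OF that]]]])
  then have "Ck_on k S (\<lambda>x. frechet_derivative f (at x) v)" for v
    by (intro Ck_on_cong[OF Ck_on_bilinear[OF bounded_bilinear_mult assms(1,3) Ck_on_const[of k S v]]
          assms(1)]) simp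
  ultimately show ?thesis by simp
qed

text \<open>The exponent is general in the induction because differentiation lowers it by one.
  Inverse and square root are then the exponents -1 and 1/2.\<close>

lemma smooth_on_powr: "smooth_on {0<..} (\<lambda>x::real. x powr a)"
proof -
  have "Ck_on k {0<..} (\<lambda>x::real. x powr a)" for k
  proof (induction k arbitrary: a)
    case 0
    have "isCont (\<lambda>x. x powr a) x" if "0 < x" for x :: real
      using that by (intro continuous_intros) auto
    then show ?case by (simp add: continuous_at_imp_continuous_on)
  next
    case (Suc k)
    have "((\<lambda>x. x powr a) has_real_derivative a * x powr (a - 1)) (at x)" if "x \<in> {0<..}" for x :: real
      using that by (auto intro!: has_real_derivative_powr)
    then show ?case
      using Ck_on_real_derivative[OF open_greaterThan _ Ck_on_bilinear[OF bounded_bilinear_mult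
            open_greaterThan Ck_on_const Suc]] by blast
  qed
  then show ?thesis by (simp add: smooth_on_def)
qed

lemma smooth_on_powr_compose:
  fixes f :: "'a::real_normed_vector \<Rightarrow> real"
  assumes "open S" "smooth_on S f" "\<And>x. x \<in> S \<Longrightarrow> 0 < f x"
  shows "smooth_on S (\<lambda>x. f x powr a)"
  by (rule smooth_on_compose[OF assms(1) _ smooth_on_powr assms(2)]) (use assms(3) in auto)

lemma smooth_on_inverse:
  fixes f :: "'a::real_normed_vector \<Rightarrow> real"
  assumes "open S" "smooth_on S f" "\<And>x. x \<in> S \<Longrightarrow> 0 < f x"
  shows "smooth_on S (\<lambda>x. inverse (f x))"
  by (rule smooth_on_cong[OF smooth_on_powr_compose[OF assms, where a="-1"] assms(1)])
    ((assumption | metis assms(3) less_imp_le powr_minus powr_one)+)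

lemma smooth_on_sqrt:
  fixes f :: "'a::real_normed_vector \<Rightarrow> real"
  assumes "open S" "smooth_on S f" "\<And>x. x \<in> S \<Longrightarrow> 0 < f x"
  shows "smooth_on S (\<lambda>x. sqrt (f x))"
  by (rule smooth_on_cong[OF smooth_on_powr_compose[OF assms, where a="1/2"] assms(1)])
    ((assumption | metis assms(3) less_imp_le powr_half_sqrt)+)

section \<open>Positive definite matrices\<close>

text \<open>A metric read in a chart. Positivity is kept apart in \<open>spd\<close>, because the
  form is also taken for derivatives of metrics.\<close>

definition mform :: "real ^ 'm ^ 'm \<Rightarrow> real ^ 'm \<Rightarrow> real ^ 'm \<Rightarrow> real" where
  "mform G v w = v \<bullet> (G *v w)"

definition spd :: "real ^ 'm ^ 'm \<Rightarrow> bool" where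
  "spd G \<longleftrightarrow> (\<forall>v w. mform G v w = mform G w v) \<and> (\<forall>v. v \<noteq> 0 \<longrightarrow> 0 < mform G v v)"

text \<open>The index set is arbitrary, so that frames numbered by \<open>{1..m}\<close> and bases
  indexed by the coordinate type are treated alike.\<close>

definition orthonormal_on :: "real ^ 'm ^ 'm \<Rightarrow> 'i set \<Rightarrow> ('i \<Rightarrow> real ^ 'm) \<Rightarrow> bool" where
  "orthonormal_on G I e \<longleftrightarrow> (\<forall>i\<in>I. \<forall>j\<in>I. mform G (e i) (e j) = (if i = j then 1 else 0))"

lemma bounded_bilinear_matrix_vector:
  "bounded_bilinear ((*v) :: real ^ 'm::finite ^ 'n::finite \<Rightarrow> real ^ 'm \<Rightarrow> real ^ 'n)"
  unfolding bilinear_conv_bounded_bilinear[symmetric] bilinear_def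
  by (intro conjI allI linearI)
    (vector matrix_vector_mult_def sum.distrib algebra_simps sum_distrib_left)+

interpretation matrix_vector: bounded_bilinear
  "(*v) :: real ^ 'm::finite ^ 'n::finite \<Rightarrow> real ^ 'm \<Rightarrow> real ^ 'n"
  by (rule bounded_bilinear_matrix_vector)

lemma mform_simps:
  fixes v w :: "real ^ 'm::finite"
  shows "mform G (v + v') w = mform G v w + mform G v' w"
    "mform G v (w + w') = mform G v w + mform G v w'"
    "mform G (v - v') w = mform G v w - mform G v' w"
    "mform G v (w - w') = mform G v w - mform G v w'"
    "mform G (c *\<^sub>R v) w = c * mform G v w"
    "mform G v (c *\<^sub>R w) = c * mform G v w"
    "mform G 0 w = 0" "mform G v 0 = 0"
    "mform G (- v) w = - mform G v w" "mform G v (- w) = - mform G v w"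
  by (simp_all add: mform_def inner_simps matrix_vector.add_right matrix_vector.diff_right
      matrix_vector.scaleR_right matrix_vector.minus_right)

lemma mform_sum:
  fixes f :: "'i \<Rightarrow> real ^ 'm::finite"
  shows "mform G (\<Sum>i\<in>I. f i) w = (\<Sum>i\<in>I. mform G (f i) w)"
    "mform G v (\<Sum>i\<in>I. f i) = (\<Sum>i\<in>I. mform G v (f i))"
  by (induction I rule: infinite_finite_induct) (auto simp: mform_simps)

lemma mform_scaleR_matrix:
  fixes v w :: "real ^ 'm::finite"
  shows "mform (c *\<^sub>R G) v w = c * mform G v w"
  by (simp add: mform_def matrix_vector.scaleR_left)

lemma mform_axis: "mform G (axis k 1) (axis l 1) = G $ k $ l"
  by (simp add: mform_def inner_axis' matrix_vector_mul_component inner_axis)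

lemma spd_sym: "spd G \<Longrightarrow> mform G v w = mform G w v"
  by (simp add: spd_def)

lemma spd_pos: "spd G \<Longrightarrow> v \<noteq> 0 \<Longrightarrow> 0 < mform G v v"
  by (simp add: spd_def)

lemma bilinear_mform: "bilinear (mform G)" for G :: "real ^ 'm::finite ^ 'm"
  unfolding bilinear_def by (auto intro!: linearI simp: mform_simps)

lemma bilinear_expand:
  fixes Q :: "real ^ 'm::finite \<Rightarrow> real ^ 'n::finite \<Rightarrow> real"
  assumes "bilinear Q"
  shows "Q v w = (\<Sum>k\<in>UNIV. \<Sum>l\<in>UNIV. v $ k * w $ l * Q (axis k 1) (axis l 1))"
proof -
  have "Q v w = Q (\<Sum>k\<in>UNIV. v $ k *\<^sub>R axis k 1) (\<Sum>l\<in>UNIV. w $ l *\<^sub>R axis l 1)"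
    using basis_expansion[of v] basis_expansion[of w] by (simp add: scalar_mult_eq_scaleR)
  also have "\<dots> = (\<Sum>(k, l)\<in>UNIV \<times> UNIV. Q (v $ k *\<^sub>R axis k 1) (w $ l *\<^sub>R axis l 1))"
    by (rule bilinear_sum[OF assms])
  also have "\<dots> = (\<Sum>k\<in>UNIV. \<Sum>l\<in>UNIV. Q (v $ k *\<^sub>R axis k 1) (w $ l *\<^sub>R axis l 1))"
    by (simp add: sum.cartesian_product)
  finally show ?thesis
    by (simp add: bilinear_lmul[OF assms] bilinear_rmul[OF assms] mult_ac)
qed

lemma linear_expand:
  fixes L :: "real ^ 'm::finite \<Rightarrow> 'b::real_vector"
  assumes "linear L"
  shows "L v = (\<Sum>k\<in>UNIV. v $ k *\<^sub>R L (axis k 1))"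
proof -
  have "L v = L (\<Sum>k\<in>UNIV. v $ k *\<^sub>R axis k 1)"
    using basis_expansion[of v] by (simp add: scalar_mult_eq_scaleR)
  then show ?thesis by (simp add: linear_sum[OF assms] linear_cmul[OF assms])
qed

lemmas smooth_on_matrix_vector = smooth_on_bilinear[OF bounded_bilinear_matrix_vector]

lemma smooth_on_mform:
  fixes G :: "'a::real_normed_vector \<Rightarrow> real ^ 'm::finite ^ 'm"
  shows "open S \<Longrightarrow> smooth_on S G \<Longrightarrow> smooth_on S v \<Longrightarrow> smooth_on S w \<Longrightarrow>
    smooth_on S (\<lambda>x. mform (G x) (v x) (w x))"
  unfolding mform_def by (intro smooth_on_inner smooth_on_matrix_vector)

lemma has_derivative_mform:
  fixes G :: "'a::real_normed_vector \<Rightarrow> real ^ 'm::finite ^ 'm"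
  assumes "(G has_derivative G') (at x)" "(v has_derivative v') (at x)" "(w has_derivative w') (at x)"
  shows "((\<lambda>x. mform (G x) (v x) (w x)) has_derivative
    (\<lambda>z. mform (G' z) (v x) (w x) + mform (G x) (v' z) (w x) + mform (G x) (v x) (w' z))) (at x)"
proof -
  have "((\<lambda>x. v x \<bullet> (G x *v w x)) has_derivative
     (\<lambda>z. v x \<bullet> (G x *v w' z + G' z *v w x) + v' z \<bullet> (G x *v w x))) (at x)"
    by (intro has_derivative_inner bounded_bilinear.FDERIV[OF bounded_bilinear_matrix_vector] assms)
  then show ?thesis unfolding mform_def by (simp add: inner_add_right algebra_simps)
qed

lemma spd_invertible:
  fixes G :: "real ^ 'm::finite ^ 'm"
  assumes "spd G"
  shows "invertible G" "G ** matrix_inv G = mat 1" "matrix_inv G ** G = mat 1"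
    "G *v (matrix_inv G *v v) = v" "matrix_inv G *v (G *v v) = v" "det G \<noteq> 0"
proof -
  have "x = 0" if "G *v x = 0" for x
    using spd_pos[OF assms, of x] that by (auto simp: mform_def)
  then show i: "invertible G"
    by (meson invertible_left_inverse matrix_left_invertible_ker)
  then show 1: "G ** matrix_inv G = mat 1" and 2: "matrix_inv G ** G = mat 1"
    unfolding invertible_def matrix_inv_def by (metis (mono_tags, lifting) someI_ex)+
  show "G *v (matrix_inv G *v v) = v" "matrix_inv G *v (G *v v) = v"
    by (simp_all add: matrix_vector_mul_assoc 1 2)
  show "det G \<noteq> 0" using i invertible_det_nz by blast
qed

text \<open>The entry at k, l of the inverse is the form of \<open>G\<close> evaluated on the
  columns k and l of the inverse, and that form is symmetric.\<close>

lemma matrix_inv_sym: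
  fixes G :: "real ^ 'm::finite ^ 'm"
  assumes "spd G"
  shows "matrix_inv G $ k $ l = matrix_inv G $ l $ k"
proof -
  let ?a = "matrix_inv G *v axis k 1" and ?b = "matrix_inv G *v axis l 1"
  have "mform G ?a ?b = mform G ?b ?a" by (rule spd_sym[OF assms])
  then have "?a \<bullet> axis l 1 = ?b \<bullet> axis k 1"
    by (simp add: mform_def spd_invertible[OF assms])
  then show ?thesis
    by (simp add: inner_axis matrix_vector_mul_component)
qed

section \<open>Orthonormal systems of a positive definite matrix\<close>

text \<open>Orthonormal vectors are independent, and as many of them as the dimension span the whole
  space; pairing with \<open>e i\<close> then identifies the coefficients.\<close>

lemma orthonormal_expand:
  fixes G :: "real ^ 'm::finite ^ 'm"
  assumes G: "spd G" and o: "orthonormal_on G I e" and I: "finite I" "card I = CARD('m)"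
  shows "v = (\<Sum>i\<in>I. mform G (e i) v *\<^sub>R e i)"
proof -
  have o': "mform G (e i) (e j) = (if i = j then 1 else 0)" if "i \<in> I" "j \<in> I" for i j
    using o that by (simp add: orthonormal_on_def)
  have inj: "inj_on e I"
  proof (rule inj_onI)
    fix i j assume "i \<in> I" "j \<in> I" "e i = e j"
    then show "i = j" using o'[of i i] o'[of i j] by (auto split: if_splits)
  qed
  have "independent (e ` I)"
  proof (rule independent_if_scalars_zero)
    fix c x assume z: "(\<Sum>x\<in>e ` I. c x *\<^sub>R x) = 0" and "x \<in> e ` I"
    then obtain i where i: "i \<in> I" "x = e i" by auto
    have "0 = mform G (e i) (\<Sum>j\<in>I. c (e j) *\<^sub>R e j)"
      using z by (simp add: sum.reindex[OF inj] mform_simps)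
    also have "\<dots> = (\<Sum>j\<in>I. if i = j then c (e j) else 0)"
      unfolding mform_sum mform_simps by (rule sum.cong) (auto simp: o' i)
    finally show "c x = 0" using i I by simp
  qed (use I in simp)
  then have "span (e ` I) = UNIV"
    using card_eq_dim[of "e ` I" UNIV] I by (simp add: card_image[OF inj] top.extremum_unique)
  then obtain c where c: "v = (\<Sum>i\<in>I. c i *\<^sub>R e i)"
  proof -
    assume *: "\<And>c. v = (\<Sum>i\<in>I. c i *\<^sub>R e i) \<Longrightarrow> thesis"
    have "v \<in> span (e ` I)" using \<open>span (e ` I) = UNIV\<close> by simp
    then obtain d where "v = (\<Sum>x\<in>e ` I. d x *\<^sub>R x)"
      using span_finite[of "e ` I"] I by auto
    then show thesis using *[of "d \<circ> e"] by (simp add: sum.reindex[OF inj])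
  qed
  have "mform G (e i) v = c i" if "i \<in> I" for i
  proof -
    have "mform G (e i) v = (\<Sum>j\<in>I. if i = j then c j else 0)"
      unfolding c mform_sum mform_simps by (rule sum.cong) (auto simp: o' that)
    then show ?thesis using that I by simp
  qed
  then show ?thesis using c by simp
qed

text \<open>One Gram-Schmidt step: fewer than m vectors span a proper subspace, and a vector outside
  it minus its projection is nonzero and can be normalised.\<close>

lemma orthonormal_extend:
  fixes G :: "real ^ 'm::finite ^ 'm"
  assumes G: "spd G" and o: "orthonormal_on G {1..k} e" and k: "k < CARD('m)"
  shows "\<exists>v. orthonormal_on G {1..Suc k} (e(Suc k := v))"
proof -
  have o': "mform G (e i) (e j) = (if i = j then 1 else 0)" if "i \<in> {1..k}" "j \<in> {1..k}" for i j
    using o that by (simp add: orthonormal_on_def)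
  have "dim (span (e ` {1..k})) \<le> card (e ` {1..k})"
    by (simp add: dim_le_card')
  also have "\<dots> \<le> k" using card_image_le[of "{1..k}" e] by simp
  finally have "span (e ` {1..k}) \<noteq> UNIV"
    using k by (metis dim_UNIV DIM_cart DIM_real mult.right_neutral linorder_not_le)
  then obtain y where y: "y \<notin> span (e ` {1..k})" by blast
  define z where "z = y - (\<Sum>i\<in>{1..k}. mform G (e i) y *\<^sub>R e i)"
  have "(\<Sum>i\<in>{1..k}. mform G (e i) y *\<^sub>R e i) \<in> span (e ` {1..k})"
    by (intro span_sum span_scale span_base) auto
  then have "z \<noteq> 0" using y by (auto simp: z_def)
  then have pos: "0 < mform G z z" by (rule spd_pos[OF G])
  have orth: "mform G (e i) z = 0" if i: "i \<in> {1..k}" for i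
  proof -
    have "mform G (e i) (\<Sum>j\<in>{1..k}. mform G (e j) y *\<^sub>R e j) =
      (\<Sum>j\<in>{1..k}. if i = j then mform G (e j) y else 0)"
      unfolding mform_sum mform_simps by (rule sum.cong) (auto simp: o'[OF i])
    then show ?thesis using i by (simp add: z_def mform_simps)
  qed
  let ?v = "(1 / sqrt (mform G z z)) *\<^sub>R z"
  have "mform G ?v ?v = mform G z z / (sqrt (mform G z z))\<^sup>2"
    by (simp add: mform_simps power2_eq_square)
  then have "mform G ?v ?v = 1" using pos by simp
  moreover have "mform G (e i) ?v = 0" "mform G ?v (e i) = 0" if "i \<in> {1..k}" for i
    using orth[OF that] spd_sym[OF G] by (auto simp: mform_simps)
  ultimately have "orthonormal_on G {1..Suc k} (e(Suc k := ?v))"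
    unfolding orthonormal_on_def using o' by (auto simp: le_Suc_eq)
  then show ?thesis by blast
qed

text \<open>The given vectors are kept unchanged; this is how a horizontal orthonormal system is
  completed by vertical vectors.\<close>

lemma orthonormal_complete:
  fixes G :: "real ^ 'm::finite ^ 'm"
  assumes G: "spd G" and o: "orthonormal_on G {1..k} e" and k: "k \<le> CARD('m)"
  shows "\<exists>e'. (\<forall>i\<in>{1..k}. e' i = e i) \<and> orthonormal_on G {1..CARD('m)} e'"
proof -
  have "\<exists>e'. (\<forall>i\<in>{1..k}. e' i = e i) \<and> orthonormal_on G {1..k + d} e'" if "k + d \<le> CARD('m)" for d
    using that
  proof (induction d)
    case 0
    then show ?case using o by auto
  next
    case (Suc d)
    then obtain e' where e': "\<forall>i\<in>{1..k}. e' i = e i" "orthonormal_on G {1..k + d} e'" by auto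
    obtain v where "orthonormal_on G {1..Suc (k + d)} (e'(Suc (k + d) := v))"
      using orthonormal_extend[OF G e'(2)] Suc.prems by auto
    then show ?case using e'(1) by (intro exI[of _ "e'(Suc (k + d) := v)"]) (auto simp del: fun_upd_apply simp: fun_upd_other)
  qed
  from this[of "CARD('m) - k"] k show ?thesis by simp
qed

lemma orthonormal_reindex:
  "orthonormal_on G J e \<Longrightarrow> inj_on r I \<Longrightarrow> r ` I \<subseteq> J \<Longrightarrow> orthonormal_on G I (e \<circ> r)"
  unfolding orthonormal_on_def by (simp add: inj_on_eq_iff image_subset_iff)

lemma orthonormal_exists:
  fixes G :: "real ^ 'm::finite ^ 'm"
  assumes "spd G"
  shows "\<exists>e. orthonormal_on G {1..CARD('m)} e" "\<exists>b :: 'm \<Rightarrow> _. orthonormal_on G UNIV b"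
proof -
  have "orthonormal_on G {1..0} e" for e :: "nat \<Rightarrow> real ^ 'm" by (simp add: orthonormal_on_def)
  from orthonormal_complete[OF assms this] obtain e where e: "orthonormal_on G {1..CARD('m)} e"
    by auto
  obtain r :: "'m \<Rightarrow> nat" where "bij_betw r UNIV {1..CARD('m)}"
    using ex_bij_betw_finite_nat[of "UNIV :: 'm set"] ex_bij_betw_nat_finite_1[of "UNIV :: 'm set"]
    by (metis bij_betw_inv finite_class.finite_UNIV)
  with e have "orthonormal_on G UNIV (e \<circ> r)"
    by (intro orthonormal_reindex) (auto simp: bij_betw_def)
  with e show "\<exists>e. orthonormal_on G {1..CARD('m)} e" "\<exists>b :: 'm \<Rightarrow> _. orthonormal_on G UNIV b"
    by blast+
qed

section \<open>Determinants, traces and the inverse matrix\<close>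

text \<open>With the rows of P orthonormal for \<open>G\<close>, the product P G P^T is the
  identity, so det G is the inverse of a square.\<close>

lemma spd_det_pos:
  fixes G :: "real ^ 'm::finite ^ 'm"
  assumes "spd G"
  shows "0 < det G"
proof -
  obtain b :: "'m \<Rightarrow> real ^ 'm" where b: "orthonormal_on G UNIV b"
    using orthonormal_exists(2)[OF assms] by blast
  define P :: "real ^ 'm ^ 'm" where "P = (\<chi> i k. b i $ k)"
  have "(P ** (G ** transpose P)) $ i $ j = mform G (b i) (b j)" for i j
    by (simp add: P_def mform_def matrix_matrix_mult_def matrix_vector_mult_def transpose_def inner_vec_def)
  then have "P ** (G ** transpose P) = mat 1"
    using b by (simp add: vec_eq_iff mat_def orthonormal_on_def)
  then have "det (P ** (G ** transpose P)) = 1" by simp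
  then have "(det P)\<^sup>2 * det G = 1" by (simp add: det_mul det_transpose power2_eq_square mult_ac)
  then show ?thesis by (metis zero_less_mult_pos zero_less_one zero_eq_power2 mult_zero_left
        zero_less_power2 zero_neq_one)
qed

text \<open>The inverse matrix is the sum of the products e_i e_i^T over any orthonormal basis.
  Hence tracing a bilinear form over the basis and contracting it with the inverse metric give the
  same result.\<close>

lemma sum_orthonormal:
  fixes G :: "real ^ 'm::finite ^ 'm"
  assumes G: "spd G" and o: "orthonormal_on G I e" and I: "finite I" "card I = CARD('m)"
    and Q: "bilinear Q"
  shows "(\<Sum>i\<in>I. Q (e i) (e i)) =
    (\<Sum>k\<in>UNIV. \<Sum>l\<in>UNIV. matrix_inv G $ k $ l * Q (axis k 1) (axis l 1) :: real)"
proof -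
  have *: "matrix_inv G $ k $ l = (\<Sum>i\<in>I. e i $ k * e i $ l)" for k l
  proof -
    have "matrix_inv G *v axis l 1 = (\<Sum>i\<in>I. mform G (e i) (matrix_inv G *v axis l 1) *\<^sub>R e i)"
      by (rule orthonormal_expand[OF G o I])
    also have "\<dots> = (\<Sum>i\<in>I. e i $ l *\<^sub>R e i)"
      by (simp add: mform_def spd_invertible[OF G] inner_axis)
    finally have "(matrix_inv G *v axis l 1) $ k = (\<Sum>i\<in>I. e i $ l *\<^sub>R e i) $ k" by simp
    then show ?thesis by (simp add: matrix_vector_mul_component inner_axis mult_ac)
  qed
  have "(\<Sum>i\<in>I. Q (e i) (e i)) =
      (\<Sum>i\<in>I. \<Sum>k\<in>UNIV. \<Sum>l\<in>UNIV. e i $ k * e i $ l * Q (axis k 1) (axis l 1))"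
    by (subst bilinear_expand[OF Q]) simp
  also have "\<dots> = (\<Sum>k\<in>UNIV. \<Sum>l\<in>UNIV. \<Sum>i\<in>I. e i $ k * e i $ l * Q (axis k 1) (axis l 1))"
    by (simp add: sum.swap[where A=I])
  finally show ?thesis by (simp add: * sum_distrib_right)
qed

text \<open>Contracting the form G(v, L w) with the inverse metric cancels \<open>G\<close> and
  leaves the coordinate trace of \<open>L\<close>. This converts a coordinate divergence into a sum
  over a frame.\<close>

lemma trace_orthonormal:
  fixes G :: "real ^ 'm::finite ^ 'm"
  assumes G: "spd G" and o: "orthonormal_on G I e" and I: "finite I" "card I = CARD('m)"
    and L: "linear L"
  shows "(\<Sum>i\<in>I. mform G (e i) (L (e i))) = (\<Sum>j\<in>UNIV. L (axis j 1) $ j)"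
proof -
  have "bilinear (\<lambda>v w. mform G v (L w))"
    unfolding bilinear_def
    by (auto intro!: linearI simp: mform_simps linear_add[OF L] linear_cmul[OF L])
  then have "(\<Sum>i\<in>I. mform G (e i) (L (e i))) =
      (\<Sum>k\<in>UNIV. \<Sum>l\<in>UNIV. matrix_inv G $ k $ l * mform G (axis k 1) (L (axis l 1)))"
    by (rule sum_orthonormal[OF G o I])
  also have "\<dots> = (\<Sum>l\<in>UNIV. \<Sum>k\<in>UNIV. matrix_inv G $ k $ l * mform G (axis k 1) (L (axis l 1)))"
    by (rule sum.swap)
  also have "\<dots> = (\<Sum>l\<in>UNIV. (matrix_inv G *v (G *v L (axis l 1))) $ l)"
  proof (rule sum.cong[OF refl])
    fix l
    show "(\<Sum>k\<in>UNIV. matrix_inv G $ k $ l * mform G (axis k 1) (L (axis l 1))) =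
      (matrix_inv G *v (G *v L (axis l 1))) $ l"
      by (subst matrix_vector_mult_def[of "matrix_inv G"])
        (simp add: mform_def inner_axis' matrix_inv_sym[OF G, of _ l])
  qed
  finally show ?thesis by (simp add: spd_invertible[OF G])
qed

lemma smooth_on_det:
  fixes G :: "'a::real_normed_vector \<Rightarrow> real ^ 'm::finite ^ 'm"
  assumes "open S" "\<And>i j. smooth_on S (\<lambda>x. G x $ i $ j)"
  shows "smooth_on S (\<lambda>x. det (G x))"
  unfolding det_def
  by (intro smooth_on_sum[OF assms(1)] smooth_on_mult[OF assms(1)] smooth_on_const
      smooth_on_prod[OF assms(1)] assms(2))

lemma smooth_on_matrixI:
  fixes G :: "'a::real_normed_vector \<Rightarrow> real ^ 'm::finite ^ 'k::finite"
  assumes "open S" "\<And>i j. smooth_on S (\<lambda>x. G x $ i $ j)"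
  shows "smooth_on S G"
  by (intro smooth_on_vecI assms)

lemma smooth_on_matrix_nth:
  fixes G :: "'a::real_normed_vector \<Rightarrow> real ^ 'm::finite ^ 'k::finite"
  assumes "open S" "smooth_on S G"
  shows "smooth_on S (\<lambda>x. G x $ i $ j)"
  by (intro smooth_on_vec_nth assms)

text \<open>Cramer's rule writes each entry as a quotient of two determinants, and determinants are
  polynomials in the entries.\<close>

lemma smooth_on_matrix_inv:
  fixes G :: "'a::real_normed_vector \<Rightarrow> real ^ 'm::finite ^ 'm"
  assumes S: "open S" and G: "smooth_on S G" and spd: "\<And>x. x \<in> S \<Longrightarrow> spd (G x)"
  shows "smooth_on S (\<lambda>x. matrix_inv (G x))"
proof (rule smooth_on_matrixI[OF S])
  fix k l
  have *: "det (\<chi> i j. if j = k then (axis l 1 :: real ^ 'm) $ i else G x $ i $ j) * inverse (det (G x)) =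
      matrix_inv (G x) $ k $ l" if "x \<in> S" for x
  proof -
    note inv = spd_invertible[OF spd[OF that]]
    have "matrix_inv (G x) *v axis l 1 =
      (\<chi> k. det (\<chi> i j. if j = k then (axis l 1 :: real ^ 'm) $ i else G x $ i $ j) / det (G x))"
      using cramer[OF inv(6)] inv(4) by blast
    then have "(matrix_inv (G x) *v axis l 1) $ k =
      det (\<chi> i j. if j = k then (axis l 1 :: real ^ 'm) $ i else G x $ i $ j) / det (G x)"
      by simp
    then show ?thesis
      by (simp add: matrix_vector_mul_component inner_axis divide_inverse)
  qed
  have "smooth_on S (\<lambda>x. if j = k then (axis l 1 :: real ^ 'm) $ i else G x $ i $ j)" for i j
    by (cases "j = k") (simp_all add: smooth_on_const smooth_on_matrix_nth[OF S G])
  then have "smooth_on S (\<lambda>x. det (\<chi> i j. if j = k then (axis l 1 :: real ^ 'm) $ i else G x $ i $ j) *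
      inverse (det (G x)))"
    by (intro smooth_on_mult[OF S] smooth_on_det[OF S] smooth_on_inverse[OF S]
        smooth_on_matrix_nth[OF S G] spd_det_pos spd) simp_all
  then show "smooth_on S (\<lambda>x. matrix_inv (G x) $ k $ l)"
    by (rule smooth_on_cong[OF _ S *])
qed

lemma has_derivative_matrix_nth:
  "(G has_derivative G') F \<Longrightarrow> ((\<lambda>x. G x $ i $ j) has_derivative (\<lambda>z. G' z $ i $ j)) F"
  using bounded_linear.has_derivative[OF bounded_linear_vec_nth,
      OF bounded_linear.has_derivative[OF bounded_linear_vec_nth]] .

text \<open>In the Leibniz expansion a permutation other than the identity moves at least two
  indices. Differentiating one factor at the identity matrix leaves another off-diagonal entry,
  which is 0, so only the trace survives.\<close>

lemma has_derivative_det_mat1: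
  fixes G :: "'a::real_normed_vector \<Rightarrow> real ^ 'm::finite ^ 'm"
  assumes G: "(G has_derivative G') (at x)" and 1: "G x = mat 1"
  shows "((\<lambda>x. det (G x)) has_derivative (\<lambda>z. \<Sum>i\<in>UNIV. G' z $ i $ i)) (at x)"
proof -
  let ?PU = "{p. p permutes (UNIV :: 'm set)}"
  let ?D = "\<lambda>p z. of_int (sign p) * (\<Sum>i\<in>UNIV. G' z $ i $ p i * (\<Prod>j\<in>UNIV - {i}. G x $ j $ p j))"
  have "((\<lambda>x. det (G x)) has_derivative (\<lambda>z. \<Sum>p\<in>?PU. ?D p z)) (at x)"
    unfolding det_def
    by (intro has_derivative_sum has_derivative_mult_right has_derivative_prod
        has_derivative_matrix_nth[OF G])
  moreover have "(\<Sum>p\<in>?PU. ?D p z) = (\<Sum>i\<in>UNIV. G' z $ i $ i)" for z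
  proof -
    have zero: "?D p z = 0" if "p \<in> ?PU - {id}" for p
    proof -
      have p: "p permutes UNIV" "p \<noteq> id" using that by auto
      have "(\<Prod>j\<in>UNIV - {i}. G x $ j $ p j) = 0" for i
      proof -
        obtain j where j: "p j \<noteq> j" using p(2) by (metis eq_id_iff)
        \<comment> \<open>If the moved index j happens to be i, then p j is moved as well and
          differs from i.\<close>
        have "p (p j) \<noteq> p j" using j permutes_inj[OF p(1)] by (simp add: inj_eq)
        with j have "\<exists>j\<in>UNIV - {i}. p j \<noteq> j" by (cases "j = i") (metis DiffI UNIV_I singletonD)+
        then obtain j' where "j' \<in> UNIV - {i}" "p j' \<noteq> j'" by blast
        then show ?thesis by (intro prod_zero) (auto simp: 1 mat_def intro!: bexI[of _ j'])
      qed
      then show ?thesis by (simp only: mult_zero_right sum.neutral_const)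
    qed
    have "(\<Sum>p\<in>?PU. ?D p z) = (\<Sum>p\<in>{id}. ?D p z)"
      by (rule sum.mono_neutral_right) (use zero finite_permutations[OF finite] permutes_id in auto)
    then show ?thesis by (simp add: 1 mat_def sign_id)
  qed
  ultimately show ?thesis by simp
qed

text \<open>Jacobi's formula. Multiplying by the constant inverse of \<open>G x\<close> reduces it
  to the derivative at the identity matrix; the trace of G^(-1) dG is then taken in the orthonormal
  frame.\<close>

lemma has_derivative_det:
  fixes G :: "'a::real_normed_vector \<Rightarrow> real ^ 'm::finite ^ 'm"
  assumes G: "(G has_derivative G') (at x)" and s: "spd (G x)"
    and o: "orthonormal_on (G x) I e" and I: "finite I" "card I = CARD('m)"
  shows "((\<lambda>x. det (G x)) has_derivative
    (\<lambda>z. det (G x) * (\<Sum>i\<in>I. mform (G' z) (e i) (e i)))) (at x)"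
proof -
  let ?B = "matrix_inv (G x)"
  have lin: "bounded_linear (\<lambda>M :: real ^ 'm ^ 'm. ?B ** M)"
    by (rule linear_conv_bounded_linear[THEN iffD1], rule linearI)
      (vector matrix_matrix_mult_def sum.distrib algebra_simps sum_distrib_left)+
  have "((\<lambda>x. det (?B ** G x)) has_derivative (\<lambda>z. \<Sum>i\<in>UNIV. (?B ** G' z) $ i $ i)) (at x)"
    by (rule has_derivative_det_mat1[OF bounded_linear.has_derivative[OF lin G]])
      (rule spd_invertible(3)[OF s])
  moreover have "det (G x) * det (?B ** G y) = det (G y)" for y
  proof -
    have "det (G x) * det ?B = 1"
      using spd_invertible(2)[OF s] by (metis det_I det_mul)
    then show ?thesis by (simp add: det_mul)
  qed
  moreover have "(\<Sum>i\<in>UNIV. (?B ** G' z) $ i $ i) = (\<Sum>i\<in>I. mform (G' z) (e i) (e i))" for z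
  proof -
    have "(\<Sum>i\<in>I. mform (G' z) (e i) (e i)) = (\<Sum>k\<in>UNIV. \<Sum>l\<in>UNIV. ?B $ k $ l * G' z $ k $ l)"
      using sum_orthonormal[OF s o I bilinear_mform[of "G' z"]] by (simp add: mform_axis)
    also have "\<dots> = (\<Sum>l\<in>UNIV. \<Sum>k\<in>UNIV. ?B $ k $ l * G' z $ k $ l)"
      by (rule sum.swap)
    also have "\<dots> = (\<Sum>i\<in>UNIV. (?B ** G' z) $ i $ i)"
      by (simp add: matrix_matrix_mult_def matrix_inv_sym[OF s])
    finally show ?thesis by simp
  qed
  ultimately show ?thesis
    using has_derivative_mult_right[of "\<lambda>y. det (?B ** G y)" _ "at x" "det (G x)"] by simp
qed

section \<open>Bump functions and the fundamental lemma of the calculus of variations\<close>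

abbreviation fd :: "('a::real_normed_vector \<Rightarrow> 'b::real_normed_vector) \<Rightarrow> 'a \<Rightarrow> 'a \<Rightarrow> 'b" where
  "fd f x \<equiv> frechet_derivative f (at x)"

text \<open>The function s^(-k) exp(-1/s), continued by 0. The case k = 0 is the classical flat
  function; the others are needed because its derivatives are combinations of them.\<close>

definition flat_fun :: "nat \<Rightarrow> real \<Rightarrow> real" where
  "flat_fun k s = (if s > 0 then inverse s ^ k * exp (- inverse s) else 0)"

lemma flat_fun_tendsto_0: "(flat_fun k \<longlongrightarrow> 0) (at 0)"
proof (rule filterlim_split_at_real)
  have "((\<lambda>s. inverse s ^ k / exp (inverse s)) \<longlongrightarrow> 0) (at_right (0::real))"
    by (rule filterlim_compose[OF tendsto_power_div_exp_0 filterlim_inverse_at_top_right])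
  then show "(flat_fun k \<longlongrightarrow> 0) (at_right 0)"
    by (rule Lim_transform_eventually)
      (auto simp: eventually_at_filter flat_fun_def exp_minus divide_inverse)
  show "(flat_fun k \<longlongrightarrow> 0) (at_left 0)"
    by (rule tendsto_eventually) (auto simp: eventually_at_filter flat_fun_def)
qed

text \<open>Away from 0 this is a computation. At 0 the difference quotient is itself the member k +
  1 of the family, and that tends to 0.\<close>

lemma flat_fun_derivative:
  "(flat_fun k has_real_derivative flat_fun (k + 2) s - real k * flat_fun (Suc k) s) (at s)"
proof -
  consider "s < 0" | "s = 0" | "s > 0" by linarith
  then show ?thesis
  proof cases
    case 1
    have "((\<lambda>_. 0) has_real_derivative 0) (at s)" by simp
    then have "(flat_fun k has_real_derivative 0) (at s)"
      by (rule has_field_derivative_transform_within_open[of _ _ _ "{..<0}"]) (use 1 in \<open>auto simp: flat_fun_def\<close>)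
    then show ?thesis using 1 by (simp add: flat_fun_def)
  next
    case 2
    have "(flat_fun k h - flat_fun k 0) / h = flat_fun (Suc k) h" for h
      by (simp add: flat_fun_def divide_inverse)
    then have "(flat_fun k has_real_derivative 0) (at 0)"
      using flat_fun_tendsto_0[of "Suc k"] by (simp add: DERIV_def)
    then show ?thesis using 2 by (simp add: flat_fun_def)
  next
    case 3
    have "((\<lambda>s. inverse s ^ k * exp (- inverse s)) has_real_derivative
        inverse s ^ (k + 2) * exp (- inverse s) - real k * (inverse s ^ Suc k * exp (- inverse s))) (at s)"
    proof -
      have inv: "(inverse has_real_derivative - (inverse s * inverse s)) (at s)"
        using DERIV_inverse[of s UNIV] 3 by (simp add: power2_eq_square)
      have A: "real k * (- (inverse s * inverse s) * inverse s ^ (k - Suc 0)) = - real k * inverse s ^ Suc k"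
        by (cases k) (simp_all add: algebra_simps)
      have pow: "((\<lambda>s. inverse s ^ k) has_real_derivative - real k * inverse s ^ Suc k) (at s)"
        using DERIV_power[OF inv, of k] unfolding A .
      have exp: "((\<lambda>s. exp (- inverse s)) has_real_derivative
          exp (- inverse s) * (inverse s * inverse s)) (at s)"
        using DERIV_fun_exp[OF DERIV_minus[OF inv]] by simp
      show ?thesis using DERIV_mult[OF pow exp] by (simp add: algebra_simps)
    qed
    then have "(flat_fun k has_real_derivative
        inverse s ^ (k + 2) * exp (- inverse s) - real k * (inverse s ^ Suc k * exp (- inverse s))) (at s)"
      by (rule has_field_derivative_transform_within_open[of _ _ _ "{0<..}"]) (use 3 in \<open>auto simp: flat_fun_def\<close>)
    then show ?thesis using 3 by (simp add: flat_fun_def)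
  qed
qed

lemma smooth_on_flat_fun: "smooth_on UNIV (flat_fun k)"
proof -
  have "Ck_on j UNIV (flat_fun k)" for j
  proof (induction j arbitrary: k)
    case 0
    show ?case
      using flat_fun_derivative by (auto intro!: continuous_at_imp_continuous_on DERIV_isCont)
  next
    case (Suc j)
    have "Ck_on j UNIV (\<lambda>s. flat_fun (k + 2) s + (- real k) * flat_fun (Suc k) s)"
      by (intro Ck_on_add Ck_on_bilinear[OF bounded_bilinear_mult] Ck_on_const Suc open_UNIV)
    then have "Ck_on j UNIV (\<lambda>s. flat_fun (k + 2) s - real k * flat_fun (Suc k) s)" by simp
    then show ?case
      using Ck_on_real_derivative[OF open_UNIV flat_fun_derivative] by blast
  qed
  then show ?thesis by (simp add: smooth_on_def)
qed

text \<open>The squared distance keeps the argument of \<open>flat_fun\<close> smooth at the centre;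
  for r > 0 that argument is positive exactly in the open ball of radius r.\<close>

definition bump :: "'a::euclidean_space \<Rightarrow> real \<Rightarrow> 'a \<Rightarrow> real" where
  "bump x0 r x = flat_fun 0 (r\<^sup>2 - (x - x0) \<bullet> (x - x0))"

lemma smooth_on_bump: "smooth_on UNIV (bump x0 r)"
proof -
  have "smooth_on UNIV (\<lambda>x. x - x0)"
    by (intro smooth_on_diff open_UNIV smooth_on_ident smooth_on_const)
  then have "smooth_on UNIV (\<lambda>x. r\<^sup>2 - (x - x0) \<bullet> (x - x0))"
    using smooth_on_diff[OF open_UNIV smooth_on_const smooth_on_inner[OF open_UNIV]] by blast
  then have "smooth_on UNIV (\<lambda>x. flat_fun 0 (r\<^sup>2 - (x - x0) \<bullet> (x - x0)))"
    by (intro smooth_on_compose[OF _ _ smooth_on_flat_fun]) auto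
  then show ?thesis by (simp add: bump_def[abs_def])
qed

lemma bump_nonneg: "0 \<le> bump x0 r x"
  by (simp add: bump_def flat_fun_def)

lemma bump_centre_pos: "r > 0 \<Longrightarrow> 0 < bump x0 r x0"
  by (simp add: bump_def flat_fun_def)

lemma bump_eq_0:
  assumes "0 < r" "x \<notin> ball x0 r"
  shows "bump x0 r x = 0"
proof -
  have "r \<le> norm (x - x0)" using assms by (simp add: dist_norm norm_minus_commute)
  then have "r\<^sup>2 \<le> (norm (x - x0))\<^sup>2" using assms by (intro power_mono) auto
  then show ?thesis by (simp add: bump_def flat_fun_def dot_square_norm)
qed

lemma fd_eq_0_outside_cbox:
  fixes Y :: "'a::euclidean_space \<Rightarrow> 'b::real_normed_vector"
  assumes "\<And>x. x \<notin> cbox a b \<Longrightarrow> Y x = 0" "x \<notin> cbox a b"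
  shows "fd Y x = (\<lambda>v. 0)"
proof -
  have "fd Y x = fd (\<lambda>_. 0) x"
    by (rule differentiable_cong_open(2)[OF differentiable_const open_Compl[OF closed_cbox], of x a b])
      (auto simp: assms)
  then show ?thesis by simp
qed

section \<open>Differentiation under the integral sign and integration by parts\<close>

lemma has_derivative_partial:
  assumes "(K has_derivative K') (at (t, x))"
  shows "((\<lambda>t. K (t, x)) has_derivative (\<lambda>s. K' (s, 0))) (at t)"
proof -
  have "((\<lambda>t. (t, x)) has_derivative (\<lambda>s. (s, 0))) (at t)"
    by (auto intro!: derivative_eq_intros)
  from has_derivative_compose[where g=K and g'=K', OF this assms] show ?thesis by simp
qed

text \<open>The derivative of the integrand in t is its total derivative in the direction (1, 0).
  Smoothness of \<open>K\<close> in both variables together gives the joint continuity that the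
  Leibniz rule asks for.\<close>

lemma leibniz_rule_smooth:
  fixes K :: "real \<times> 'a::euclidean_space \<Rightarrow> real"
  assumes P: "open P" and K: "smooth_on P K" and "0 < \<epsilon>" and sub: "{-\<epsilon><..<\<epsilon>} \<times> cbox a b \<subseteq> P"
  shows "((\<lambda>t. integral (cbox a b) (\<lambda>x. K (t, x))) has_real_derivative
    integral (cbox a b) (\<lambda>x. fd K (0, x) (1, 0))) (at 0)"
proof -
  let ?U = "{-\<epsilon><..<\<epsilon>}"
  have "((\<lambda>t. integral (cbox a b) (\<lambda>x. K (t, x))) has_real_derivative
    integral (cbox a b) (\<lambda>x. fd K (0, x) (1, 0))) (at 0 within ?U)"
  proof (rule leibniz_rule_field_derivative)
    fix t x assume tx: "t \<in> ?U" "x \<in> cbox a b"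
    then have P: "(t, x) \<in> P" using sub by auto
    have lin: "linear (fd K (t, x))" by (rule smooth_on_linear[OF K P])
    have "(\<lambda>s. fd K (t, x) (s, 0)) = (*) (fd K (t, x) (1, 0))"
    proof
      fix s show "fd K (t, x) (s, 0) = fd K (t, x) (1, 0) * s"
        using linear_cmul[OF lin, of s "(1, 0)"] by (simp add: mult.commute)
    qed
    then have "((\<lambda>t. K (t, x)) has_real_derivative fd K (t, x) (1, 0)) (at t)"
      using has_derivative_partial[OF smooth_on_has_derivative[OF K P]]
      by (simp add: has_field_derivative_def)
    then show "((\<lambda>t. K (t, x)) has_real_derivative fd K (t, x) (1, 0)) (at t within ?U)"
      by (rule has_field_derivative_at_within)
  next
    fix t assume "t \<in> ?U"
    then have "continuous_on (cbox a b) (\<lambda>x. K (t, x))"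
      by (intro continuous_on_compose2[OF smooth_on_imp_continuous_on[OF K]] continuous_on_Pair
          continuous_on_const continuous_on_id) (use sub in auto)
    then show "(\<lambda>x. K (t, x)) integrable_on cbox a b" by (rule integrable_continuous)
  next
    have "continuous_on (?U \<times> cbox a b) (\<lambda>y. fd K y (1, 0))"
      using continuous_on_subset[OF smooth_on_imp_continuous_on[OF smooth_on_frechet_derivative[OF K]] sub] .
    then show "continuous_on (?U \<times> cbox a b) (\<lambda>(t, x). fd K (t, x) (1, 0))"
      by (simp add: case_prod_beta')
  next
    show "0 \<in> ?U" using \<open>0 < \<epsilon>\<close> by simp
    show "convex ?U" by (rule convex_real_interval)
  qed
  moreover have "at 0 within ?U = at 0" by (rule at_within_open) (use \<open>0 < \<epsilon>\<close> in auto)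
  ultimately show ?thesis by (simp only:)
qed

text \<open>The integral of Y(x + t v) over a large box does not depend on t, by translation
  invariance; its derivative at t = 0 is the integral in question. No iterated integrals are
  required.\<close>

lemma integral_directional_derivative:
  fixes Y :: "'a::euclidean_space \<Rightarrow> real"
  assumes Y: "smooth_on UNIV Y" and supp: "\<And>x. x \<notin> cbox a b \<Longrightarrow> Y x = 0"
  shows "((\<lambda>x. fd Y x v) has_integral 0) (cbox a b)"
proof -
  \<comment> \<open>One box contains all translates of the support for t between -1 and 1, so the
    domain of integration does not depend on t.\<close>
  have "bounded ((\<lambda>(t, x). x - t *\<^sub>R v) ` ({-1..1} \<times> cbox a b))"
    by (intro compact_imp_bounded compact_continuous_image compact_Times)
      (auto simp: case_prod_beta' intro!: continuous_intros)
  then obtain p where p: "(\<lambda>(t, x). x - t *\<^sub>R v) ` ({-1..1} \<times> cbox a b) \<subseteq> cbox (-p) p"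
    using bounded_subset_cbox_symmetric by blast
  have K: "smooth_on UNIV (\<lambda>(t::real, x). Y (x + t *\<^sub>R v))"
  proof -
    have "smooth_on UNIV (\<lambda>z :: real \<times> 'a. snd z + fst z *\<^sub>R v)"
      by (intro smooth_on_add smooth_on_scaleR smooth_on_const smooth_on_bounded_linear
          bounded_linear_fst bounded_linear_snd open_UNIV)
    then have "smooth_on UNIV (\<lambda>z :: real \<times> 'a. Y (snd z + fst z *\<^sub>R v))"
      by (intro smooth_on_compose[OF _ _ Y]) auto
    then show ?thesis by (simp add: case_prod_beta')
  qed
  have const: "integral (cbox (-p) p) (\<lambda>x. Y (x + t *\<^sub>R v)) = integral (cbox a b) Y"
    if t: "t \<in> {-1<..<1}" for t
  proof -
    have "Y integrable_on cbox a b"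
      by (intro integrable_continuous continuous_on_subset[OF smooth_on_imp_continuous_on[OF Y]]) simp
    then have "((\<lambda>x. Y (1 *\<^sub>R x + t *\<^sub>R v)) has_integral (integral (cbox a b) Y /\<^sub>R 1 ^ DIM('a)))
        (cbox ((a - t *\<^sub>R v) /\<^sub>R 1) ((b - t *\<^sub>R v) /\<^sub>R 1))"
      by (intro has_integral_affinity' integrable_integral) auto
    then have *: "((\<lambda>x. Y (x + t *\<^sub>R v)) has_integral integral (cbox a b) Y)
        (cbox (a - t *\<^sub>R v) (b - t *\<^sub>R v))" by simp
    have eq: "cbox (a - t *\<^sub>R v) (b - t *\<^sub>R v) = (\<lambda>x. x - t *\<^sub>R v) ` cbox a b"
      using cbox_translation[of "- t *\<^sub>R v" a b] by (simp add: algebra_simps image_def)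
    have "((\<lambda>x. Y (x + t *\<^sub>R v)) has_integral integral (cbox a b) Y) (cbox (-p) p)"
    proof (rule has_integral_on_superset[OF *])
      fix x assume x: "x \<notin> cbox (a - t *\<^sub>R v) (b - t *\<^sub>R v)"
      have "x + t *\<^sub>R v \<notin> cbox a b"
      proof
        assume "x + t *\<^sub>R v \<in> cbox a b"
        then have "x + t *\<^sub>R v - t *\<^sub>R v \<in> cbox (a - t *\<^sub>R v) (b - t *\<^sub>R v)" unfolding eq by blast
        then show False using x by simp
      qed
      then show "Y (x + t *\<^sub>R v) = 0" by (rule supp)
    next
      show "cbox (a - t *\<^sub>R v) (b - t *\<^sub>R v) \<subseteq> cbox (-p) p"
      proof
        fix y assume "y \<in> cbox (a - t *\<^sub>R v) (b - t *\<^sub>R v)"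
        then obtain x where x: "x \<in> cbox a b" "y = x - t *\<^sub>R v" unfolding eq by blast
        then have "(case (t, x) of (t, x) \<Rightarrow> x - t *\<^sub>R v) \<in> cbox (-p) p"
          using t by (intro subsetD[OF p] imageI) auto
        then show "y \<in> cbox (-p) p" using x by simp
      qed
    qed
    then show ?thesis by (rule integral_unique)
  qed
  have "((\<lambda>t. integral (cbox (-p) p) (\<lambda>x. Y (x + t *\<^sub>R v))) has_real_derivative
      integral (cbox (-p) p) (\<lambda>x. fd (\<lambda>(t, x). Y (x + t *\<^sub>R v)) (0, x) (1, 0))) (at 0)"
    using leibniz_rule_smooth[OF open_UNIV K, of 1 "-p" p] by simp
  moreover have "fd (\<lambda>(t, x). Y (x + t *\<^sub>R v)) (0, x) (1, 0) = fd Y x v" for x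
  proof -
    have "((\<lambda>z :: real \<times> 'a. snd z + fst z *\<^sub>R v) has_derivative
        (\<lambda>h. snd h + fst h *\<^sub>R v)) (at (0, x))"
      by (auto intro!: derivative_eq_intros)
    moreover have "(Y has_derivative fd Y x) (at (snd (0::real, x) + fst (0::real, x) *\<^sub>R v))"
      using smooth_on_has_derivative[OF Y] by simp
    ultimately have "((\<lambda>z :: real \<times> 'a. Y (snd z + fst z *\<^sub>R v)) has_derivative
        (\<lambda>h. fd Y x (snd h + fst h *\<^sub>R v))) (at (0, x))"
      by (rule has_derivative_compose)
    then show ?thesis by (simp add: case_prod_beta' frechet_derivative_eq)
  qed
  ultimately have "((\<lambda>t. integral (cbox (-p) p) (\<lambda>x. Y (x + t *\<^sub>R v))) has_real_derivative
      integral (cbox (-p) p) (\<lambda>x. fd Y x v)) (at 0)" by simp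
  moreover have "((\<lambda>t. integral (cbox (-p) p) (\<lambda>x. Y (x + t *\<^sub>R v))) has_real_derivative 0) (at 0)"
    by (rule has_field_derivative_transform_within_open[of "\<lambda>t. integral (cbox a b) Y" _ _ "{-1<..<1}"])
      (auto simp: const)
  ultimately have 0: "integral (cbox (-p) p) (\<lambda>x. fd Y x v) = 0"
    by (rule DERIV_unique)
  have cont: "continuous_on UNIV (\<lambda>x. fd Y x v)"
    by (rule smooth_on_imp_continuous_on[OF smooth_on_frechet_derivative[OF Y]])
  have zero: "fd Y x v = 0" if "x \<notin> cbox a b" for x
    using fd_eq_0_outside_cbox[OF supp that] by simp
  have sub: "cbox a b \<subseteq> cbox (-p) p"
  proof
    fix x assume "x \<in> cbox a b"
    then have "(case (0, x) of (t, x) \<Rightarrow> x - t *\<^sub>R v) \<in> cbox (-p) p"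
      using p by (intro subsetD[OF p] imageI) auto
    then show "x \<in> cbox (-p) p" by simp
  qed
  have *: "((\<lambda>x. fd Y x v) has_integral integral (cbox a b) (\<lambda>x. fd Y x v)) (cbox a b)"
    by (rule integrable_integral[OF integrable_continuous[OF continuous_on_subset[OF cont subset_UNIV]]])
  have "((\<lambda>x. fd Y x v) has_integral integral (cbox a b) (\<lambda>x. fd Y x v)) (cbox (-p) p)"
    by (rule has_integral_on_superset[OF * zero sub])
  with 0 have "integral (cbox a b) (\<lambda>x. fd Y x v) = 0" by (simp add: integral_unique)
  then show ?thesis
    using * by simp
qed

text \<open>Integration by parts, applied to each product of \<phi> with a component of
  \<open>X\<close>, turns the weak equation into the vanishing of the integral of \<phi> times c -
  div X. A bump placed where this difference keeps its sign excludes a nonzero value at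
  \<open>x0\<close>.\<close>

lemma weak_divergence_imp_pointwise:
  fixes X :: "real ^ 'm::finite \<Rightarrow> real ^ 'm" and c :: "real ^ 'm \<Rightarrow> real"
  assumes U: "open U" "x0 \<in> U" and X: "smooth_on U X" and c: "continuous_on U c"
    and weak: "\<And>a b \<phi>. \<lbrakk>cbox a b \<subseteq> U; smooth_on UNIV \<phi>; \<And>x. x \<notin> cbox a b \<Longrightarrow> \<phi> x = 0\<rbrakk>
      \<Longrightarrow> integral (cbox a b) (\<lambda>x. fd \<phi> x (X x) + \<phi> x * c x) = 0"
  shows "(\<Sum>j\<in>UNIV. fd X x0 (axis j 1) $ j) = c x0"
proof (rule ccontr)
  define q where "q x = c x - (\<Sum>j\<in>UNIV. fd X x (axis j 1) $ j)" for x
  assume "\<not> ?thesis"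
  then have q0: "q x0 \<noteq> 0" by (simp add: q_def)
  have qc: "continuous_on U q"
    unfolding q_def
    by (intro continuous_intros c continuous_on_sum continuous_on_component
        smooth_on_imp_continuous_on[OF smooth_on_frechet_derivative[OF X]])
  \<comment> \<open>The set where \<open>q\<close> has the sign of \<open>q x0\<close>, written as a
    product so that both signs are treated at once.\<close>
  define V where "V = {x\<in>U. 0 < q x0 * q x}"
  have "V = U \<inter> (\<lambda>x. q x0 * q x) -` {0<..}" by (auto simp: V_def)
  moreover have "continuous_on U (\<lambda>x. q x0 * q x)" by (intro continuous_intros qc)
  ultimately have "open V"
    using continuous_open_preimage[OF _ U(1) open_greaterThan[of 0]] by simp
  moreover have "x0 \<in> V" using q0 U by (auto simp: V_def zero_less_mult_iff)
  ultimately obtain a b where ab: "cbox a b \<subseteq> V" "x0 \<in> box a b"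
    using open_contains_cbox by metis
  obtain r where r: "0 < r" "ball x0 r \<subseteq> box a b"
    using open_box ab(2) openE by blast
  define \<phi> where "\<phi> = bump x0 r"
  have abU: "cbox a b \<subseteq> U" using ab(1) by (auto simp: V_def)
  have \<phi>: "smooth_on UNIV \<phi>" by (simp add: \<phi>_def smooth_on_bump)
  have supp: "\<phi> x = 0" if "x \<notin> cbox a b" for x
    unfolding \<phi>_def by (rule bump_eq_0[OF r(1)]) (use r that box_subset_cbox in blast)
  \<comment> \<open>\<open>X\<close> is smooth only on \<open>U\<close>, so the product is set to 0
    elsewhere. It remains smooth because \<phi> already vanishes outside a box contained in
    \<open>U\<close>.\<close>
  define Y where "Y j x = (if x \<in> U then \<phi> x * X x $ j else 0)" for j x
  have Y: "smooth_on UNIV (Y j)" for j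
  proof (rule smooth_on_local)
    fix x :: "real ^ 'm"
    show "\<exists>T. open T \<and> x \<in> T \<and> smooth_on T (Y j)"
    proof (cases "x \<in> U")
      case True
      have "smooth_on U (\<lambda>x. \<phi> x * X x $ j)"
        by (intro smooth_on_mult[OF U(1)] smooth_on_subset[OF \<phi>] smooth_on_vec_nth[OF U(1) X]) simp
      then have "smooth_on U (Y j)" by (rule smooth_on_cong[OF _ U(1)]) (simp add: Y_def)
      then show ?thesis using True U by blast
    next
      case False
      have "smooth_on (- cbox a b) (Y j)"
        by (rule smooth_on_cong[OF smooth_on_const[where c=0] open_Compl[OF closed_cbox]])
          (auto simp: Y_def supp)
      then show ?thesis using False abU open_Compl[OF closed_cbox] by blast
    qed
  qed
  have Ysupp: "Y j x = 0" if "x \<notin> cbox a b" for j x using supp[OF that] by (simp add: Y_def)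
  have Y': "fd (Y j) x v = fd \<phi> x v * X x $ j + \<phi> x * fd X x v $ j" if "x \<in> U" for j x v
  proof -
    have "((\<lambda>x. \<phi> x * X x $ j) has_derivative (\<lambda>v. \<phi> x * fd X x v $ j + fd \<phi> x v * X x $ j)) (at x)"
      by (intro has_derivative_mult smooth_on_has_derivative[OF \<phi>] bounded_linear.has_derivative[OF
            bounded_linear_vec_nth] smooth_on_has_derivative[OF X]) (use that in auto)
    then have "(Y j has_derivative (\<lambda>v. \<phi> x * fd X x v $ j + fd \<phi> x v * X x $ j)) (at x)"
      by (rule has_derivative_transform_within_open[OF _ U(1) that]) (simp add: Y_def)
    then show ?thesis by (simp add: frechet_derivative_eq)
  qed
  have "((\<lambda>x. \<Sum>j\<in>UNIV. fd (Y j) x (axis j 1)) has_integral (\<Sum>j\<in>(UNIV :: 'm set). 0)) (cbox a b)"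
    by (intro has_integral_sum integral_directional_derivative Y Ysupp) auto
  moreover have "(\<Sum>j\<in>UNIV. fd (Y j) x (axis j 1)) =
      fd \<phi> x (X x) + \<phi> x * (\<Sum>j\<in>UNIV. fd X x (axis j 1) $ j)" if "x \<in> cbox a b" for x
  proof -
    have "fd \<phi> x (X x) = (\<Sum>j\<in>UNIV. X x $ j *\<^sub>R fd \<phi> x (axis j 1))"
      by (rule linear_expand) (rule smooth_on_linear[OF \<phi>], simp)
    moreover have "x \<in> U" using that abU by auto
    ultimately show ?thesis by (simp add: Y' sum.distrib sum_distrib_left mult_ac)
  qed
  ultimately have 1: "((\<lambda>x. fd \<phi> x (X x) + \<phi> x * (\<Sum>j\<in>UNIV. fd X x (axis j 1) $ j)) has_integral 0) (cbox a b)"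
    by (subst has_integral_cong[symmetric]) auto
  have cont: "continuous_on (cbox a b) (\<lambda>x. fd \<phi> x (X x) + \<phi> x * c x)"
  proof -
    have "fd \<phi> x (X x) = (\<Sum>j\<in>UNIV. X x $ j *\<^sub>R fd \<phi> x (axis j 1))" for x
      by (rule linear_expand) (rule smooth_on_linear[OF \<phi>], simp)
    moreover have "continuous_on (cbox a b) (\<lambda>x. (\<Sum>j\<in>UNIV. X x $ j *\<^sub>R fd \<phi> x (axis j 1)) + \<phi> x * c x)"
      by (intro continuous_intros continuous_on_component
          continuous_on_subset[OF smooth_on_imp_continuous_on[OF X] abU]
          continuous_on_subset[OF c abU]
          continuous_on_subset[OF smooth_on_imp_continuous_on[OF \<phi>]]
          continuous_on_subset[OF smooth_on_imp_continuous_on[OF smooth_on_frechet_derivative[OF \<phi>]]]) auto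
    ultimately show ?thesis by simp
  qed
  have 2: "((\<lambda>x. fd \<phi> x (X x) + \<phi> x * c x) has_integral 0) (cbox a b)"
    using weak[OF abU \<phi> supp] integrable_integral[OF integrable_continuous[OF cont]] by simp
  \<comment> \<open>The difference of the weak equation and of the integration by parts. The factor
    \<open>q x0\<close> makes the integrand nonnegative on the box, so a vanishing integral forces
    it to vanish at the centre.\<close>
  have "((\<lambda>x. q x0 * (\<phi> x * q x)) has_integral q x0 * 0) (cbox a b)"
    using has_integral_mult_right[OF has_integral_diff[OF 2 1], of "q x0"]
    by (simp add: q_def algebra_simps)
  then have 3: "((\<lambda>x. q x0 * (\<phi> x * q x)) has_integral 0) (cbox a b)" by simp
  have "q x0 * (\<phi> x0 * q x0) = 0"
  proof (rule has_integral_0_cbox_imp_0[OF _ _ 3])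
    show "continuous_on (cbox a b) (\<lambda>x. q x0 * (\<phi> x * q x))"
      by (intro continuous_intros continuous_on_subset[OF qc abU]
          continuous_on_subset[OF smooth_on_imp_continuous_on[OF \<phi>]]) auto
    show "0 \<le> q x0 * (\<phi> x * q x)" if "x \<in> box a b" for x
    proof -
      have "x \<in> V" using that ab(1) box_subset_cbox by blast
      then have "0 \<le> \<phi> x * (q x0 * q x)"
        by (intro mult_nonneg_nonneg[of "\<phi> x"]) (simp_all add: V_def \<phi>_def bump_nonneg less_imp_le)
      then show ?thesis by (simp add: mult_ac)
    qed
    show "box a b \<noteq> {}" "x0 \<in> cbox a b" using ab(2) box_subset_cbox by auto
  qed
  then show False using q0 bump_centre_pos[OF r(1), of x0] by (simp add: \<phi>_def)
qed

section \<open>Second derivatives\<close>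

text \<open>The mean value theorem is used twice: along a for the difference of f between the two
  parallel sides, then along b for the derivative of f in the direction a.\<close>

lemma second_difference_mean_value:
  fixes f :: "'a::real_normed_vector \<Rightarrow> real"
  assumes f: "smooth_on U f" and h: "0 < h"
    and sub: "\<And>s t. s \<in> {0..h} \<Longrightarrow> t \<in> {0..h} \<Longrightarrow> x + s *\<^sub>R a + t *\<^sub>R b \<in> U"
  shows "\<exists>s\<in>{0..h}. \<exists>t\<in>{0..h}. f (x + h *\<^sub>R a + h *\<^sub>R b) - f (x + h *\<^sub>R a) - f (x + h *\<^sub>R b) + f x =
    h\<^sup>2 * fd (\<lambda>y. fd f y a) (x + s *\<^sub>R a + t *\<^sub>R b) b"
proof -
  have d1: "((\<lambda>s. f (x + s *\<^sub>R a + t *\<^sub>R b)) has_real_derivative fd f (x + s *\<^sub>R a + t *\<^sub>R b) a) (at s)"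
    if st: "s \<in> {0..h}" "t \<in> {0..h}" for s t
  proof -
    have "((\<lambda>s. x + s *\<^sub>R a + t *\<^sub>R b) has_derivative (\<lambda>r. r *\<^sub>R a)) (at s)"
      by (auto intro!: derivative_eq_intros)
    from has_derivative_compose[OF this smooth_on_has_derivative[OF f sub[OF st]]]
    have "((\<lambda>s. f (x + s *\<^sub>R a + t *\<^sub>R b)) has_derivative
        (\<lambda>r. fd f (x + s *\<^sub>R a + t *\<^sub>R b) (r *\<^sub>R a))) (at s)" .
    moreover have "fd f (x + s *\<^sub>R a + t *\<^sub>R b) (r *\<^sub>R a) = fd f (x + s *\<^sub>R a + t *\<^sub>R b) a * r" for r
      using linear_cmul[OF smooth_on_linear[OF f sub[OF st]], of r a] by simp
    ultimately show ?thesis by (simp add: has_field_derivative_def)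
  qed
  have d2: "((\<lambda>t. fd f (x + s *\<^sub>R a + t *\<^sub>R b) a) has_real_derivative
      fd (\<lambda>y. fd f y a) (x + s *\<^sub>R a + t *\<^sub>R b) b) (at t)"
    if st: "s \<in> {0..h}" "t \<in> {0..h}" for s t
  proof -
    note f' = smooth_on_frechet_derivative[OF f, of a]
    have "((\<lambda>t. x + s *\<^sub>R a + t *\<^sub>R b) has_derivative (\<lambda>r. r *\<^sub>R b)) (at t)"
      by (auto intro!: derivative_eq_intros)
    from has_derivative_compose[OF this smooth_on_has_derivative[OF f' sub[OF st]]]
    have "((\<lambda>t. fd f (x + s *\<^sub>R a + t *\<^sub>R b) a) has_derivative
        (\<lambda>r. fd (\<lambda>y. fd f y a) (x + s *\<^sub>R a + t *\<^sub>R b) (r *\<^sub>R b))) (at t)" .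
    moreover have "fd (\<lambda>y. fd f y a) (x + s *\<^sub>R a + t *\<^sub>R b) (r *\<^sub>R b) =
        fd (\<lambda>y. fd f y a) (x + s *\<^sub>R a + t *\<^sub>R b) b * r" for r
      using linear_cmul[OF smooth_on_linear[OF f' sub[OF st]], of r b] by simp
    ultimately show ?thesis by (simp add: has_field_derivative_def)
  qed
  have "((\<lambda>s. f (x + s *\<^sub>R a + h *\<^sub>R b) - f (x + s *\<^sub>R a)) has_real_derivative
      fd f (x + s *\<^sub>R a + h *\<^sub>R b) a - fd f (x + s *\<^sub>R a) a) (at s)" if "0 \<le> s" "s \<le> h" for s
    using DERIV_diff[OF d1[of s h] d1[of s 0]] that h by simp
  from MVT2[OF h this] obtain s where s: "0 < s" "s < h"
    "f (x + h *\<^sub>R a + h *\<^sub>R b) - f (x + h *\<^sub>R a) - (f (x + 0 *\<^sub>R a + h *\<^sub>R b) - f (x + 0 *\<^sub>R a)) =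
      (h - 0) * (fd f (x + s *\<^sub>R a + h *\<^sub>R b) a - fd f (x + s *\<^sub>R a) a)"
    by blast
  from MVT2[OF h, of "\<lambda>t. fd f (x + s *\<^sub>R a + t *\<^sub>R b) a"
      "\<lambda>t. fd (\<lambda>y. fd f y a) (x + s *\<^sub>R a + t *\<^sub>R b) b"] d2 s
  obtain t where t: "0 < t" "t < h"
    "fd f (x + s *\<^sub>R a + h *\<^sub>R b) a - fd f (x + s *\<^sub>R a + 0 *\<^sub>R b) a =
      (h - 0) * fd (\<lambda>y. fd f y a) (x + s *\<^sub>R a + t *\<^sub>R b) b"
    by auto
  show ?thesis
    using s t by (intro bexI[of _ s] bexI[of _ t]) (auto simp: power2_eq_square)
qed

text \<open>The second difference over a small parallelogram is symmetric in a and b, so the two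
  mixed derivatives agree at two points near x. By continuity they then agree at x.\<close>

lemma second_derivative_symmetric_real:
  fixes f :: "'a::real_normed_vector \<Rightarrow> real"
  assumes U: "open U" "x \<in> U" and f: "smooth_on U f"
  shows "fd (\<lambda>y. fd f y a) x b = fd (\<lambda>y. fd f y b) x a"
proof (rule ccontr)
  let ?p = "\<lambda>y. fd (\<lambda>y. fd f y a) y b" and ?q = "\<lambda>y. fd (\<lambda>y. fd f y b) y a"
  assume ne: "?p x \<noteq> ?q x"
  define d where "d = \<bar>?p x - ?q x\<bar> / 2"
  have "d > 0" using ne by (simp add: d_def)
  have "isCont ?p x" "isCont ?q x"
    using smooth_on_imp_continuous_on[OF smooth_on_frechet_derivative[OF smooth_on_frechet_derivative[OF f]]]
      continuous_on_eq_continuous_at U by blast+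
  then obtain r1 r2 where r: "r1 > 0" "\<And>y. dist y x < r1 \<Longrightarrow> dist (?p y) (?p x) < d"
    "r2 > 0" "\<And>y. dist y x < r2 \<Longrightarrow> dist (?q y) (?q x) < d"
    using \<open>d > 0\<close> unfolding continuous_at_eps_delta by metis
  obtain r3 where r3: "r3 > 0" "ball x r3 \<subseteq> U" using U openE by blast
  define R where "R = min r1 (min r2 r3)"
  have "R > 0" using r r3 by (simp add: R_def)
  \<comment> \<open>Small enough that the whole parallelogram stays within R / 2 of x; the 1
    prevents a zero denominator when a and b vanish.\<close>
  define h where "h = R / (2 * (norm a + norm b + 1))"
  have pos: "norm a + norm b + 1 > 0" by (simp add: add_nonneg_pos)
  have "h > 0" using \<open>R > 0\<close> pos by (simp add: h_def)
  have near: "dist (x + s *\<^sub>R a + t *\<^sub>R b) x < R" if "s \<in> {0..h}" "t \<in> {0..h}" for s t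
  proof -
    have "dist (x + s *\<^sub>R a + t *\<^sub>R b) x = norm (s *\<^sub>R a + t *\<^sub>R b)" by (simp add: dist_norm)
    also have "\<dots> \<le> s * norm a + t * norm b"
      using norm_triangle_ineq[of "s *\<^sub>R a" "t *\<^sub>R b"] that by simp
    also have "\<dots> \<le> h * norm a + h * norm b"
      using that by (intro add_mono mult_right_mono) auto
    also have "\<dots> \<le> h * (norm a + norm b + 1)" using \<open>h > 0\<close> by (simp add: algebra_simps)
    also have "\<dots> = R / 2" unfolding h_def using less_imp_neq[OF pos] by (simp only: times_divide_eq_left mult_divide_mult_cancel_right)
    finally show ?thesis using \<open>R > 0\<close> by simp
  qed
  have sub: "x + s *\<^sub>R a + t *\<^sub>R b \<in> U" if "s \<in> {0..h}" "t \<in> {0..h}" for s t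
    using near[OF that] r3 by (auto simp: R_def dist_commute subset_iff)
  have sub': "x + s *\<^sub>R b + t *\<^sub>R a \<in> U" if "s \<in> {0..h}" "t \<in> {0..h}" for s t
    using sub[OF that(2,1)] by (simp add: add_ac)
  obtain s t where st: "s \<in> {0..h}" "t \<in> {0..h}"
    "f (x + h *\<^sub>R a + h *\<^sub>R b) - f (x + h *\<^sub>R a) - f (x + h *\<^sub>R b) + f x = h\<^sup>2 * ?p (x + s *\<^sub>R a + t *\<^sub>R b)"
    using second_difference_mean_value[OF f \<open>h > 0\<close> sub] by blast
  obtain s' t' where st': "s' \<in> {0..h}" "t' \<in> {0..h}"
    "f (x + h *\<^sub>R b + h *\<^sub>R a) - f (x + h *\<^sub>R b) - f (x + h *\<^sub>R a) + f x = h\<^sup>2 * ?q (x + s' *\<^sub>R b + t' *\<^sub>R a)"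
    using second_difference_mean_value[OF f \<open>h > 0\<close> sub'] by blast
  have "h\<^sup>2 * ?p (x + s *\<^sub>R a + t *\<^sub>R b) = h\<^sup>2 * ?q (x + t' *\<^sub>R a + s' *\<^sub>R b)"
  proof -
    have "x + h *\<^sub>R b + h *\<^sub>R a = x + h *\<^sub>R a + h *\<^sub>R b"
      "x + t' *\<^sub>R a + s' *\<^sub>R b = x + s' *\<^sub>R b + t' *\<^sub>R a" by (simp_all add: add_ac)
    then show ?thesis using st(3) st'(3) by (simp only:)
  qed
  then have "?p (x + s *\<^sub>R a + t *\<^sub>R b) = ?q (x + t' *\<^sub>R a + s' *\<^sub>R b)"
    using \<open>h > 0\<close> by simp
  moreover have "dist (?p (x + s *\<^sub>R a + t *\<^sub>R b)) (?p x) < d"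
    using near[OF st(1,2)] by (intro r) (simp add: R_def)
  moreover have "dist (?q (x + t' *\<^sub>R a + s' *\<^sub>R b)) (?q x) < d"
    using near[OF st'(2,1)] by (intro r) (simp add: R_def)
  ultimately show False unfolding d_def dist_real_def by argo
qed

lemma second_derivative_symmetric:
  fixes f :: "'a::real_normed_vector \<Rightarrow> real ^ 'n::finite"
  assumes U: "open U" "x \<in> U" and f: "smooth_on U f"
  shows "fd (\<lambda>y. fd f y a) x b = fd (\<lambda>y. fd f y b) x a"
proof -
  have *: "fd (\<lambda>y. fd f y a) x b $ i = fd (\<lambda>y. fd (\<lambda>z. f z $ i) y a) x b" for a b i
  proof -
    have 1: "fd (\<lambda>z. f z $ i) y a = fd f y a $ i" if "y \<in> U" for y
      by (intro fun_cong[OF frechet_derivative_eq] bounded_linear.has_derivative[OF bounded_linear_vec_nth]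
          smooth_on_has_derivative[OF f that])
    have "((\<lambda>y. fd f y a $ i) has_derivative (\<lambda>b. fd (\<lambda>y. fd f y a) x b $ i)) (at x)"
      by (intro bounded_linear.has_derivative[OF bounded_linear_vec_nth] smooth_on_has_derivative[OF
            smooth_on_frechet_derivative[OF f] U(2)])
    then have "((\<lambda>y. fd (\<lambda>z. f z $ i) y a) has_derivative (\<lambda>b. fd (\<lambda>y. fd f y a) x b $ i)) (at x)"
      by (rule has_derivative_transform_within_open[OF _ U]) (simp add: 1)
    from fun_cong[OF frechet_derivative_eq[OF this]] show ?thesis by simp
  qed
  show ?thesis unfolding vec_eq_iff *
    using second_derivative_symmetric_real[OF U smooth_on_vec_nth[OF U(1) f]] by blast
qed

lemma second_derivative_linear:
  fixes f :: "real ^ 'm::finite \<Rightarrow> 'b::real_normed_vector"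
  assumes U: "open U" "x \<in> U" and f: "smooth_on U f"
  shows "fd (\<lambda>y. fd f y v) x z = (\<Sum>k\<in>UNIV. v $ k *\<^sub>R fd (\<lambda>y. fd f y (axis k 1)) x z)"
proof -
  have "((\<lambda>y. \<Sum>k\<in>UNIV. v $ k *\<^sub>R fd f y (axis k 1)) has_derivative
      (\<lambda>z. \<Sum>k\<in>UNIV. v $ k *\<^sub>R fd (\<lambda>y. fd f y (axis k 1)) x z)) (at x)"
    by (intro has_derivative_sum has_derivative_scaleR_right
        smooth_on_has_derivative[OF smooth_on_frechet_derivative[OF f] U(2)])
  then have "((\<lambda>y. fd f y v) has_derivative
      (\<lambda>z. \<Sum>k\<in>UNIV. v $ k *\<^sub>R fd (\<lambda>y. fd f y (axis k 1)) x z)) (at x)"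
    by (rule has_derivative_transform_within_open[OF _ U])
      (simp add: linear_expand[OF smooth_on_linear[OF f], of _ v])
  from fun_cong[OF frechet_derivative_eq[OF this]] show ?thesis .
qed

text \<open>Smoothness controls the derivative of \<open>f\<close> only in fixed directions, so
  \<open>Y\<close> is expanded in coordinates before the product rule is applied.\<close>

lemma has_derivative_fd_apply:
  fixes f :: "real ^ 'm::finite \<Rightarrow> 'b::real_normed_vector"
  assumes U: "open U" "x \<in> U" and f: "smooth_on U f" and Y: "(Y has_derivative Y') (at x)"
  shows "((\<lambda>y. fd f y (Y y)) has_derivative
    (\<lambda>z. fd (\<lambda>y. fd f y (Y x)) x z + fd f x (Y' z))) (at x)"
proof -
  have "((\<lambda>y. \<Sum>k\<in>UNIV. Y y $ k *\<^sub>R fd f y (axis k 1)) has_derivative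
      (\<lambda>z. \<Sum>k\<in>UNIV. Y x $ k *\<^sub>R fd (\<lambda>y. fd f y (axis k 1)) x z + Y' z $ k *\<^sub>R fd f x (axis k 1))) (at x)"
    by (intro has_derivative_sum has_derivative_scaleR bounded_linear.has_derivative[OF bounded_linear_vec_nth Y]
        smooth_on_has_derivative[OF smooth_on_frechet_derivative[OF f] U(2)])
  then have "((\<lambda>y. fd f y (Y y)) has_derivative
      (\<lambda>z. \<Sum>k\<in>UNIV. Y x $ k *\<^sub>R fd (\<lambda>y. fd f y (axis k 1)) x z + Y' z $ k *\<^sub>R fd f x (axis k 1))) (at x)"
    by (rule has_derivative_transform_within_open[OF _ U])
      (simp add: linear_expand[OF smooth_on_linear[OF f]])
  then show ?thesis
    by (simp add: second_derivative_linear[OF U f, of "Y x"] sum.distrib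
        linear_expand[OF smooth_on_linear[OF f U(2)], of "Y' _"])
qed

lemma smooth_on_fd_apply:
  fixes f :: "real ^ 'm::finite \<Rightarrow> 'b::real_normed_vector"
  assumes U: "open U" and f: "smooth_on U f" and Y: "smooth_on U Y"
  shows "smooth_on U (\<lambda>y. fd f y (Y y))"
proof -
  have "smooth_on U (\<lambda>y. \<Sum>k\<in>UNIV. Y y $ k *\<^sub>R fd f y (axis k 1))"
    by (intro smooth_on_sum[OF U] smooth_on_scaleR[OF U] smooth_on_vec_nth[OF U Y]
        smooth_on_frechet_derivative[OF f])
  then show ?thesis
    by (rule smooth_on_cong[OF _ U]) (simp add: linear_expand[OF smooth_on_linear[OF f]])
qed

section \<open>The Euler-Lagrange equation in coordinates\<close>

text \<open>The squared Hilbert-Schmidt norm g^(kl) h(L e_k, L e_l) of \<open>L\<close> in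
  coordinates. \<open>H\<close> enters linearly, so the derivative of the target metric can be
  inserted in its place.\<close>

definition energy_form :: "real ^ 'm ^ 'm \<Rightarrow> real ^ 'n ^ 'n \<Rightarrow> (real ^ 'm::finite \<Rightarrow> real ^ 'n::finite) \<Rightarrow> real" where
  "energy_form G H L =
    (\<Sum>k\<in>UNIV. \<Sum>l\<in>UNIV. matrix_inv G $ k $ l * mform H (L (axis k 1)) (L (axis l 1)))"

text \<open>The frame may be chosen freely; with an adapted frame the vertical terms of the sum
  vanish.\<close>

lemma energy_form_orthonormal:
  fixes G :: "real ^ 'm::finite ^ 'm"
  assumes "spd G" "orthonormal_on G I e" "finite I" "card I = CARD('m)" "linear L"
  shows "energy_form G H L = (\<Sum>i\<in>I. mform H (L (e i)) (L (e i)))"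
proof -
  have "bilinear (\<lambda>v w. mform H (L v) (L w))"
    unfolding bilinear_def
    by (auto intro!: linearI simp: linear_add[OF assms(5)] linear_cmul[OF assms(5)] mform_simps)
  from sum_orthonormal[OF assms(1-4) this] show ?thesis by (simp add: energy_form_def)
qed

lemma mform_nonneg: "spd H \<Longrightarrow> 0 \<le> mform H v v" for v :: "real ^ 'n::finite"
  by (cases "v = 0") (auto simp: mform_simps less_imp_le spd_pos)

lemma energy_form_nonneg:
  assumes "spd G" "spd H" "linear L"
  shows "0 \<le> energy_form G H L"
proof -
  obtain b where b: "orthonormal_on G UNIV (b :: 'a \<Rightarrow> _)"
    using orthonormal_exists(2)[OF assms(1)] by blast
  show ?thesis
    unfolding energy_form_orthonormal[OF assms(1) b finite refl assms(3)]
    by (intro sum_nonneg mform_nonneg assms)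
qed

lemma smooth_on_energy_form:
  fixes G :: "'a::real_normed_vector \<Rightarrow> real ^ 'm::finite ^ 'm"
  assumes S: "open S" and G: "smooth_on S G" and spd: "\<And>x. x \<in> S \<Longrightarrow> spd (G x)"
    and H: "smooth_on S H" and L: "\<And>k. smooth_on S (\<lambda>x. L x (axis k 1))"
  shows "smooth_on S (\<lambda>x. energy_form (G x) (H x) (L x))"
  unfolding energy_form_def
  by (intro smooth_on_sum[OF S] smooth_on_mult[OF S] smooth_on_mform[OF S] H L
      smooth_on_matrix_nth[OF S smooth_on_matrix_inv[OF S G spd]])

text \<open>A horizontally conformal submersion in charts: \<open>G\<close>, \<open>H\<close> are the metrics, \<open>M\<close> is the
  squared dilation and \<open>lift w x\<close> is the adjoint of \<open>du\<^sub>x\<close> applied to \<open>w\<close>, that is \<open>M\<close> times the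
  horizontal lift of \<open>w\<close>.\<close>

locale conformal_chart =
  fixes U :: "(real ^ 'm::finite) set" and V :: "(real ^ 'n::finite) set"
    and G :: "real ^ 'm \<Rightarrow> real ^ 'm ^ 'm" and H :: "real ^ 'n \<Rightarrow> real ^ 'n ^ 'n"
    and u :: "real ^ 'm \<Rightarrow> real ^ 'n" and M :: "real ^ 'm \<Rightarrow> real"
    and lift :: "real ^ 'n \<Rightarrow> real ^ 'm \<Rightarrow> real ^ 'm"
  assumes U: "open U" and V: "open V" and uV: "u ` U \<subseteq> V"
    and u: "smooth_on U u" and G: "smooth_on U G" and H: "smooth_on V H" and M: "smooth_on U M"
    and spdG: "\<And>x. x \<in> U \<Longrightarrow> spd (G x)" and spdH: "\<And>y. y \<in> V \<Longrightarrow> spd (H y)"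
    and Mpos: "\<And>x. x \<in> U \<Longrightarrow> 0 < M x"
    and lift_def: "\<And>w x. lift w x = matrix_inv (G x) *v (\<chi> k. mform (H (u x)) w (fd u x (axis k 1)))"
    and conformal: "\<And>w x. x \<in> U \<Longrightarrow> fd u x (lift w x) = M x *\<^sub>R w"
begin

lemma uV': "x \<in> U \<Longrightarrow> u x \<in> V"
  using uV by blast

lemma Hu: "smooth_on U (\<lambda>x. H (u x))"
  by (rule smooth_on_compose[OF U uV H u])

text \<open>The inverse metric in the definition of \<open>lift\<close> cancels against
  \<open>G\<close>. In particular a lift is orthogonal to every vector that du sends to 0.\<close>

lemma mform_lift:
  assumes "x \<in> U"
  shows "mform (G x) (lift w x) v = mform (H (u x)) w (fd u x v)"
proof -
  have "mform (G x) (lift w x) v = mform (G x) v (lift w x)"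
    by (rule spd_sym[OF spdG[OF assms]])
  also have "\<dots> = (\<Sum>k\<in>UNIV. v $ k * mform (H (u x)) w (fd u x (axis k 1)))"
    by (simp add: mform_def[of "G x"] lift_def spd_invertible(4)[OF spdG[OF assms]] inner_vec_def)
  also have "\<dots> = mform (H (u x)) w (\<Sum>k\<in>UNIV. v $ k *\<^sub>R fd u x (axis k 1))"
    by (simp add: mform_sum mform_simps)
  finally show ?thesis using linear_expand[OF smooth_on_linear[OF u assms], of v] by simp
qed

lemma smooth_lift: "smooth_on U (lift w)"
proof -
  have "smooth_on U (\<lambda>x. matrix_inv (G x) *v (\<chi> k. mform (H (u x)) w (fd u x (axis k 1))))"
    by (intro smooth_on_matrix_vector[OF U] smooth_on_matrix_inv[OF U G spdG] smooth_on_vec_lambda[OF U]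
        smooth_on_mform[OF U Hu] smooth_on_const smooth_on_frechet_derivative[OF u])
  then show ?thesis by (simp add: lift_def[abs_def])
qed

text \<open>Differentiating the adjoint identity \<open>mform_lift\<close> with w and e held fixed
  determines the derivative of the lift through its products with e, and so avoids differentiating
  the inverse matrix.\<close>

lemma lift_derivative:
  assumes x: "x \<in> U"
  shows "mform (G x) e (fd (lift w) x z) =
    mform (H (u x)) w (fd (\<lambda>y. fd u y e) x z) + mform (fd H (u x) (fd u x z)) w (fd u x e)
    - mform (fd G x z) (lift w x) e"
proof -
  have 1: "((\<lambda>x. mform (G x) (lift w x) e) has_derivative
      (\<lambda>z. mform (fd G x z) (lift w x) e + mform (G x) (fd (lift w) x z) e + mform (G x) (lift w x) 0)) (at x)"
    by (intro has_derivative_mform smooth_on_has_derivative[OF G x] smooth_on_has_derivative[OF smooth_lift x]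
        has_derivative_const)
  have "((\<lambda>x. H (u x)) has_derivative (\<lambda>z. fd H (u x) (fd u x z))) (at x)"
    by (rule has_derivative_compose[OF smooth_on_has_derivative[OF u x] smooth_on_has_derivative[OF H uV'[OF x]]])
  then have "((\<lambda>x. mform (H (u x)) w (fd u x e)) has_derivative
      (\<lambda>z. mform (fd H (u x) (fd u x z)) w (fd u x e) + mform (H (u x)) 0 (fd u x e)
        + mform (H (u x)) w (fd (\<lambda>y. fd u y e) x z))) (at x)"
    by (intro has_derivative_mform has_derivative_const
        smooth_on_has_derivative[OF smooth_on_frechet_derivative[OF u] x])
  then have "((\<lambda>x. mform (G x) (lift w x) e) has_derivative
      (\<lambda>z. mform (fd H (u x) (fd u x z)) w (fd u x e) + mform (H (u x)) 0 (fd u x e)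
        + mform (H (u x)) w (fd (\<lambda>y. fd u y e) x z))) (at x)"
    by (rule has_derivative_transform_within_open[OF _ U x]) (simp add: mform_lift)
  from fun_cong[OF has_derivative_unique[OF 1 this], of z] show ?thesis
    using spd_sym[OF spdG[OF x], of e] by (simp add: mform_simps)
qed

lemma conformal_derivative:
  assumes x: "x \<in> U"
  shows "fd (\<lambda>y. fd u y (lift w x)) x z + fd u x (fd (lift w) x z) = fd M x z *\<^sub>R w"
proof -
  have "((\<lambda>y. fd u y (lift w y)) has_derivative
      (\<lambda>z. fd (\<lambda>y. fd u y (lift w x)) x z + fd u x (fd (lift w) x z))) (at x)"
    by (rule has_derivative_fd_apply[OF U x u smooth_on_has_derivative[OF smooth_lift x]])
  then show ?thesis
  proof (rule fun_cong[OF has_derivative_unique])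
    show "((\<lambda>y. fd u y (lift w y)) has_derivative (\<lambda>z. fd M x z *\<^sub>R w)) (at x)"
    by (rule has_derivative_transform_within_open[OF has_derivative_scaleR_left[OF
            smooth_on_has_derivative[OF M x]] U x]) (simp add: conformal)
  qed
qed

text \<open>In an orthonormal basis b_a of the target the energy is the trace of du du*, and
  conformality makes this operator M times the identity of an n-dimensional space.\<close>

lemma energy_density:
  assumes x: "x \<in> U"
  shows "energy_form (G x) (H (u x)) (fd u x) = real CARD('n) * M x"
proof -
  note sH = spdH[OF uV'[OF x]]
  obtain b :: "'n \<Rightarrow> real ^ 'n" where b: "orthonormal_on (H (u x)) UNIV b"
    using orthonormal_exists(2)[OF sH] by blast
  let ?p = "\<lambda>k. fd u x (axis k 1)"
  have *: "mform (H (u x)) (?p k) (?p l) = (\<Sum>a\<in>UNIV. mform (H (u x)) (b a) (?p k) * mform (H (u x)) (b a) (?p l))" for k l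
    by (subst orthonormal_expand[OF sH b finite refl, of "?p k"]) (simp add: mform_sum mform_simps)
  have "energy_form (G x) (H (u x)) (fd u x) = (\<Sum>k\<in>UNIV. \<Sum>l\<in>UNIV. \<Sum>a\<in>UNIV.
      mform (H (u x)) (b a) (?p k) * (matrix_inv (G x) $ k $ l * mform (H (u x)) (b a) (?p l)))"
    by (simp add: energy_form_def * sum_distrib_left mult_ac)
  also have "\<dots> = (\<Sum>k\<in>UNIV. \<Sum>a\<in>UNIV. \<Sum>l\<in>UNIV.
      mform (H (u x)) (b a) (?p k) * (matrix_inv (G x) $ k $ l * mform (H (u x)) (b a) (?p l)))"
    by (intro sum.cong refl sum.swap)
  also have "\<dots> = (\<Sum>a\<in>UNIV. \<Sum>k\<in>UNIV. \<Sum>l\<in>UNIV.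
      mform (H (u x)) (b a) (?p k) * (matrix_inv (G x) $ k $ l * mform (H (u x)) (b a) (?p l)))"
    by (rule sum.swap)
  also have "\<dots> = (\<Sum>a\<in>UNIV. \<Sum>k\<in>UNIV. mform (H (u x)) (b a) (?p k) * lift (b a) x $ k)"
    by (simp add: lift_def matrix_vector_mult_def sum_distrib_left)
  also have "\<dots> = (\<Sum>a\<in>UNIV. mform (H (u x)) (b a) (fd u x (lift (b a) x)))"
  proof (rule sum.cong[OF refl])
    fix a
    show "(\<Sum>k\<in>UNIV. mform (H (u x)) (b a) (?p k) * lift (b a) x $ k) =
      mform (H (u x)) (b a) (fd u x (lift (b a) x))"
      by (subst linear_expand[OF smooth_on_linear[OF u x], of "lift (b a) x"])
        (simp add: mform_sum mform_simps mult_ac)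
  qed
  also have "\<dots> = (\<Sum>a\<in>(UNIV :: 'n set). M x)"
    using b by (simp add: conformal[OF x] mform_simps orthonormal_on_def)
  finally show ?thesis by simp
qed

section \<open>The perturbed map and its first variation\<close>

definition vary :: "real ^ 'n \<Rightarrow> (real ^ 'm \<Rightarrow> real) \<Rightarrow> real \<Rightarrow> real ^ 'm \<Rightarrow> real ^ 'n" where
  "vary w \<phi> t x = u x + (t * \<phi> x) *\<^sub>R w"

text \<open>The volume density is included, so that plain Lebesgue integrals over boxes of the chart
  are energies.\<close>

definition vary_density :: "real \<Rightarrow> real ^ 'n \<Rightarrow> (real ^ 'm \<Rightarrow> real) \<Rightarrow> real \<Rightarrow> real ^ 'm \<Rightarrow> real" where
  "vary_density \<alpha> w \<phi> t x =
    (1 + energy_form (G x) (H (vary w \<phi> t x)) (fd (vary w \<phi> t) x)) powr \<alpha> * sqrt (det (G x))"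

lemma vary_0: "vary w \<phi> 0 = u"
  by (simp add: vary_def fun_eq_iff)

lemma fd_vary:
  assumes \<phi>: "smooth_on UNIV \<phi>" and x: "x \<in> U"
  shows "fd (vary w \<phi> t) x v = fd u x v + (t * fd \<phi> x v) *\<^sub>R w"
    and "smooth_on U (vary w \<phi> t)"
proof -
  have "((\<lambda>x. u x + (t * \<phi> x) *\<^sub>R w) has_derivative (\<lambda>v. fd u x v + (t * fd \<phi> x v) *\<^sub>R w)) (at x)"
    by (intro has_derivative_add has_derivative_scaleR_left has_derivative_mult_right
        smooth_on_has_derivative[OF u x] smooth_on_has_derivative[OF \<phi> UNIV_I])
  then show "fd (vary w \<phi> t) x v = fd u x v + (t * fd \<phi> x v) *\<^sub>R w"
    by (simp add: vary_def[abs_def] frechet_derivative_eq)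
  show "smooth_on U (vary w \<phi> t)"
    unfolding vary_def[abs_def]
    by (intro smooth_on_add[OF U] u smooth_on_scaleR[OF U] smooth_on_mult[OF U] smooth_on_const
        smooth_on_subset[OF \<phi>]) simp
qed

lemma smooth_vary:
  assumes "smooth_on UNIV \<phi>"
  shows "smooth_on (UNIV \<times> U) (\<lambda>z. vary w \<phi> (fst z) (snd z))"
proof -
  have P: "open (UNIV \<times> U :: (real \<times> (real ^ 'm)) set)" by (simp add: open_Times U)
  have snd: "smooth_on (UNIV \<times> U) (\<lambda>z :: real \<times> (real ^ 'm). f (snd z))" if "smooth_on U f"
    for f :: "real ^ 'm \<Rightarrow> 'c::real_normed_vector"
    by (rule smooth_on_compose[OF P _ that]) (auto intro!: smooth_on_bounded_linear bounded_linear_snd)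
  have "smooth_on (UNIV \<times> U) (fst :: real \<times> (real ^ 'm) \<Rightarrow> real)"
    by (intro smooth_on_bounded_linear bounded_linear_fst)
  then show ?thesis
    unfolding vary_def
    by (intro smooth_on_add[OF P] smooth_on_scaleR[OF P] smooth_on_mult[OF P] smooth_on_const
        snd[OF u] snd[OF smooth_on_subset[OF assms subset_UNIV]])
qed

text \<open>The image of the box is compact and therefore has a positive distance \<open>d\<close>
  to the complement of \<open>V\<close>, while outside the box nothing is moved.\<close>

lemma vary_in_V:
  assumes \<phi>: "smooth_on UNIV \<phi>" and ab: "cbox a b \<subseteq> U" and supp: "\<And>x. x \<notin> cbox a b \<Longrightarrow> \<phi> x = 0"
  shows "\<exists>\<epsilon>>0. \<forall>t\<in>{-\<epsilon><..<\<epsilon>}. \<forall>x\<in>U. vary w \<phi> t x \<in> V"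
proof -
  have "compact (u ` cbox a b)"
    by (intro compact_continuous_image continuous_on_subset[OF smooth_on_imp_continuous_on[OF u] ab]) auto
  moreover have "u ` cbox a b \<subseteq> V" using ab uV by blast
  ultimately obtain d where d: "d > 0" "(\<Union>y\<in>u ` cbox a b. cball y d) \<subseteq> V"
    using compact_subset_open_imp_cball_epsilon_subset[OF _ V] by metis
  have "bounded (\<phi> ` cbox a b)"
    by (intro compact_imp_bounded compact_continuous_image continuous_on_subset[OF smooth_on_imp_continuous_on[OF \<phi>]]) auto
  then obtain C where C: "C > 0" "\<And>x. x \<in> cbox a b \<Longrightarrow> \<bar>\<phi> x\<bar> \<le> C"
    unfolding bounded_pos by auto
  \<comment> \<open>For such t the displacement t \<phi> w is at most d; the 1 keeps the denominator
    positive when w = 0.\<close>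
  define \<epsilon> where "\<epsilon> = d / (C * (norm w + 1))"
  have pos: "0 < C * (norm w + 1)" using C by (simp add: add_nonneg_pos)
  then have "\<epsilon> > 0" using d by (simp add: \<epsilon>_def)
  moreover have "vary w \<phi> t x \<in> V" if t: "t \<in> {-\<epsilon><..<\<epsilon>}" and x: "x \<in> U" for t x
  proof (cases "x \<in> cbox a b")
    case True
    have "norm ((t * \<phi> x) *\<^sub>R w) = \<bar>t\<bar> * (\<bar>\<phi> x\<bar> * norm w)" by (simp add: abs_mult)
    also have "\<dots> \<le> \<epsilon> * (C * (norm w + 1))"
      using t C(2)[OF True] \<open>C > 0\<close> by (intro mult_mono) auto
    also have "\<dots> = d" using less_imp_neq[OF pos] by (simp add: \<epsilon>_def)
    finally have "vary w \<phi> t x \<in> cball (u x) d" by (simp add: vary_def dist_norm)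
    then show ?thesis using d True by blast
  next
    case False
    then show ?thesis using supp uV'[OF x] by (simp add: vary_def)
  qed
  ultimately show ?thesis by blast
qed

lemma alpha_weight_smooth:
  "smooth_on U (\<lambda>x. (1 + real CARD('n) * M x) powr (\<alpha> - 1) * sqrt (det (G x)))"
proof -
  have "0 < 1 + real CARD('n) * M x" if "x \<in> U" for x
    using Mpos[OF that] by (simp add: add_pos_pos)
  then show ?thesis
    by (intro smooth_on_mult[OF U] smooth_on_powr_compose[OF U] smooth_on_add[OF U] smooth_on_const M
        smooth_on_sqrt[OF U] smooth_on_det[OF U] smooth_on_matrix_nth[OF U G] spd_det_pos spdG)
qed

text \<open>The perturbed map and its derivative are affine in t. The energy therefore changes
  through \<open>H\<close>, whose base point moves in the direction \<phi> w, and through two mixed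
  terms that agree by symmetry and give 2 d\<phi>(du* w).\<close>

lemma first_variation:
  assumes \<phi>: "smooth_on UNIV \<phi>" and ab: "cbox a b \<subseteq> U" and supp: "\<And>x. x \<notin> cbox a b \<Longrightarrow> \<phi> x = 0"
  shows "((\<lambda>t. integral (cbox a b) (vary_density \<alpha> w \<phi> t)) has_real_derivative
    integral (cbox a b) (\<lambda>x. \<alpha> * ((1 + real CARD('n) * M x) powr (\<alpha> - 1) * sqrt (det (G x))) *
      (2 * fd \<phi> x (lift w x) + \<phi> x * energy_form (G x) (fd H (u x) w) (fd u x)))) (at 0)"
proof -
  obtain \<epsilon> where \<epsilon>: "\<epsilon> > 0" "\<And>t x. t \<in> {-\<epsilon><..<\<epsilon>} \<Longrightarrow> x \<in> U \<Longrightarrow> vary w \<phi> t x \<in> V"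
    using vary_in_V[OF \<phi> ab supp, of w] by blast
  define P where "P = {-\<epsilon><..<\<epsilon>} \<times> U"
  have P: "open P" by (simp add: P_def open_Times U)
  \<comment> \<open>The derivative of the perturbed map written out, so that its joint smoothness in
    t and x can be read off.\<close>
  define L where "L z v = fd u (snd z) v + (fst z * fd \<phi> (snd z) v) *\<^sub>R w" for z :: "real \<times> (real ^ 'm)" and v
  define E where "E z = energy_form (G (snd z)) (H (vary w \<phi> (fst z) (snd z))) (L z)" for z
  define K where "K z = (1 + E z) powr \<alpha> * sqrt (det (G (snd z)))" for z
  have snd: "smooth_on P (\<lambda>z. f (snd z))" if "smooth_on U f" for f :: "real ^ 'm \<Rightarrow> 'c::real_normed_vector"
    by (rule smooth_on_compose[OF P _ that]) (auto simp: P_def intro!: smooth_on_bounded_linear bounded_linear_snd)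
  have fst: "smooth_on P fst" by (intro smooth_on_bounded_linear bounded_linear_fst)
  have \<phi>': "smooth_on U \<phi>" by (rule smooth_on_subset[OF \<phi>]) simp
  have vsm: "smooth_on P (\<lambda>z. vary w \<phi> (fst z) (snd z))"
    by (rule smooth_on_subset[OF smooth_vary[OF \<phi>]]) (auto simp: P_def)
  have Lsm: "smooth_on P (\<lambda>z. L z v)" for v
    unfolding L_def
    by (intro smooth_on_add[OF P] smooth_on_scaleR[OF P] smooth_on_mult[OF P] smooth_on_const fst
        snd[OF smooth_on_frechet_derivative[OF u]] snd[OF smooth_on_frechet_derivative[OF \<phi>']])
  have Esm: "smooth_on P E"
    unfolding E_def
    by (intro smooth_on_energy_form[OF P snd[OF G] _ _ Lsm] smooth_on_compose[OF P _ H vsm])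
      (auto simp: P_def spdG \<epsilon>)
  have Lfd: "L (t, x) = fd (vary w \<phi> t) x" if "x \<in> U" for t x
    by (simp add: fun_eq_iff L_def fd_vary(1)[OF \<phi> that])
  have Epos: "0 < 1 + E z" if "z \<in> P" for z
  proof -
    obtain t x where z: "z = (t, x)" by fastforce
    have tx: "t \<in> {-\<epsilon><..<\<epsilon>}" "x \<in> U" using that by (auto simp: P_def z)
    have "0 \<le> E (t, x)"
      unfolding E_def Lfd[OF tx(2)] fst_conv snd_conv
      by (intro energy_form_nonneg spdG spdH \<epsilon> tx smooth_on_linear[OF fd_vary(2)[OF \<phi> tx(2)] tx(2)])
    then show ?thesis by (simp add: z)
  qed
  have Ksm: "smooth_on P K"
    unfolding K_def
    by (intro smooth_on_mult[OF P] smooth_on_powr_compose[OF P] smooth_on_add[OF P] smooth_on_const Esm Epos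
        snd[OF smooth_on_sqrt[OF U smooth_on_det[OF U smooth_on_matrix_nth[OF U G]] spd_det_pos[OF spdG]]])
  have Kd: "vary_density \<alpha> w \<phi> t x = K (t, x)" if "x \<in> U" for t x
    by (simp add: vary_density_def K_def E_def Lfd[OF that])
  have "((\<lambda>t. integral (cbox a b) (\<lambda>x. K (t, x))) has_real_derivative
      integral (cbox a b) (\<lambda>x. fd K (0, x) (1, 0))) (at 0)"
    by (rule leibniz_rule_smooth[OF P Ksm \<epsilon>(1)]) (use ab in \<open>auto simp: P_def\<close>)
  moreover have "integral (cbox a b) (\<lambda>x. K (t, x)) = integral (cbox a b) (vary_density \<alpha> w \<phi> t)" for t
    by (rule integral_cong) (use ab Kd in auto)
  moreover have "integral (cbox a b) (\<lambda>x. fd K (0, x) (1, 0)) =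
    integral (cbox a b) (\<lambda>x. \<alpha> * ((1 + real CARD('n) * M x) powr (\<alpha> - 1) * sqrt (det (G x))) *
      (2 * fd \<phi> x (lift w x) + \<phi> x * energy_form (G x) (fd H (u x) w) (fd u x)))"
  proof (rule integral_cong)
    fix x assume "x \<in> cbox a b"
    then have x: "x \<in> U" using ab by auto
    then have xP: "(0, x) \<in> P" using \<epsilon>(1) by (simp add: P_def)
    let ?B = "matrix_inv (G x)" and ?p = "\<lambda>k. fd u x (axis k 1)" and ?q = "\<lambda>k. fd \<phi> x (axis k 1)"
      and ?H = "H (u x)"
    let ?E' = "2 * fd \<phi> x (lift w x) + \<phi> x * energy_form (G x) (fd H (u x) w) (fd u x)"
    have linH: "linear (fd H (u x))" by (rule smooth_on_linear[OF H uV'[OF x]])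
    have v': "((\<lambda>t. vary w \<phi> t x) has_derivative (\<lambda>s. (s * \<phi> x) *\<^sub>R w)) (at 0)"
      unfolding vary_def by (auto intro!: derivative_eq_intros)
    have H': "((\<lambda>t. H (vary w \<phi> t x)) has_derivative (\<lambda>s. (s * \<phi> x) *\<^sub>R fd H (u x) w)) (at 0)"
    proof -
      have "(H has_derivative fd H (u x)) (at (vary w \<phi> 0 x))"
        using smooth_on_has_derivative[OF H uV'[OF x]] by (simp add: vary_0)
      from has_derivative_compose[OF v' this] show ?thesis by (simp add: linear_cmul[OF linH])
    qed
    have L': "((\<lambda>t. L (t, x) (axis k 1)) has_derivative (\<lambda>s. (s * ?q k) *\<^sub>R w)) (at 0)" for k
      unfolding L_def by (auto intro!: derivative_eq_intros)
    have L0: "L (0, x) = fd u x" by (simp add: L_def fun_eq_iff)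
    \<comment> \<open>Contracting h(w, du e_l) with the inverse metric is the definition of the lift
      of w.\<close>
    have q: "(\<Sum>k\<in>UNIV. \<Sum>l\<in>UNIV. ?B $ k $ l * (?q k * mform ?H w (?p l))) = fd \<phi> x (lift w x)"
    proof -
      have "fd \<phi> x (lift w x) = (\<Sum>k\<in>UNIV. lift w x $ k *\<^sub>R ?q k)"
        by (rule linear_expand[OF smooth_on_linear[OF \<phi> UNIV_I]])
      also have "\<dots> = (\<Sum>k\<in>UNIV. \<Sum>l\<in>UNIV. ?B $ k $ l * (?q k * mform ?H w (?p l)))"
        by (simp add: lift_def matrix_vector_mult_def sum_distrib_left mult_ac)
      finally show ?thesis by simp
    qed
    have q2: "(\<Sum>k\<in>UNIV. \<Sum>l\<in>UNIV. ?B $ k $ l * (?q l * mform ?H (?p k) w)) = fd \<phi> x (lift w x)"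
    proof -
      have "(\<Sum>k\<in>UNIV. \<Sum>l\<in>UNIV. ?B $ k $ l * (?q l * mform ?H (?p k) w)) =
        (\<Sum>l\<in>UNIV. \<Sum>k\<in>UNIV. ?B $ k $ l * (?q l * mform ?H (?p k) w))" by (rule sum.swap)
      then show ?thesis
        using q matrix_inv_sym[OF spdG[OF x]] spd_sym[OF spdH[OF uV'[OF x]], of _ w] by simp
    qed
    have "((\<lambda>t. E (t, x)) has_derivative (\<lambda>s. \<Sum>k\<in>UNIV. \<Sum>l\<in>UNIV. ?B $ k $ l *
        (mform ((s * \<phi> x) *\<^sub>R fd H (u x) w) (L (0, x) (axis k 1)) (L (0, x) (axis l 1)) +
         mform (H (vary w \<phi> 0 x)) ((s * ?q k) *\<^sub>R w) (L (0, x) (axis l 1)) +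
         mform (H (vary w \<phi> 0 x)) (L (0, x) (axis k 1)) ((s * ?q l) *\<^sub>R w)))) (at 0)"
      unfolding E_def energy_form_def fst_conv snd_conv
      by (intro has_derivative_sum has_derivative_mult_right has_derivative_mform H' L')
    moreover have "(\<Sum>k\<in>UNIV. \<Sum>l\<in>UNIV. ?B $ k $ l *
        (mform ((s * \<phi> x) *\<^sub>R fd H (u x) w) (L (0, x) (axis k 1)) (L (0, x) (axis l 1)) +
         mform (H (vary w \<phi> 0 x)) ((s * ?q k) *\<^sub>R w) (L (0, x) (axis l 1)) +
         mform (H (vary w \<phi> 0 x)) (L (0, x) (axis k 1)) ((s * ?q l) *\<^sub>R w))) = ?E' * s" for s
    proof -
      have "(\<Sum>k\<in>UNIV. \<Sum>l\<in>UNIV. ?B $ k $ l *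
        (mform ((s * \<phi> x) *\<^sub>R fd H (u x) w) (L (0, x) (axis k 1)) (L (0, x) (axis l 1)) +
         mform (H (vary w \<phi> 0 x)) ((s * ?q k) *\<^sub>R w) (L (0, x) (axis l 1)) +
         mform (H (vary w \<phi> 0 x)) (L (0, x) (axis k 1)) ((s * ?q l) *\<^sub>R w))) =
        (\<Sum>k\<in>UNIV. \<Sum>l\<in>UNIV. s * (\<phi> x * (?B $ k $ l * mform (fd H (u x) w) (?p k) (?p l)) +
          ?B $ k $ l * (?q k * mform ?H w (?p l)) + ?B $ k $ l * (?q l * mform ?H (?p k) w)))"
        by (intro sum.cong refl) (simp add: L0 vary_0 mform_simps mform_scaleR_matrix algebra_simps)
      also have "\<dots> = s * (\<phi> x * energy_form (G x) (fd H (u x) w) (fd u x) +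
          (\<Sum>k\<in>UNIV. \<Sum>l\<in>UNIV. ?B $ k $ l * (?q k * mform ?H w (?p l))) +
          (\<Sum>k\<in>UNIV. \<Sum>l\<in>UNIV. ?B $ k $ l * (?q l * mform ?H (?p k) w)))"
        unfolding energy_form_def by (simp only: sum.distrib sum_distrib_left[symmetric])
      finally show ?thesis unfolding q q2 by (simp add: algebra_simps)
    qed
    ultimately have E': "((\<lambda>t. E (t, x)) has_real_derivative ?E') (at 0)"
      by (simp add: has_field_derivative_def)
    have E0: "E (0, x) = real CARD('n) * M x"
      by (simp add: E_def L0 vary_0 energy_density[OF x])
    have "((\<lambda>t. (1 + E (t, x)) powr \<alpha>) has_real_derivative \<alpha> * (1 + E (0, x)) powr (\<alpha> - 1) * ?E') (at 0)"
    proof -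
      have 1: "((\<lambda>t. 1 + E (t, x)) has_real_derivative ?E') (at 0)"
        using DERIV_add[OF DERIV_const E', of 1] by simp
      show ?thesis
        using DERIV_chain2[OF has_real_derivative_powr[OF Epos[OF xP]] 1] by simp
    qed
    then have K': "((\<lambda>t. K (t, x)) has_real_derivative
        \<alpha> * (1 + E (0, x)) powr (\<alpha> - 1) * ?E' * sqrt (det (G x))) (at 0)"
      unfolding K_def snd_conv by (rule DERIV_cmult_right)
    have "fd K (0, x) (1, 0) = \<alpha> * (1 + E (0, x)) powr (\<alpha> - 1) * ?E' * sqrt (det (G x))"
      using fun_cong[OF has_derivative_unique[OF has_derivative_partial[OF smooth_on_has_derivative[OF Ksm xP]]
            K'[unfolded has_field_derivative_def]], of 1] by simp
    then show "fd K (0, x) (1, 0) = \<alpha> * ((1 + real CARD('n) * M x) powr (\<alpha> - 1) * sqrt (det (G x))) * ?E'"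
      by (simp add: E0 mult_ac)
  qed
  ultimately show ?thesis by simp
qed

end

section \<open>The pointwise equation and its vertical trace\<close>

context conformal_chart
begin

text \<open>The first variation is the weak form of div Z = c with Z = 2 \<alpha> \<rho> du* w. The
  divergence is a coordinate one, because \<rho> contains the volume density; expanding it by the
  product rule and cancelling \<alpha> gives the claim.\<close>

lemma euler_lagrange:
  assumes x: "x \<in> U" and "\<alpha> \<noteq> 0"
    and weak: "\<And>a b \<phi> w. \<lbrakk>cbox a b \<subseteq> U; smooth_on UNIV \<phi>; \<And>x. x \<notin> cbox a b \<Longrightarrow> \<phi> x = 0\<rbrakk>
      \<Longrightarrow> ((\<lambda>t. integral (cbox a b) (vary_density \<alpha> w \<phi> t)) has_real_derivative 0) (at 0)"
    and \<rho>: "\<And>x. \<rho> x = (1 + real CARD('n) * M x) powr (\<alpha> - 1) * sqrt (det (G x))"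
  shows "2 * (fd \<rho> x (lift w x) + \<rho> x * (\<Sum>j\<in>UNIV. fd (lift w) x (axis j 1) $ j)) =
    \<rho> x * energy_form (G x) (fd H (u x) w) (fd u x)"
proof -
  define Z where "Z x = (2 * \<alpha> * \<rho> x) *\<^sub>R lift w x" for x
  define c where "c x = \<alpha> * \<rho> x * energy_form (G x) (fd H (u x) w) (fd u x)" for x
  have \<rho>s: "smooth_on U \<rho>"
    using alpha_weight_smooth[of \<alpha>] by (simp add: \<rho>[abs_def])
  have Zs: "smooth_on U Z"
    unfolding Z_def[abs_def]
    by (intro smooth_on_scaleR[OF U] smooth_on_mult[OF U] smooth_on_const \<rho>s smooth_lift)
  have "smooth_on U c"
    unfolding c_def[abs_def]
    by (intro smooth_on_mult[OF U] smooth_on_const \<rho>s smooth_on_energy_form[OF U G spdG]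
        smooth_on_frechet_derivative[OF u]
        smooth_on_compose[OF U uV smooth_on_frechet_derivative[OF H] u])
  then have cc: "continuous_on U c" by (rule smooth_on_imp_continuous_on)
  have main: "(\<Sum>j\<in>UNIV. fd Z x (axis j 1) $ j) = c x"
  proof (rule weak_divergence_imp_pointwise[OF U x Zs cc])
    fix a b and \<phi> :: "real ^ 'm \<Rightarrow> real"
    assume ab: "cbox a b \<subseteq> U" and \<phi>: "smooth_on UNIV \<phi>" and supp: "\<And>x. x \<notin> cbox a b \<Longrightarrow> \<phi> x = 0"
    have "fd \<phi> x (Z x) + \<phi> x * c x = \<alpha> * \<rho> x *
      (2 * fd \<phi> x (lift w x) + \<phi> x * energy_form (G x) (fd H (u x) w) (fd u x))" for x
      unfolding Z_def c_def
      by (subst linear_cmul[OF smooth_on_linear[OF \<phi> UNIV_I]]) (simp add: algebra_simps)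
    then show "integral (cbox a b) (\<lambda>x. fd \<phi> x (Z x) + \<phi> x * c x) = 0"
      using DERIV_unique[OF first_variation[where \<alpha>=\<alpha> and w=w, OF \<phi> ab supp]
          weak[where w=w, OF ab \<phi> supp]]
      by (simp add: \<rho>)
  qed
  have "(Z has_derivative (\<lambda>z. (2 * \<alpha> * \<rho> x) *\<^sub>R fd (lift w) x z + (2 * \<alpha> * fd \<rho> x z) *\<^sub>R lift w x)) (at x)"
    unfolding Z_def[abs_def]
    by (intro has_derivative_scaleR has_derivative_mult_right smooth_on_has_derivative[OF \<rho>s x]
        smooth_on_has_derivative[OF smooth_lift x])
  then have "fd Z x z = (2 * \<alpha> * \<rho> x) *\<^sub>R fd (lift w) x z + (2 * \<alpha> * fd \<rho> x z) *\<^sub>R lift w x" for z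
    by (simp add: frechet_derivative_eq)
  then have "(\<Sum>j\<in>UNIV. fd Z x (axis j 1) $ j) =
    2 * \<alpha> * (\<rho> x * (\<Sum>j\<in>UNIV. fd (lift w) x (axis j 1) $ j) + (\<Sum>j\<in>UNIV. lift w x $ j *\<^sub>R fd \<rho> x (axis j 1)))"
    by (simp add: sum.distrib sum_distrib_left algebra_simps)
  also have "(\<Sum>j\<in>UNIV. lift w x $ j *\<^sub>R fd \<rho> x (axis j 1)) = fd \<rho> x (lift w x)"
    by (rule linear_expand[OF smooth_on_linear[OF \<rho>s x], symmetric])
  finally have "\<alpha> * (2 * (fd \<rho> x (lift w x) + \<rho> x * (\<Sum>j\<in>UNIV. fd (lift w) x (axis j 1) $ j))) =
    \<alpha> * (\<rho> x * energy_form (G x) (fd H (u x) w) (fd u x))"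
    using main by (simp add: c_def algebra_simps)
  then show ?thesis using \<open>\<alpha> \<noteq> 0\<close> by simp
qed

text \<open>A logarithmic derivative: the power of 1 + n M gives the first term, and the square root
  of det G gives half the trace of dG by Jacobi's formula.\<close>

lemma alpha_weight_derivative:
  assumes x: "x \<in> U" and o: "orthonormal_on (G x) I e" "finite I" "card I = CARD('m)"
    and \<rho>: "\<And>x. \<rho> x = (1 + real CARD('n) * M x) powr (\<alpha> - 1) * sqrt (det (G x))"
  shows "fd \<rho> x z = \<rho> x * ((\<alpha> - 1) * real CARD('n) * fd M x z / (1 + real CARD('n) * M x)
    + (\<Sum>i\<in>I. mform (fd G x z) (e i) (e i)) / 2)"
proof -
  let ?c = "1 + real CARD('n) * M x"
  have c: "0 < ?c" using Mpos[OF x] by (simp add: add_pos_pos)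
  have d: "0 < det (G x)" by (rule spd_det_pos[OF spdG[OF x]])
  let ?F' = "\<lambda>z. (\<alpha> - 1) * ?c powr (\<alpha> - 1 - 1) * (real CARD('n) * fd M x z)"
  let ?S' = "\<lambda>z. inverse (sqrt (det (G x))) / 2 * (det (G x) * (\<Sum>i\<in>I. mform (fd G x z) (e i) (e i)))"
  have 1: "((\<lambda>x. (1 + real CARD('n) * M x) powr (\<alpha> - 1)) has_derivative ?F') (at x)"
  proof -
    have "((\<lambda>x. 1 + real CARD('n) * M x) has_derivative (\<lambda>z. real CARD('n) * fd M x z)) (at x)"
      using has_derivative_add[OF has_derivative_const has_derivative_mult_right[OF smooth_on_has_derivative[OF M x]]]
      by simp
    moreover have "((\<lambda>s. s powr (\<alpha> - 1)) has_derivative (*) ((\<alpha> - 1) * ?c powr (\<alpha> - 1 - 1))) (at ?c)"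
      by (rule has_real_derivative_powr[OF c, unfolded has_field_derivative_def])
    ultimately show ?thesis by (rule has_derivative_compose)
  qed
  have 2: "((\<lambda>x. sqrt (det (G x))) has_derivative ?S') (at x)"
  proof -
    have "((\<lambda>x. det (G x)) has_derivative (\<lambda>z. det (G x) * (\<Sum>i\<in>I. mform (fd G x z) (e i) (e i)))) (at x)"
      by (rule has_derivative_det[OF smooth_on_has_derivative[OF G x] spdG[OF x] o])
    moreover have "(sqrt has_derivative (*) (inverse (sqrt (det (G x))) / 2)) (at (det (G x)))"
      using DERIV_real_sqrt[OF d] by (simp add: has_field_derivative_def)
    ultimately show ?thesis by (rule has_derivative_compose)
  qed
  have "\<rho> = (\<lambda>x. (1 + real CARD('n) * M x) powr (\<alpha> - 1) * sqrt (det (G x)))"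
    by (rule ext) (rule \<rho>)
  then have "(\<rho> has_derivative (\<lambda>z. ?c powr (\<alpha> - 1) * ?S' z + ?F' z * sqrt (det (G x)))) (at x)"
    using has_derivative_mult[OF 1 2] by (simp only:)
  then have "fd \<rho> x z = ?c powr (\<alpha> - 1) * ?S' z + ?F' z * sqrt (det (G x))"
    by (rule fun_cong[OF frechet_derivative_eq])
  moreover have "?S' z = sqrt (det (G x)) * ((\<Sum>i\<in>I. mform (fd G x z) (e i) (e i)) / 2)"
  proof -
    have e: "inverse (sqrt (det (G x))) * det (G x) = sqrt (det (G x))"
      using real_div_sqrt[of "det (G x)"] d by (simp add: divide_inverse mult.commute)
    have "?S' z = (inverse (sqrt (det (G x))) * det (G x)) * ((\<Sum>i\<in>I. mform (fd G x z) (e i) (e i)) / 2)"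
      by simp
    then show ?thesis unfolding e .
  qed
  moreover have "?c powr (\<alpha> - 1 - 1) = ?c powr (\<alpha> - 1) / ?c"
    using c powr_diff[of ?c "\<alpha> - 1" 1] by simp
  ultimately have "fd \<rho> x z = ?c powr (\<alpha> - 1) * (sqrt (det (G x)) * ((\<Sum>i\<in>I. mform (fd G x z) (e i) (e i)) / 2)) +
      (\<alpha> - 1) * (?c powr (\<alpha> - 1) / ?c) * (real CARD('n) * fd M x z) * sqrt (det (G x))"
    by (simp only:)
  also have "\<dots> = (?c powr (\<alpha> - 1) * sqrt (det (G x))) * ((\<alpha> - 1) * real CARD('n) * fd M x z / ?c
    + (\<Sum>i\<in>I. mform (fd G x z) (e i) (e i)) / 2)"
    by (simp only: distrib_left times_divide_eq_left times_divide_eq_right mult_ac add.commute)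
  finally show ?thesis unfolding \<rho>[of x] .
qed

text \<open>Only the values \<open>e i\<close> of a frame at one point enter, since all derivatives
  are taken along fixed vectors and with fixed target vectors. The left side will turn out to be M
  times the sum of g(nabla_{e_i} e_i, e_a) over the vertical i, in a form free of derivatives of the
  frame. The hypothesis \<open>hor\<close> expresses du* du e_i = M e_i.\<close>

lemma vertical_trace:
  fixes e :: "nat \<Rightarrow> real ^ 'm"
  assumes x: "x \<in> U" and "\<alpha> \<noteq> 0"
    and weak: "\<And>a b \<phi> w. \<lbrakk>cbox a b \<subseteq> U; smooth_on UNIV \<phi>; \<And>x. x \<notin> cbox a b \<Longrightarrow> \<phi> x = 0\<rbrakk>
      \<Longrightarrow> ((\<lambda>t. integral (cbox a b) (vary_density \<alpha> w \<phi> t)) has_real_derivative 0) (at 0)"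
    and o: "orthonormal_on (G x) {1..CARD('m)} e" and mn: "CARD('n) < CARD('m)"
    and vert: "\<And>i. i \<in> {CARD('n)+1..CARD('m)} \<Longrightarrow> fd u x (e i) = 0"
    and hor: "\<And>i. i \<in> {1..CARD('n)} \<Longrightarrow> lift (fd u x (e i)) x = M x *\<^sub>R e i"
    and a: "a \<in> {1..CARD('n)}"
  shows "(\<Sum>i\<in>{CARD('n)+1..CARD('m)}. M x * (mform (fd G x (e i)) (e i) (e a) - mform (fd G x (e a)) (e i) (e i) / 2)
      - mform (H (u x)) (fd u x (e a)) (fd (\<lambda>y. fd u y (e i)) x (e i))) =
    ((\<alpha> - 1) * real CARD('n) * M x / (1 + real CARD('n) * M x) + 1 - real CARD('n) / 2) * fd M x (e a)"
proof -
  let ?m = "CARD('m)" and ?n = "CARD('n)"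
  define p where "p i = fd u x (e i)" for i
  define g where "g i j k = mform (fd G x (e i)) (e j) (e k)" for i j k
  define h where "h i j k = mform (fd H (u x) (p i)) (p j) (p k)" for i j k
  \<comment> \<open>The second derivative of u in the directions e_z and e_v, paired with p_b. In
    \<open>g\<close> and \<open>h\<close> the first index is likewise the direction of
    differentiation.\<close>
  define S where "S b z v = mform (H (u x)) (p b) (fd (\<lambda>y. fd u y (e v)) x (e z))" for b z v
  have o': "mform (G x) (e i) (e j) = (if i = j then 1 else 0)" if "i \<in> {1..?m}" "j \<in> {1..?m}" for i j
    using o that by (simp add: orthonormal_on_def)
  have gsym: "g i j k = g i k j" for i j k
  proof -
    have "((\<lambda>x. mform (G x) v w) has_derivative (\<lambda>z. mform (fd G x z) v w)) (at x)" for v w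
      using has_derivative_mform[OF smooth_on_has_derivative[OF G x] has_derivative_const has_derivative_const]
      by (simp add: mform_simps)
    moreover have "((\<lambda>x. mform (G x) (e k) (e j)) has_derivative (\<lambda>z. mform (fd G x z) (e j) (e k))) (at x)"
      by (rule has_derivative_transform_within_open[OF calculation[of "e j" "e k"] U x])
        (rule spd_sym[OF spdG])
    ultimately show ?thesis
      unfolding g_def using fun_cong[OF has_derivative_unique] by blast
  qed
  \<comment> \<open>The vector p_a is held constant while its lift is differentiated; at the point
    itself this lift equals M e_a.\<close>
  have ld: "mform (G x) (e i) (fd (lift (p a)) x (e z)) =
      S a z i + mform (fd H (u x) (p z)) (p a) (p i) - M x * g z a i"
    if "a \<in> {1..?n}" for a i z
    using lift_derivative[OF x, of "e i" "p a" "e z"] hor[OF that]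
    by (simp add: S_def p_def g_def mform_simps)
  have sub: "{1..?n} \<subseteq> {1..?m}" using mn by auto
  \<comment> \<open>The identity du (du* p_a) = M p_a, differentiated along e_z and paired with p_b.
    Since M e_b is the lift of p_b, the term with du of the derivative of the lift becomes a product
    to which \<open>ld\<close> applies, and a common factor M cancels.\<close>
  have A: "S b z a + S a z b = (if a = b then fd M x (e z) else 0) + M x * g z a b - h z a b"
    if ab: "a \<in> {1..?n}" "b \<in> {1..?n}" for a b z
  proof -
    have lb: "lift (p b) x = M x *\<^sub>R e b" using hor[OF ab(2)] by (simp add: p_def)
    have la: "lift (p a) x = M x *\<^sub>R e a" using hor[OF ab(1)] by (simp add: p_def)
    have 1: "fd (\<lambda>y. fd u y (M x *\<^sub>R e a)) x (e z) = M x *\<^sub>R fd (\<lambda>y. fd u y (e a)) x (e z)"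
      by (simp add: second_derivative_linear[OF U x u, of "M x *\<^sub>R e a"]
          second_derivative_linear[OF U x u, of "e a"] scaleR_sum_right)
    have 2: "mform (H (u x)) (p b) y = M x * mform (G x) (e b) w" if "y = fd u x w" for y w
      using mform_lift[OF x, of "p b" w] that by (simp add: lb mform_simps)
    have "mform (H (u x)) (p b) (fd (\<lambda>y. fd u y (lift (p a) x)) x (e z) + fd u x (fd (lift (p a)) x (e z))) =
      mform (H (u x)) (p b) (fd M x (e z) *\<^sub>R p a)"
      by (simp only: conformal_derivative[OF x])
    then have "M x * S b z a + M x * mform (G x) (e b) (fd (lift (p a)) x (e z)) =
        fd M x (e z) * mform (H (u x)) (p b) (p a)"
      by (simp add: mform_simps la 1 2[OF refl] S_def)
    also have "mform (H (u x)) (p b) (p a) = M x * (if a = b then 1 else 0)"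
      using 2[of "p a" "e a"] o'[of b a] ab sub by (auto simp: p_def)
    finally have "M x * (S b z a + mform (G x) (e b) (fd (lift (p a)) x (e z))) =
        M x * (if a = b then fd M x (e z) else 0)"
      by (simp add: algebra_simps)
    then have "S b z a + mform (G x) (e b) (fd (lift (p a)) x (e z)) = (if a = b then fd M x (e z) else 0)"
      using Mpos[OF x] by simp
    then show ?thesis unfolding ld[OF ab(1)] by (simp add: h_def)
  qed
  have Ssym: "S b i j = S b j i" for b i j
    unfolding S_def by (simp add: second_derivative_symmetric[OF U x u, of "e i"])
  \<comment> \<open>As in the Koszul formula, \<open>A\<close> at \<open>(a, c)\<close> minus half of \<open>A\<close> at \<open>(c, c)\<close> isolates \<open>S a c c\<close>.\<close>
  have A': "S a c c + h c a c - M x * g c a c + M x * g a c c / 2 - h a c c / 2 =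
      (if a = c then fd M x (e c) else 0) - fd M x (e a) / 2" if c: "c \<in> {1..?n}" for c
    using A[OF a c, of c] A[OF c c, of a] Ssym[of c a c] by (simp add: field_simps)
  define \<rho> where "\<rho> x = (1 + real ?n * M x) powr (\<alpha> - 1) * sqrt (det (G x))" for x
  have \<rho>pos: "0 < \<rho> x"
  proof -
    have "0 < 1 + real ?n * M x" using Mpos[OF x] by (simp add: add_pos_pos)
    then show ?thesis using spd_det_pos[OF spdG[OF x]] by (simp add: \<rho>_def)
  qed
  have tr: "(\<Sum>j\<in>UNIV. fd (lift (p a)) x (axis j 1) $ j) =
      (\<Sum>i\<in>{1..?m}. mform (G x) (e i) (fd (lift (p a)) x (e i)))"
    by (rule trace_orthonormal[OF spdG[OF x] o, symmetric])
      (auto intro: smooth_on_linear[OF smooth_lift x])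
  have split: "(\<Sum>i\<in>{1..?m}. f i) = (\<Sum>i\<in>{1..?n}. f i) + (\<Sum>i\<in>{?n+1..?m}. f i)" for f :: "nat \<Rightarrow> real"
    using sum.ub_add_nat[of 1 ?n f "?m - ?n"] mn by simp
  have p0: "p i = 0" if "i \<in> {?n+1..?m}" for i using vert[OF that] by (simp add: p_def)
  \<comment> \<open>The trace of dH(p_a) runs over the whole frame, but the vertical vectors are
    sent to 0, so only horizontal terms stay.\<close>
  have ef: "energy_form (G x) (fd H (u x) (p a)) (fd u x) = (\<Sum>c\<in>{1..?n}. h a c c)"
  proof -
    have "energy_form (G x) (fd H (u x) (p a)) (fd u x) = (\<Sum>i\<in>{1..?m}. h a i i)"
      unfolding h_def p_def
      by (rule energy_form_orthonormal[OF spdG[OF x] o]) (auto intro: smooth_on_linear[OF u x])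
    then show ?thesis unfolding split by (simp add: h_def p0 mform_simps)
  qed
  define q where "q = (\<alpha> - 1) * real ?n * fd M x (e a) / (1 + real ?n * M x)"
  define W where "W = (\<Sum>i\<in>{1..?m}. g a i i) / 2"
  define T where "T = (\<Sum>i\<in>{1..?m}. mform (G x) (e i) (fd (lift (p a)) x (e i)))"
  define R where "R = (\<Sum>c\<in>{1..?n}. h a c c)"
  have f1: "fd \<rho> x (e a) = \<rho> x * (q + W)"
    unfolding g_def q_def W_def by (rule alpha_weight_derivative[OF x o]) (simp_all add: \<rho>_def)
  have "linear (fd \<rho> x)"
    using smooth_on_linear[OF alpha_weight_smooth x, of \<alpha>] by (simp add: \<rho>_def[abs_def])
  then have f2: "fd \<rho> x (lift (p a) x) = M x * fd \<rho> x (e a)"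
    using hor[OF a] by (simp add: p_def linear_cmul)
  have E: "2 * (fd \<rho> x (lift (p a) x) + \<rho> x * T) = \<rho> x * R"
    unfolding T_def R_def tr[symmetric] ef[symmetric]
    by (rule euler_lagrange[OF x \<open>\<alpha> \<noteq> 0\<close>]) (fact weak \<rho>_def)+
  have "\<rho> x * (2 * (M x * (q + W) + T)) = \<rho> x * R"
    using E unfolding f2 f1 by (simp add: algebra_simps)
  then have E': "2 * (M x * (q + W) + T) = R"
    using \<rho>pos by simp
  have "(\<Sum>i\<in>{1..?m}. M x * g a i i / 2 + S a i i + mform (fd H (u x) (p i)) (p a) (p i) - M x * g i a i) =
      M x * W + T"
    by (simp add: W_def T_def ld[OF a] sum.distrib sum_subtractf sum_distrib_left sum_divide_distrib)
  moreover have "(\<Sum>c\<in>{1..?n}. h a c c / 2) = R / 2"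
    by (simp add: R_def sum_divide_distrib)
  \<comment> \<open>The Euler-Lagrange equation divided by 2 \<rho>, with the trace of dG and the
    divergence of the lift merged into one sum over the frame.\<close>
  ultimately have EL: "M x * q + (\<Sum>i\<in>{1..?m}. M x * g a i i / 2 + S a i i + mform (fd H (u x) (p i)) (p a) (p i) - M x * g i a i) -
      (\<Sum>c\<in>{1..?n}. h a c c / 2) = 0"
    using E' by (simp add: algebra_simps)
  \<comment> \<open>For vertical i the vector p_i is 0, so the derivative of the target metric drops
    out of this part of the sum.\<close>
  have "(\<Sum>i\<in>{?n+1..?m}. M x * g a i i / 2 + S a i i + mform (fd H (u x) (p i)) (p a) (p i) - M x * g i a i) =
      - (\<Sum>i\<in>{?n+1..?m}. M x * (g i i a - g a i i / 2) - S a i i)"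
    unfolding sum_negf[symmetric]
    by (rule sum.cong[OF refl]) (simp add: p0 mform_simps gsym[of _ _ a] algebra_simps)
  with EL have "(\<Sum>i\<in>{?n+1..?m}. M x * (g i i a - g a i i / 2) - S a i i) = M x * q +
      (\<Sum>c\<in>{1..?n}. M x * g a c c / 2 + S a c c + h c a c - M x * g c a c) - (\<Sum>c\<in>{1..?n}. h a c c / 2)"
    unfolding split by (simp add: h_def)
  also have "\<dots> = M x * q + (\<Sum>c\<in>{1..?n}. S a c c + h c a c - M x * g c a c + M x * g a c c / 2 - h a c c / 2)"
    by (simp add: sum.distrib sum_subtractf)
  also have "(\<Sum>c\<in>{1..?n}. S a c c + h c a c - M x * g c a c + M x * g a c c / 2 - h a c c / 2) =
      (\<Sum>c\<in>{1..?n}. (if a = c then fd M x (e c) else 0) - fd M x (e a) / 2)"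
    by (rule sum.cong[OF refl]) (rule A')
  \<comment> \<open>The Kronecker term is met once, for c = a, and gives the summand 1 of the
    coefficient; the n halves give - n / 2.\<close>
  also have "\<dots> = fd M x (e a) - real ?n * (fd M x (e a) / 2)"
    using a by (simp add: sum_subtractf)
  finally show ?thesis by (simp add: g_def S_def p_def q_def algebra_simps)
qed

end

section \<open>Charts, tangent vectors and metrics\<close>

locale atlas =
  fixes A :: "('a::{t2_space, second_countable_topology}, 'm::finite) chart set"
  assumes smooth_atlas: "smooth_atlas A"
begin

lemma chart_at: "chart_at A p \<in> A" "p \<in> cdom (chart_at A p)"
proof -
  have "\<exists>c. c \<in> A \<and> p \<in> cdom c"
    using smooth_atlas unfolding smooth_atlas_def by blast
  then have "chart_at A p \<in> A \<and> p \<in> cdom (chart_at A p)"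
    unfolding chart_at_def by (rule someI_ex)
  then show "chart_at A p \<in> A" "p \<in> cdom (chart_at A p)" by auto
qed

lemma chart:
  assumes "c \<in> A"
  shows "open (cdom c)" "open (cmap c ` cdom c)"
    and "homeomorphism (cdom c) (cmap c ` cdom c) (cmap c) (cinv c)"
    and cinv_cmap: "\<And>p. p \<in> cdom c \<Longrightarrow> cinv c (cmap c p) = p"
    and cmap_cinv: "\<And>x. x \<in> cmap c ` cdom c \<Longrightarrow> cmap c (cinv c x) = x"
    and cinv_in: "\<And>x. x \<in> cmap c ` cdom c \<Longrightarrow> cinv c x \<in> cdom c"
    and continuous_cmap: "continuous_on (cdom c) (cmap c)"
    and continuous_cinv: "continuous_on (cmap c ` cdom c) (cinv c)"
proof -
  show h: "homeomorphism (cdom c) (cmap c ` cdom c) (cmap c) (cinv c)"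
    and "open (cdom c)" "open (cmap c ` cdom c)"
    using smooth_atlas assms unfolding smooth_atlas_def by blast+
  show "\<And>p. p \<in> cdom c \<Longrightarrow> cinv c (cmap c p) = p"
    "\<And>x. x \<in> cmap c ` cdom c \<Longrightarrow> cmap c (cinv c x) = x"
    "\<And>x. x \<in> cmap c ` cdom c \<Longrightarrow> cinv c x \<in> cdom c"
    "continuous_on (cdom c) (cmap c)" "continuous_on (cmap c ` cdom c) (cinv c)"
    using h by (auto simp: homeomorphism_def)
qed

lemma open_cmap_image:
  assumes c: "c \<in> A" and W: "open W" "W \<subseteq> cdom c"
  shows "open (cmap c ` W)"
proof -
  have "cmap c ` W = cmap c ` cdom c \<inter> cinv c -` W"
    using W(2) cinv_cmap[OF c] by (auto simp: image_iff)
  then show ?thesis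
    using continuous_open_preimage[OF continuous_cinv[OF c] chart(2)[OF c] W(1)] by simp
qed

lemma open_cinv_image:
  assumes c: "c \<in> A" and Y: "open Y" "Y \<subseteq> cmap c ` cdom c"
  shows "open (cinv c ` Y)"
proof -
  have "cinv c ` Y = cdom c \<inter> cmap c -` Y"
    using Y(2) cinv_cmap[OF c] cmap_cinv[OF c] cinv_in[OF c] by (auto simp: image_iff) (metis subsetD)+
  then show ?thesis
    using continuous_open_preimage[OF continuous_cmap[OF c] chart(1)[OF c] Y(1)] by simp
qed

lemma transition:
  assumes "c \<in> A" "d \<in> A"
  shows "open (cmap c ` (cdom c \<inter> cdom d))"
    and "smooth_on (cmap c ` (cdom c \<inter> cdom d)) (cmap d \<circ> cinv c)"
  using open_cmap_image[OF assms(1), of "cdom c \<inter> cdom d"] chart(1)[OF assms(1)] chart(1)[OF assms(2)]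
    smooth_atlas assms by (auto simp: smooth_atlas_def open_Int)

abbreviation dtrans :: "('a, 'm) chart \<Rightarrow> ('a, 'm) chart \<Rightarrow> 'a \<Rightarrow> real ^ 'm \<Rightarrow> real ^ 'm" where
  "dtrans c d p \<equiv> fd (cmap d \<circ> cinv c) (cmap c p)"

text \<open>A tangent vector at \<open>p\<close> is stored by its components in \<open>chart_at A p\<close>; \<open>comps c p\<close> and
  \<open>vect c p\<close> pass to the components in \<open>c\<close> and back.\<close>

abbreviation comps :: "('a, 'm) chart \<Rightarrow> 'a \<Rightarrow> real ^ 'm \<Rightarrow> real ^ 'm" where
  "comps c p \<equiv> dtrans (chart_at A p) c p"

abbreviation vect :: "('a, 'm) chart \<Rightarrow> 'a \<Rightarrow> real ^ 'm \<Rightarrow> real ^ 'm" where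
  "vect c p \<equiv> dtrans c (chart_at A p) p"

lemma has_derivative_dtrans:
  assumes "c \<in> A" "d \<in> A" "p \<in> cdom c" "p \<in> cdom d"
  shows "((cmap d \<circ> cinv c) has_derivative dtrans c d p) (at (cmap c p))"
  by (rule smooth_on_has_derivative[OF transition(2)[OF assms(1,2)]]) (use assms in auto)

lemma linear_dtrans:
  assumes "c \<in> A" "d \<in> A" "p \<in> cdom c" "p \<in> cdom d"
  shows "linear (dtrans c d p)"
  using has_derivative_dtrans[OF assms] by (rule has_derivative_linear)

text \<open>The two chart expressions of \<open>f\<close> differ by a transition map only over the
  overlap of the charts, which is open and so suffices for the chain rule.\<close>

lemma chart_change:
  fixes f :: "'a \<Rightarrow> 'z::real_normed_vector"
  assumes c: "c \<in> A" "p \<in> cdom c" and d: "d \<in> A" "p \<in> cdom d"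
    and f: "((f \<circ> cinv c) has_derivative f') (at (cmap c p))"
  shows "((f \<circ> cinv d) has_derivative (\<lambda>v. f' (dtrans d c p v))) (at (cmap d p))"
proof -
  have "((f \<circ> cinv c) has_derivative f') (at ((cmap c \<circ> cinv d) (cmap d p)))"
    using f cinv_cmap[OF d] by simp
  from has_derivative_compose[OF has_derivative_dtrans[OF d(1) c(1) d(2) c(2)] this]
  have "((\<lambda>x. (f \<circ> cinv c) ((cmap c \<circ> cinv d) x)) has_derivative (\<lambda>v. f' (dtrans d c p v))) (at (cmap d p))" .
  then show ?thesis
  proof (rule has_derivative_transform_within_open)
    show "open (cmap d ` (cdom d \<inter> cdom c))" by (rule transition(1)[OF d(1) c(1)])
    show "cmap d p \<in> cmap d ` (cdom d \<inter> cdom c)" using c d by auto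
    show "(f \<circ> cinv c) ((cmap c \<circ> cinv d) x) = (f \<circ> cinv d) x" if "x \<in> cmap d ` (cdom d \<inter> cdom c)" for x
      using that cinv_cmap[OF c(1)] cinv_cmap[OF d(1)] by auto
  qed
qed

lemma dtrans_self:
  assumes "c \<in> A" "p \<in> cdom c"
  shows "dtrans c c p v = v"
proof -
  have "((\<lambda>x. x) has_derivative (\<lambda>v. v)) (at (cmap c p))" by (rule has_derivative_ident)
  then have "((cmap c \<circ> cinv c) has_derivative (\<lambda>v. v)) (at (cmap c p))"
    by (rule has_derivative_transform_within_open[OF _ chart(2)[OF assms(1)]])
      (use assms cinv_cmap[OF assms(1)] in auto)
  then show ?thesis by (simp add: frechet_derivative_eq)
qed

text \<open>The chain rule for \<open>f = cmap e\<close>; with e = c it makes the derivatives of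
  opposite transitions inverse to each other.\<close>

lemma dtrans_compose:
  assumes "c \<in> A" "p \<in> cdom c" "d \<in> A" "p \<in> cdom d" "e \<in> A" "p \<in> cdom e"
  shows "dtrans d e p (dtrans c d p v) = dtrans c e p v"
  using chart_change[OF assms(3,4,1,2) has_derivative_dtrans[OF assms(3,5,4,6)]]
  by (simp add: frechet_derivative_eq)

lemma dtrans_inverse:
  assumes "c \<in> A" "p \<in> cdom c" "d \<in> A" "p \<in> cdom d"
  shows "dtrans d c p (dtrans c d p v) = v"
  by (simp add: dtrans_compose dtrans_self assms)

lemmas vect_comps = dtrans_inverse[OF chart_at]
  and comps_vect = dtrans_inverse[OF _ _ chart_at]

lemma linear_comps: "c \<in> A \<Longrightarrow> p \<in> cdom c \<Longrightarrow> linear (comps c p)"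
  and linear_vect: "c \<in> A \<Longrightarrow> p \<in> cdom c \<Longrightarrow> linear (vect c p)"
  by (auto intro!: linear_dtrans chart_at)

lemma comps_chart_at: "comps (chart_at A p) p v = v"
  by (simp add: dtrans_self chart_at)

lemma field_in_chart_eq:
  "field_in_chart A c X x = comps c (cinv c x) (X (cinv c x))"
  by (simp add: field_in_chart_def Let_def)

lemma function_differential_eq:
  assumes c: "c \<in> A" "p \<in> cdom c" and f: "smooth_function A f"
  shows "function_differential A f p v = fd (f \<circ> cinv c) (cmap c p) (comps c p v)"
proof -
  have "((f \<circ> cinv c) has_derivative fd (f \<circ> cinv c) (cmap c p)) (at (cmap c p))"
    by (rule smooth_on_has_derivative[of "cmap c ` cdom c"])
      (use f c in \<open>auto simp: smooth_function_def\<close>)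
  from frechet_derivative_eq[OF chart_change[OF c chart_at this]] show ?thesis
    by (simp add: function_differential_def)
qed

end

section \<open>The metric and the gradient in charts\<close>

locale riemannian = atlas A for A :: "('a::{t2_space, second_countable_topology}, 'm::finite) chart set" +
  fixes g :: "('a, 'm) metric_tensor"
  assumes metric: "riemannian_metric A g"
begin

lemma bilinear_metric: "bilinear (g p)"
  and metric_sym: "g p v w = g p w v"
  and metric_pos: "v \<noteq> 0 \<Longrightarrow> 0 < g p v v"
  using metric unfolding riemannian_metric_def by blast+

abbreviation gmat :: "('a, 'm) chart \<Rightarrow> real ^ 'm \<Rightarrow> real ^ 'm ^ 'm" where
  "gmat \<equiv> metric_matrix A g"

text \<open>The entries of the metric matrix are the values of \<open>g\<close> on the vectors
  \<open>vect c p (axis i 1)\<close>, and both sides are bilinear.\<close>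

lemma metric_vect:
  assumes c: "c \<in> A" "p \<in> cdom c"
  shows "g p (vect c p v) (vect c p w) = mform (gmat c (cmap c p)) v w"
proof -
  have lin: "linear (vect c p)" by (rule linear_vect[OF c])
  have bil: "bilinear (\<lambda>v w. g p (vect c p v) (vect c p w))"
    unfolding bilinear_def
    by (auto intro!: linearI simp: linear_add[OF lin] linear_cmul[OF lin]
        bilinear_ladd[OF bilinear_metric] bilinear_radd[OF bilinear_metric]
        bilinear_lmul[OF bilinear_metric] bilinear_rmul[OF bilinear_metric])
  have "gmat c (cmap c p) $ i $ j = g p (vect c p (axis i 1)) (vect c p (axis j 1))" for i j
    by (simp add: metric_matrix_def cinv_cmap[OF c] coord_vector_def)
  then show ?thesis
    by (simp add: bilinear_expand[OF bil, of v w] bilinear_expand[OF bilinear_mform, of _ v w] mform_axis)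
qed

lemma metric_comps:
  assumes c: "c \<in> A" "p \<in> cdom c"
  shows "g p v w = mform (gmat c (cmap c p)) (comps c p v) (comps c p w)"
  using metric_vect[OF c, of "comps c p v" "comps c p w"] by (simp add: vect_comps c)

lemma spd_metric_matrix:
  assumes c: "c \<in> A" and x: "x \<in> cmap c ` cdom c"
  shows "spd (gmat c x)"
proof -
  obtain p where p: "p \<in> cdom c" "x = cmap c p" using x by auto
  show ?thesis
    unfolding spd_def p(2) metric_vect[OF c p(1), symmetric]
  proof (intro conjI allI impI)
    fix v :: "real ^ 'm" assume "v \<noteq> 0"
    then have "vect c p v \<noteq> 0"
      using comps_vect[OF c p(1), of v] linear_0[OF linear_comps[OF c p(1)]] by auto
    then show "0 < g p (vect c p v) (vect c p v)" by (rule metric_pos)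
  qed (rule metric_sym)
qed

lemma smooth_metric_matrix: "c \<in> A \<Longrightarrow> smooth_on (cmap c ` cdom c) (gmat c)"
  by (rule smooth_on_matrixI[OF chart(2)]) (use metric in \<open>auto simp: riemannian_metric_def\<close>)

text \<open>\<open>gradient\<close> is a definite description, so both halves are shown: the inverse
  matrix applied to the differential is a solution, and the difference of two solutions has length
  0.\<close>

lemma gradient:
  assumes f: "smooth_function A f"
  shows "g p (gradient A g f p) w = function_differential A f p w"
proof -
  let ?c = "chart_at A p"
  let ?G = "gmat ?c (cmap ?c p)"
  have s: "spd ?G" by (rule spd_metric_matrix[OF chart_at(1)]) (use chart_at(2) in auto)
  have geq: "g p v w = mform ?G v w" for v w
    using metric_comps[OF chart_at] by (simp add: comps_chart_at)
  have "linear (function_differential A f p)"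
  proof -
    have "linear (fd (f \<circ> cinv ?c) (cmap ?c p))"
      by (rule smooth_on_linear[of "cmap ?c ` cdom ?c"])
        (use f chart_at in \<open>auto simp: smooth_function_def\<close>)
    then show ?thesis by (simp add: function_differential_def[abs_def])
  qed
  then have lin: "function_differential A f p w = (\<Sum>k\<in>UNIV. w $ k *\<^sub>R function_differential A f p (axis k 1))" for w
    by (rule linear_expand)
  define v where "v = matrix_inv ?G *v (\<chi> k. function_differential A f p (axis k 1))"
  have v: "g p v w = function_differential A f p w" for w
  proof -
    have "g p v w = w \<bullet> (?G *v v)" unfolding geq spd_sym[OF s, of v] by (simp add: mform_def)
    also have "\<dots> = function_differential A f p w"
      unfolding v_def spd_invertible(4)[OF s] by (subst lin) (simp add: inner_vec_def)
    finally show ?thesis .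
  qed
  have "v' = v" if "\<And>w. g p v' w = function_differential A f p w" for v'
  proof (rule ccontr)
    assume "v' \<noteq> v"
    then have "0 < g p (v' - v) (v' - v)" by (intro metric_pos) simp
    also have "g p (v' - v) (v' - v) = 0"
      unfolding bilinear_lsub[OF bilinear_metric] by (simp add: that v)
    finally show False by simp
  qed
  then have "gradient A g f p = v"
    unfolding gradient_def using v by (intro the_equality) blast+
  then show ?thesis by (simp add: v)
qed

lemma orthonormal_basis_comps:
  assumes "c \<in> A" "p \<in> cdom c"
  shows "orthonormal_basis g p b \<longleftrightarrow> orthonormal_on (gmat c (cmap c p)) UNIV (\<lambda>i. comps c p (b i))"
  by (simp add: orthonormal_basis_def orthonormal_on_def metric_comps[OF assms])

text \<open>\<open>hs_norm\<close> picks its basis by \<open>SOME\<close>; the existence of a basis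
  is what makes the pick orthonormal.\<close>

lemma orthonormal_basis_some: "orthonormal_basis g p (SOME b. orthonormal_basis g p b)"
proof (rule someI_ex[of "orthonormal_basis g p"])
  let ?c = "chart_at A p"
  have "spd (gmat ?c (cmap ?c p))"
    by (rule spd_metric_matrix[OF chart_at(1)]) (use chart_at(2) in auto)
  then obtain b where "orthonormal_on (gmat ?c (cmap ?c p)) UNIV (b :: 'm \<Rightarrow> _)"
    using orthonormal_exists(2) by blast
  then show "\<exists>b. orthonormal_basis g p b"
    unfolding orthonormal_basis_comps[OF chart_at] comps_chart_at by blast
qed

end

section \<open>Differential and Hilbert-Schmidt norm of a map in a pair of charts\<close>

locale two_manifolds = M: riemannian A g + N: riemannian B h
  for A :: "('a::{t2_space, second_countable_topology}, 'm::finite) chart set" and g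
    and B :: "('b::{t2_space, second_countable_topology}, 'n::finite) chart set" and h
begin

text \<open>The map is assumed differentiable in the charts at p only, with a neighbourhood going
  into the target chart. In this form the transformation rule, and with it the norm formula, applies
  to the perturbed maps too.\<close>

lemma tangent_map_chart:
  assumes c: "c \<in> A" and d: "d \<in> B" and W: "open W" "p \<in> W" "W \<subseteq> cdom c" "\<psi> ` W \<subseteq> cdom d"
    and diff: "(cmap d \<circ> \<psi> \<circ> cinv c) differentiable (at (cmap c p))"
  shows "N.comps d (\<psi> p) (tangent_map A B \<psi> p v) = fd (cmap d \<circ> \<psi> \<circ> cinv c) (cmap c p) (M.comps c p v)"
    and "linear (tangent_map A B \<psi> p)"
proof -
  let ?d' = "chart_at B (\<psi> p)" and ?c' = "chart_at A p"
  have p: "p \<in> cdom c" "\<psi> p \<in> cdom d" using W by auto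
  note d' = N.chart_at[of "\<psi> p"]
  have "((cmap ?d' \<circ> cinv d) has_derivative N.vect d (\<psi> p)) (at ((cmap d \<circ> \<psi> \<circ> cinv c) (cmap c p)))"
    using N.has_derivative_dtrans[OF d d'(1) p(2) d'(2)] M.cinv_cmap[OF c p(1)] by simp
  from has_derivative_compose[OF frechet_derivative_has_derivative[OF diff] this]
  have "((\<lambda>x. (cmap ?d' \<circ> cinv d) ((cmap d \<circ> \<psi> \<circ> cinv c) x)) has_derivative
      (\<lambda>v. N.vect d (\<psi> p) (fd (cmap d \<circ> \<psi> \<circ> cinv c) (cmap c p) v))) (at (cmap c p))" .
  then have "((cmap ?d' \<circ> \<psi> \<circ> cinv c) has_derivative
      (\<lambda>v. N.vect d (\<psi> p) (fd (cmap d \<circ> \<psi> \<circ> cinv c) (cmap c p) v))) (at (cmap c p))"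
  proof (rule has_derivative_transform_within_open)
    show "open (cmap c ` W)" by (rule M.open_cmap_image[OF c W(1,3)])
    show "cmap c p \<in> cmap c ` W" using W by simp
    show "(cmap ?d' \<circ> cinv d) ((cmap d \<circ> \<psi> \<circ> cinv c) x) = (cmap ?d' \<circ> \<psi> \<circ> cinv c) x"
      if x: "x \<in> cmap c ` W" for x
    proof -
      obtain q where q: "q \<in> W" "x = cmap c q" using x by blast
      then have "q \<in> cdom c" "\<psi> q \<in> cdom d" using W by auto
      then show ?thesis by (simp add: q M.cinv_cmap[OF c] N.cinv_cmap[OF d])
    qed
  qed
  from M.chart_change[OF c p(1) M.chart_at this]
  have t: "((cmap ?d' \<circ> \<psi> \<circ> cinv ?c') has_derivative
      (\<lambda>v. N.vect d (\<psi> p) (fd (cmap d \<circ> \<psi> \<circ> cinv c) (cmap c p) (M.comps c p v)))) (at (cmap ?c' p))" .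
  show "N.comps d (\<psi> p) (tangent_map A B \<psi> p v) = fd (cmap d \<circ> \<psi> \<circ> cinv c) (cmap c p) (M.comps c p v)"
    unfolding tangent_map_def frechet_derivative_eq[OF t] by (rule N.comps_vect[OF d p(2)])
  show "linear (tangent_map A B \<psi> p)"
    unfolding tangent_map_def frechet_derivative_eq[OF t] by (rule has_derivative_linear[OF t])
qed

lemma hs_norm_chart:
  assumes c: "c \<in> A" and d: "d \<in> B" and W: "open W" "p \<in> W" "W \<subseteq> cdom c" "\<psi> ` W \<subseteq> cdom d"
    and diff: "(cmap d \<circ> \<psi> \<circ> cinv c) differentiable (at (cmap c p))"
  shows "(hs_norm A g B h \<psi> p)\<^sup>2 =
    energy_form (M.gmat c (cmap c p)) (N.gmat d (cmap d (\<psi> p))) (fd (cmap d \<circ> \<psi> \<circ> cinv c) (cmap c p))"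
proof -
  have p: "p \<in> cdom c" "\<psi> p \<in> cdom d" using W by auto
  let ?G = "M.gmat c (cmap c p)" and ?H = "N.gmat d (cmap d (\<psi> p))"
    and ?L = "fd (cmap d \<circ> \<psi> \<circ> cinv c) (cmap c p)"
  define b where "b = (SOME b. orthonormal_basis g p b)"
  have b: "orthonormal_on ?G UNIV (\<lambda>i. M.comps c p (b i))"
    using M.orthonormal_basis_some[of p] unfolding b_def M.orthonormal_basis_comps[OF c p(1)] .
  have sH: "spd ?H" by (rule N.spd_metric_matrix[OF d]) (use p in auto)
  have sG: "spd ?G" by (rule M.spd_metric_matrix[OF c]) (use p in auto)
  have "(\<Sum>i\<in>UNIV. h (\<psi> p) (tangent_map A B \<psi> p (b i)) (tangent_map A B \<psi> p (b i))) =
    (\<Sum>i\<in>UNIV. mform ?H (?L (M.comps c p (b i))) (?L (M.comps c p (b i))))"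
    by (simp add: N.metric_comps[OF d p(2)] tangent_map_chart(1)[OF assms])
  also have "\<dots> = energy_form ?G ?H ?L"
    by (rule energy_form_orthonormal[OF sG b finite refl, symmetric])
      (rule linear_frechet_derivative[OF diff])
  finally have eq: "(\<Sum>i\<in>UNIV. h (\<psi> p) (tangent_map A B \<psi> p (b i)) (tangent_map A B \<psi> p (b i))) =
    energy_form ?G ?H ?L" .
  have "0 \<le> energy_form ?G ?H ?L"
    by (rule energy_form_nonneg[OF sG sH linear_frechet_derivative[OF diff]])
  then show ?thesis by (simp add: hs_norm_def Let_def b_def[symmetric] eq)
qed

end

section \<open>The Riemannian measure in a chart\<close>

context riemannian
begin

text \<open>The set is the continuous image of the box under \<open>cinv c\<close>; it is closed
  because the manifold is Hausdorff.\<close>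

lemma compact_chart_box:
  assumes c: "c \<in> A" and ab: "cbox a b \<subseteq> cmap c ` cdom c"
  shows "compact {p\<in>cdom c. cmap c p \<in> cbox a b}" "closed {p\<in>cdom c. cmap c p \<in> cbox a b}"
proof -
  have "{p\<in>cdom c. cmap c p \<in> cbox a b} = cinv c ` cbox a b"
    using ab cinv_cmap[OF c] cmap_cinv[OF c] cinv_in[OF c]
    by (auto simp: image_iff) (metis subsetD)+
  then show "compact {p\<in>cdom c. cmap c p \<in> cbox a b}"
    using compact_continuous_image[OF continuous_on_subset[OF continuous_cinv[OF c] ab]] by simp
  then show "closed {p\<in>cdom c. cmap c p \<in> cbox a b}" by (rule compact_imp_closed)
qed

text \<open>The Riemannian measure is known on Borel sets inside one chart, which says that its
  restriction to the chart is the image of a weighted Lebesgue measure. The default values make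
  \<open>w\<close> and \<kappa> Borel on all of the coordinate space, and the value 0 of
  \<open>w\<close> removes the points outside the chart image.\<close>

lemma chart_measure:
  assumes dV: "riemannian_measure A g dV" and c: "c \<in> A"
  defines "W \<equiv> cmap c ` cdom c"
  defines "w \<equiv> \<lambda>x. if x \<in> W then sqrt (det (gmat c x)) else 0"
    and "\<kappa> \<equiv> \<lambda>x. if x \<in> W then cinv c x else undefined"
  shows "w \<in> borel_measurable borel" "\<kappa> \<in> borel_measurable borel"
    and "density dV (indicator (cdom c)) = distr (density lborel (\<lambda>x. ennreal (w x))) borel \<kappa>"
proof -
  have W: "open W" unfolding W_def by (rule chart(2)[OF c])
  have "continuous_on W (\<lambda>x. sqrt (det (gmat c x)))"
    unfolding W_def
    by (intro smooth_on_imp_continuous_on smooth_on_sqrt[OF chart(2)[OF c]] smooth_on_det[OF chart(2)[OF c]]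
        smooth_on_matrix_nth[OF chart(2)[OF c]] smooth_metric_matrix[OF c] spd_det_pos spd_metric_matrix[OF c])
  then show w: "w \<in> borel_measurable borel"
    unfolding w_def using W by (intro borel_measurable_continuous_on_if) auto
  show \<kappa>: "\<kappa> \<in> borel_measurable borel"
    unfolding \<kappa>_def using W continuous_cinv[OF c] by (intro borel_measurable_continuous_on_if) (auto simp: W_def)
  have sets: "sets dV = sets borel" and space: "space dV = UNIV"
    using dV sets_eq_imp_space_eq[of dV borel] by (auto simp: riemannian_measure_def)
  have C: "cdom c \<in> sets borel" using chart(1)[OF c] by simp
  show "density dV (indicator (cdom c)) = distr (density lborel (\<lambda>x. ennreal (w x))) borel \<kappa>"
  proof (rule measure_eqI)
    show "sets (density dV (indicator (cdom c))) = sets (distr (density lborel (\<lambda>x. ennreal (w x))) borel \<kappa>)"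
      by (simp add: sets)
  next
    fix S assume "S \<in> sets (density dV (indicator (cdom c)))"
    then have S: "S \<in> sets borel" by (simp add: sets)
    have "emeasure (density dV (indicator (cdom c))) S = emeasure dV (cdom c \<inter> S)"
    proof (subst emeasure_density)
      show "(indicator (cdom c) :: 'a \<Rightarrow> ennreal) \<in> borel_measurable dV" using C sets by simp
      show "S \<in> sets dV" using S sets by simp
      have "(\<integral>\<^sup>+p. indicator (cdom c) p * indicator S p \<partial>dV) = (\<integral>\<^sup>+p. indicator (cdom c \<inter> S) p \<partial>dV)"
        by (intro nn_integral_cong) (auto split: split_indicator)
      then show "(\<integral>\<^sup>+p. indicator (cdom c) p * indicator S p \<partial>dV) = emeasure dV (cdom c \<inter> S)"
        using C S sets by simp
    qed
    also have "\<dots> = (\<integral>\<^sup>+x\<in>cmap c ` (cdom c \<inter> S). ennreal (sqrt (det (gmat c x))) \<partial>lborel)"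
    proof -
      have "\<forall>c\<in>A. \<forall>S\<in>sets borel. S \<subseteq> cdom c \<longrightarrow>
          emeasure dV S = (\<integral>\<^sup>+x\<in>cmap c ` S. ennreal (sqrt (det (gmat c x))) \<partial>lborel)"
        using dV unfolding riemannian_measure_def by (rule conjunct2)
      from mp[OF bspec[OF bspec[OF this c] sets.Int[OF C S]] Int_lower1] show ?thesis .
    qed
    also have "\<dots> = (\<integral>\<^sup>+x. ennreal (w x) * indicator (\<kappa> -` S) x \<partial>lborel)"
    proof (intro nn_integral_cong)
      fix x
      have "x \<in> cmap c ` (cdom c \<inter> S) \<longleftrightarrow> x \<in> W \<and> cinv c x \<in> S"
        unfolding W_def using cinv_cmap[OF c] by (auto simp: image_iff)
      then show "ennreal (sqrt (det (gmat c x))) * indicator (cmap c ` (cdom c \<inter> S)) x =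
        ennreal (w x) * indicator (\<kappa> -` S) x"
        by (auto simp: w_def \<kappa>_def split: split_indicator)
    qed
    also have "\<dots> = emeasure (density lborel (\<lambda>x. ennreal (w x))) (\<kappa> -` S)"
      using w measurable_sets[OF \<kappa> S] by (subst emeasure_density) auto
    also have "\<dots> = emeasure (distr (density lborel (\<lambda>x. ennreal (w x))) borel \<kappa>) S"
      using \<kappa> S by (subst emeasure_distr) auto
    finally show "emeasure (density dV (indicator (cdom c))) S =
      emeasure (distr (density lborel (\<lambda>x. ennreal (w x))) borel \<kappa>) S" .
  qed
qed

text \<open>Integrability is part of the claim: the energy of a perturbation is split into two
  Bochner integrals, which is legitimate only if both summands are integrable.\<close>

lemma chart_integral:
  assumes dV: "riemannian_measure A g dV" and c: "c \<in> A" and ab: "cbox a b \<subseteq> cmap c ` cdom c"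
    and k: "continuous_on (cbox a b) k"
  defines "F \<equiv> \<lambda>p. if p \<in> cdom c \<and> cmap c p \<in> cbox a b then k (cmap c p) else (0::real)"
  shows "integrable dV F"
    and "integral\<^sup>L dV F = integral (cbox a b) (\<lambda>x. k x * sqrt (det (gmat c x)))"
proof -
  define W where "W = cmap c ` cdom c"
  define w where "w = (\<lambda>x. if x \<in> W then sqrt (det (gmat c x)) else 0)"
  define \<kappa> where "\<kappa> = (\<lambda>x. if x \<in> W then cinv c x else undefined)"
  have m: "w \<in> borel_measurable borel" "\<kappa> \<in> borel_measurable borel"
    "density dV (indicator (cdom c)) = distr (density lborel (\<lambda>x. ennreal (w x))) borel \<kappa>"
    unfolding w_def \<kappa>_def W_def by (fact chart_measure[OF dV c])+
  let ?K = "{p\<in>cdom c. cmap c p \<in> cbox a b}"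
  have sets: "sets dV = sets borel" using dV by (simp add: riemannian_measure_def)
  have "continuous_on ?K (\<lambda>p. k (cmap c p))"
    by (rule continuous_on_compose2[OF k continuous_on_subset[OF continuous_cmap[OF c]]]) auto
  then have "(\<lambda>p. if p \<in> ?K then k (cmap c p) else 0) \<in> borel_measurable borel"
    using compact_chart_box(2)[OF c ab] by (intro borel_measurable_continuous_on_if) auto
  then have Fm: "F \<in> borel_measurable borel" by (simp add: F_def)
  then have Fm': "F \<in> borel_measurable dV" using sets measurable_cong_sets by blast
  \<comment> \<open>Pulled back and weighted, F becomes the continuous integrand restricted to the
    box; as the box lies in the chart image, both sides are 0 outside that image.\<close>
  have wF: "w x *\<^sub>R F (\<kappa> x) = indicator (cbox a b) x *\<^sub>R (k x * sqrt (det (gmat c x)))" for x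
  proof (cases "x \<in> W")
    case True
    then show ?thesis
      using cinv_in[OF c] cmap_cinv[OF c] by (auto simp: w_def \<kappa>_def F_def W_def split: split_indicator)
  next
    case False
    then show ?thesis using ab by (auto simp: w_def W_def split: split_indicator)
  qed
  have w0: "0 \<le> w x" for x
    using spd_det_pos[OF spd_metric_matrix[OF c]] by (auto simp: w_def W_def less_imp_le)
  have "continuous_on (cmap c ` cdom c) (\<lambda>x. sqrt (det (gmat c x)))"
    by (intro smooth_on_imp_continuous_on smooth_on_sqrt[OF chart(2)[OF c]] smooth_on_det[OF chart(2)[OF c]]
        smooth_on_matrix_nth[OF chart(2)[OF c]] smooth_metric_matrix[OF c] spd_det_pos spd_metric_matrix[OF c])
  then have "continuous_on (cbox a b) (\<lambda>x. k x * sqrt (det (gmat c x)))"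
    by (intro continuous_on_mult k continuous_on_subset[OF _ ab])
  then have int: "integrable lborel (\<lambda>x. indicator (cbox a b) x *\<^sub>R (k x * sqrt (det (gmat c x))))"
    by (intro borel_integrable_compact) auto
  have iF: "indicator (cdom c) p *\<^sub>R F p = F p" for p by (simp add: F_def split: split_indicator)
  have ind: "(\<lambda>p. ennreal (indicator (cdom c) p)) = indicator (cdom c)"
    by (auto split: split_indicator)
  have indm: "(indicator (cdom c) :: 'a \<Rightarrow> real) \<in> borel_measurable dV"
    by (rule borel_measurable_indicator) (use chart(1)[OF c] sets in simp)
  have "integrable (density dV (indicator (cdom c))) F \<longleftrightarrow> integrable dV F"
    using integrable_density[OF Fm' indm] by (simp only: ind iF) simp
  moreover have "integrable (density dV (indicator (cdom c))) F \<longleftrightarrow>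
      integrable lborel (\<lambda>x. w x *\<^sub>R F (\<kappa> x))"
    unfolding m(3) using m(1,2) Fm w0
    by (simp add: integrable_distr_eq integrable_density measurable_compose[OF m(2) Fm])
  ultimately show "integrable dV F" using int by (simp only: wF)
  have "integral\<^sup>L dV F = integral\<^sup>L (density dV (indicator (cdom c))) F"
    using integral_density[OF Fm' indm] by (simp only: ind iF) simp
  also have "\<dots> = integral\<^sup>L lborel (\<lambda>x. w x *\<^sub>R F (\<kappa> x))"
    unfolding m(3) using m(1,2) Fm w0
    by (simp add: integral_distr integral_density measurable_compose[OF m(2) Fm])
  also have "\<dots> = (LINT x : cbox a b | lborel. k x * sqrt (det (gmat c x)))"
    by (simp only: wF set_lebesgue_integral_def)
  also have "\<dots> = integral (cbox a b) (\<lambda>x. k x * sqrt (det (gmat c x)))"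
    by (rule set_borel_integral_eq_integral) (simp only: set_integrable_def int)
  finally show "integral\<^sup>L dV F = integral (cbox a b) (\<lambda>x. k x * sqrt (det (gmat c x)))" .
qed

text \<open>Every point has a neighbourhood inside a closed box of some chart, where the volume
  density is bounded; compactness leaves finitely many of these neighbourhoods.\<close>

lemma finite_riemannian_measure:
  assumes dV: "riemannian_measure A g dV" and cpt: "compact (UNIV :: 'a set)"
  shows "emeasure dV UNIV < \<infinity>"
proof -
  have sets: "sets dV = sets borel" using dV by (simp add: riemannian_measure_def)
  have "\<exists>T. open T \<and> p \<in> T \<and> emeasure dV T < \<infinity>" for p
  proof -
    let ?c = "chart_at A p"
    note c = chart_at[of p]
    obtain a b where ab: "cbox a b \<subseteq> cmap ?c ` cdom ?c" "cmap ?c p \<in> box a b"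
      using open_contains_cbox[OF chart(2)[OF c(1)] imageI[OF c(2)]] by metis
    define K where "K = {p\<in>cdom ?c. cmap ?c p \<in> cbox a b}"
    \<comment> \<open>For the constant function 1, integrability over the box says that the box has
      finite measure.\<close>
    have "integrable dV (\<lambda>p. if p \<in> cdom ?c \<and> cmap ?c p \<in> cbox a b then 1 else (0::real))"
      by (rule chart_integral(1)[OF dV c(1) ab(1), of "\<lambda>_. 1"]) simp
    also have "(\<lambda>p. if p \<in> cdom ?c \<and> cmap ?c p \<in> cbox a b then 1 else (0::real)) = indicator K"
      by (auto simp: K_def split: split_indicator)
    finally have "emeasure dV (K \<inter> space dV) < \<infinity>" by (simp only: integrable_indicator_iff)
    moreover have "space dV = UNIV" using sets_eq_imp_space_eq[OF sets] by simp
    ultimately have K: "emeasure dV K < \<infinity>" by simp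
    define T where "T = cinv ?c ` box a b"
    have boxsub: "box a b \<subseteq> cmap ?c ` cdom ?c" using ab(1) box_subset_cbox by blast
    have "open T" unfolding T_def by (rule open_cinv_image[OF c(1) open_box boxsub])
    moreover have "p \<in> T" using ab(2) cinv_cmap[OF c] by (auto simp: T_def image_iff intro!: bexI[of _ "cmap ?c p"])
    moreover have "T \<subseteq> K"
      using boxsub cinv_in[OF c(1)] cmap_cinv[OF c(1)] box_subset_cbox[of a b] by (auto simp: T_def K_def subset_iff)
    moreover have "K \<in> sets dV"
      using compact_chart_box(2)[OF c(1) ab(1)] sets by (simp add: K_def)
    ultimately show ?thesis using emeasure_mono[of T K dV] K le_less_trans by blast
  qed
  then obtain T where T: "\<And>p. open (T p)" "\<And>p. p \<in> T p" "\<And>p. emeasure dV (T p) < \<infinity>" by metis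
  obtain D where D: "finite D" "UNIV \<subseteq> (\<Union>p\<in>D. T p)"
    using compactE_image[OF cpt, of UNIV T] T by (metis UNIV_I UN_iff subsetI)
  have "emeasure dV UNIV = emeasure dV (\<Union>p\<in>D. T p)" using D(2) by (simp add: top.extremum_unique)
  also have "\<dots> \<le> (\<Sum>p\<in>D. emeasure dV (T p))"
    by (rule emeasure_subadditive_finite) (use D T sets in auto)
  also have "\<dots> < \<infinity>" using D T by (simp add: ennreal_sum_less_top less_top[symmetric])
  finally show ?thesis .
qed

lemma integrable_continuous_compact:
  assumes dV: "riemannian_measure A g dV" and cpt: "compact (UNIV :: 'a set)"
    and f: "continuous_on UNIV f"
  shows "integrable dV (f :: 'a \<Rightarrow> real)"
proof -
  have sets: "sets dV = sets borel" using dV by (simp add: riemannian_measure_def)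
  then have space: "space dV = UNIV" using sets_eq_imp_space_eq[OF sets] by simp
  interpret finite_measure dV
    using finite_riemannian_measure[OF dV cpt] by (intro finite_measureI) (simp add: space)
  have "bounded (f ` UNIV)" by (intro compact_imp_bounded compact_continuous_image f cpt)
  then obtain C where "\<And>p. norm (f p) \<le> C" unfolding bounded_iff by auto
  moreover have "f \<in> borel_measurable dV"
    using borel_measurable_continuous_onI[OF f] measurable_cong_sets[OF sets refl] by blast
  ultimately show ?thesis by (intro integrable_const_bound[of _ C]) auto
qed

end

section \<open>Variations supported in a chart\<close>

context conformal_chart
begin

lemma continuous_energy_vary:
  assumes \<phi>: "smooth_on UNIV \<phi>" and V': "\<And>x. x \<in> U \<Longrightarrow> vary w \<phi> t x \<in> V"
  shows "continuous_on U (\<lambda>x. (1 + energy_form (G x) (H (vary w \<phi> t x)) (fd (vary w \<phi> t) x)) powr \<alpha>)"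
proof (cases "U = {}")
  case False
  then have sm: "smooth_on U (vary w \<phi> t)" using fd_vary(2)[OF \<phi>] by blast
  have "0 < 1 + energy_form (G x) (H (vary w \<phi> t x)) (fd (vary w \<phi> t) x)" if "x \<in> U" for x
    using energy_form_nonneg[OF spdG[OF that] spdH[OF V'[OF that]] smooth_on_linear[OF sm that]] by simp
  moreover have "smooth_on U (\<lambda>x. H (vary w \<phi> t x))"
    by (rule smooth_on_compose[OF U _ H sm]) (use V' in auto)
  ultimately show ?thesis
    by (intro smooth_on_imp_continuous_on[OF smooth_on_powr_compose[OF U]] smooth_on_add[OF U]
        smooth_on_const smooth_on_energy_form[OF U G spdG] smooth_on_frechet_derivative[OF sm])
qed simp

end

section \<open>The conformal map in a pair of charts\<close>

locale conformal_map = two_manifolds A g B h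
  for A :: "('a::{t2_space, second_countable_topology}, 'm::finite) chart set" and g
    and B :: "('b::{t2_space, second_countable_topology}, 'n::finite) chart set" and h +
  fixes \<psi> :: "'a \<Rightarrow> 'b" and \<mu> :: "'a \<Rightarrow> real"
  assumes hc: "horizontally_conformal A g B h \<psi> \<mu>"
begin

lemma smooth_psi: "smooth_map A B \<psi>"
  and smooth_mu: "smooth_function A \<mu>"
  and mu_pos: "0 < \<mu> p"
  and surj: "tangent_map A B \<psi> p ` horizontal_space A g B \<psi> p = UNIV"
  using hc unfolding horizontally_conformal_def by blast+

lemma dilation: "X \<in> horizontal_space A g B \<psi> p \<Longrightarrow> Y \<in> horizontal_space A g B \<psi> p \<Longrightarrow>
    h (\<psi> p) (tangent_map A B \<psi> p X) (tangent_map A B \<psi> p Y) = (\<mu> p)\<^sup>2 * g p X Y"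
  using hc unfolding horizontally_conformal_def by blast

lemma continuous_psi: "continuous_on UNIV \<psi>"
  using smooth_psi by (simp add: smooth_map_def)

lemma smooth_mu2: "smooth_function A (\<lambda>p. (\<mu> p)\<^sup>2)"
  unfolding smooth_function_def
proof
  fix c assume c: "c \<in> A"
  then have "smooth_on (cmap c ` cdom c) (\<mu> \<circ> cinv c)" using smooth_mu by (simp add: smooth_function_def)
  from smooth_on_mult[OF M.chart(2)[OF c] this this]
  show "smooth_on (cmap c ` cdom c) ((\<lambda>p. (\<mu> p)\<^sup>2) \<circ> cinv c)"
    by (simp add: power2_eq_square o_def)
qed

text \<open>The part of the chart c that \<psi> sends into d; \<open>uc\<close> and
  \<open>liftc\<close> are meaningful only over it.\<close>

definition src :: "('a, 'm) chart \<Rightarrow> ('b, 'n) chart \<Rightarrow> 'a set" where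
  "src c d = cdom c \<inter> \<psi> -` cdom d"

definition uc :: "('a, 'm) chart \<Rightarrow> ('b, 'n) chart \<Rightarrow> real ^ 'm \<Rightarrow> real ^ 'n" where
  "uc c d = cmap d \<circ> \<psi> \<circ> cinv c"

definition liftc :: "('a, 'm) chart \<Rightarrow> ('b, 'n) chart \<Rightarrow> real ^ 'n \<Rightarrow> real ^ 'm \<Rightarrow> real ^ 'm" where
  "liftc c d w x = matrix_inv (M.gmat c x) *v
    (\<chi> k. mform (N.gmat d (uc c d x)) w (fd (uc c d) x (axis k 1)))"

definition Mc :: "('a, 'm) chart \<Rightarrow> real ^ 'm \<Rightarrow> real" where
  "Mc c = (\<lambda>p. (\<mu> p)\<^sup>2) \<circ> cinv c"

lemma open_src: "c \<in> A \<Longrightarrow> d \<in> B \<Longrightarrow> open (src c d)"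
  unfolding src_def
  using continuous_open_preimage[OF continuous_psi open_UNIV N.chart(1)] M.chart(1) by (simp add: open_Int)

lemma uc_smooth: "c \<in> A \<Longrightarrow> d \<in> B \<Longrightarrow> smooth_on (cmap c ` src c d) (uc c d)"
  using smooth_psi by (simp add: smooth_map_def src_def uc_def)

lemma tangent_map_src:
  assumes "c \<in> A" "d \<in> B" "p \<in> src c d"
  shows "N.comps d (\<psi> p) (tangent_map A B \<psi> p v) = fd (uc c d) (cmap c p) (M.comps c p v)"
    and "linear (tangent_map A B \<psi> p)"
  using tangent_map_chart[OF assms(1,2) open_src[OF assms(1,2)] assms(3), of \<psi>, folded uc_def]
    smooth_on_imp_differentiable[OF uc_smooth[OF assms(1,2)], of "cmap c p"] assms(3)
  by (auto simp: src_def)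

text \<open>The point is to pass from conformality on horizontal vectors to du (du* w) = M w. The
  vector du* w is horizontal, being orthogonal to the kernel, so the dilation identity applies to
  it.\<close>

lemma conformal_chart_uc:
  assumes c: "c \<in> A" and d: "d \<in> B"
  shows "conformal_chart (cmap c ` src c d) (cmap d ` cdom d) (M.gmat c) (N.gmat d) (uc c d) (Mc c) (liftc c d)"
proof -
  let ?U = "cmap c ` src c d" and ?V = "cmap d ` cdom d"
  have sub: "?U \<subseteq> cmap c ` cdom c" by (auto simp: src_def)
  have U: "open ?U" by (rule M.open_cmap_image[OF c open_src[OF c d]]) (auto simp: src_def)
  have uV: "uc c d ` ?U \<subseteq> ?V" using M.cinv_cmap[OF c] by (auto simp: uc_def src_def)
  have G: "smooth_on ?U (M.gmat c)" by (rule smooth_on_subset[OF M.smooth_metric_matrix[OF c] sub])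
  have Ms: "smooth_on ?U (Mc c)"
    unfolding Mc_def by (rule smooth_on_subset[OF _ sub]) (use smooth_mu2 c in \<open>simp add: smooth_function_def\<close>)
  have spdG: "spd (M.gmat c x)" if "x \<in> ?U" for x
    by (rule M.spd_metric_matrix[OF c]) (use that sub in auto)
  have conf: "fd (uc c d) x (liftc c d w x) = Mc c x *\<^sub>R w" if x: "x \<in> ?U" for w x
  proof -
    obtain p where p: "p \<in> src c d" "x = cmap c p" using x by blast
    have pc: "p \<in> cdom c" and pd: "\<psi> p \<in> cdom d" using p by (auto simp: src_def)
    note tm = tangent_map_src[OF c d p(1)]
    have ux: "uc c d x = cmap d (\<psi> p)" by (simp add: uc_def p(2) M.cinv_cmap[OF c pc])
    have lin: "linear (fd (uc c d) x)" by (rule smooth_on_linear[OF uc_smooth[OF c d] x])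
    let ?\<xi> = "M.vect c p (liftc c d w x)"
    have lift: "g p ?\<xi> v = h (\<psi> p) (N.vect d (\<psi> p) w) (tangent_map A B \<psi> p v)" for v
    proof -
      let ?v = "M.comps c p v"
      have "g p ?\<xi> v = mform (M.gmat c x) ?v (liftc c d w x)"
        unfolding M.metric_comps[OF c pc] M.comps_vect[OF c pc] p(2)
        by (rule spd_sym[OF spdG[OF x, unfolded p(2)]])
      also have "\<dots> = (\<Sum>k\<in>UNIV. ?v $ k * mform (N.gmat d (uc c d x)) w (fd (uc c d) x (axis k 1)))"
        by (simp add: mform_def[of "M.gmat c x"] liftc_def spd_invertible(4)[OF spdG[OF x]] inner_vec_def)
      also have "\<dots> = mform (N.gmat d (uc c d x)) w (fd (uc c d) x ?v)"
        by (subst linear_expand[OF lin, of ?v]) (simp add: mform_sum mform_simps)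
      also have "\<dots> = h (\<psi> p) (N.vect d (\<psi> p) w) (tangent_map A B \<psi> p v)"
        unfolding N.metric_comps[OF d pd] N.comps_vect[OF d pd] tm(1) p(2) ux[unfolded p(2)] ..
      finally show ?thesis .
    qed
    have hor: "?\<xi> \<in> horizontal_space A g B \<psi> p"
      unfolding horizontal_space_def vertical_space_def
      by (auto simp: lift bilinear_rzero[OF N.bilinear_metric])
    \<comment> \<open>Both sides have the same product with d\<psi>(Y) for each horizontal Y. By
      surjectivity their difference is itself such a d\<psi>(Y), hence it is orthogonal to
      itself.\<close>
    have "tangent_map A B \<psi> p ?\<xi> = (\<mu> p)\<^sup>2 *\<^sub>R N.vect d (\<psi> p) w" (is "?a = ?b")
    proof (rule ccontr)
      assume "?a \<noteq> ?b"
      then have pos: "0 < h (\<psi> p) (?a - ?b) (?a - ?b)" by (intro N.metric_pos) simp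
      have "?a - ?b \<in> tangent_map A B \<psi> p ` horizontal_space A g B \<psi> p" unfolding surj by simp
      then obtain Y where Y: "Y \<in> horizontal_space A g B \<psi> p" "?a - ?b = tangent_map A B \<psi> p Y"
        by (rule imageE)
      have 1: "h (\<psi> p) (?a - ?b) (?a - ?b) = h (\<psi> p) ?a (?a - ?b) - h (\<psi> p) ?b (?a - ?b)"
        by (rule bilinear_lsub[OF N.bilinear_metric])
      have 2: "h (\<psi> p) ?a (?a - ?b) = (\<mu> p)\<^sup>2 * g p ?\<xi> Y" unfolding Y(2) by (rule dilation[OF hor Y(1)])
      have 3: "h (\<psi> p) ?b (?a - ?b) = (\<mu> p)\<^sup>2 * g p ?\<xi> Y"
        unfolding Y(2) bilinear_lmul[OF N.bilinear_metric] lift by simp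
      show False using pos unfolding 1 2 3 by simp
    qed
    then have "N.comps d (\<psi> p) (tangent_map A B \<psi> p ?\<xi>) = N.comps d (\<psi> p) ((\<mu> p)\<^sup>2 *\<^sub>R N.vect d (\<psi> p) w)"
      by simp
    also have "\<dots> = (\<mu> p)\<^sup>2 *\<^sub>R w"
      unfolding linear_cmul[OF N.linear_comps[OF d pd]] N.comps_vect[OF d pd] ..
    finally show ?thesis
      unfolding tm(1) M.comps_vect[OF c pc] by (simp add: Mc_def p(2) M.cinv_cmap[OF c pc])
  qed
  show ?thesis
  proof
    show "0 < Mc c x" for x by (simp add: Mc_def less_imp_neq[OF mu_pos, symmetric])
  qed (use U N.chart(2)[OF d] uV uc_smooth[OF c d] G N.smooth_metric_matrix[OF d] Ms spdG
      N.spd_metric_matrix[OF d] conf in \<open>auto simp: liftc_def\<close>)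
qed

lemma hs_norm_psi: "(hs_norm A g B h \<psi> p)\<^sup>2 = real CARD('n) * (\<mu> p)\<^sup>2"
proof -
  let ?c = "chart_at A p" and ?d = "chart_at B (\<psi> p)"
  note c = M.chart_at[of p] and d = N.chart_at[of "\<psi> p"]
  have p: "p \<in> src ?c ?d" using c d by (simp add: src_def)
  interpret conformal_chart "cmap ?c ` src ?c ?d" "cmap ?d ` cdom ?d" "M.gmat ?c" "N.gmat ?d" "uc ?c ?d"
    "Mc ?c" "liftc ?c ?d"
    by (rule conformal_chart_uc[OF c(1) d(1)])
  have x: "cmap ?c p \<in> cmap ?c ` src ?c ?d" using p by simp
  have "(hs_norm A g B h \<psi> p)\<^sup>2 =
    energy_form (M.gmat ?c (cmap ?c p)) (N.gmat ?d (cmap ?d (\<psi> p))) (fd (uc ?c ?d) (cmap ?c p))"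
    unfolding uc_def
    by (rule hs_norm_chart[OF c(1) d(1) open_src[OF c(1) d(1)] p])
      (use smooth_on_imp_differentiable[OF u x] in \<open>auto simp: src_def uc_def\<close>)
  also have "cmap ?d (\<psi> p) = uc ?c ?d (cmap ?c p)" by (simp add: uc_def M.cinv_cmap[OF c])
  finally show ?thesis by (simp add: energy_density[OF x] Mc_def M.cinv_cmap[OF c])
qed

lemma continuous_mu: "continuous_on UNIV \<mu>"
proof -
  have "isCont \<mu> p" for p
  proof -
    let ?c = "chart_at A p"
    note c = M.chart_at[of p]
    have "continuous_on (cmap ?c ` cdom ?c) (\<mu> \<circ> cinv ?c)"
      by (rule smooth_on_imp_continuous_on) (use smooth_mu c in \<open>simp add: smooth_function_def\<close>)
    from continuous_on_compose2[OF this M.continuous_cmap[OF c(1)] subset_refl]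
    have "continuous_on (cdom ?c) (\<lambda>q. (\<mu> \<circ> cinv ?c) (cmap ?c q))" .
    then have "continuous_on (cdom ?c) \<mu>"
      by (rule continuous_on_eq) (simp add: M.cinv_cmap[OF c(1)])
    then show ?thesis using M.chart(1)[OF c(1)] c(2) continuous_on_eq_continuous_at by blast
  qed
  then show ?thesis by (simp add: continuous_at_imp_continuous_on)
qed

section \<open>From perturbations in a chart to global variations\<close>

text \<open>A perturbation in the charts, continued by \<psi>, is a smooth variation of the global
  map. Its energy differs from the chart integral by a constant, so criticality passes to the chart
  integral.\<close>

lemma weak_equation:
  assumes dV: "riemannian_measure A g dV" and cpt: "compact (UNIV :: 'a set)"
    and ah: "alpha_harmonic A g dV B h \<alpha> \<psi>" and c: "c \<in> A" and d: "d \<in> B"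
    and ab: "cbox a b \<subseteq> cmap c ` src c d" and \<phi>: "smooth_on UNIV \<phi>"
    and supp: "\<And>x. x \<notin> cbox a b \<Longrightarrow> \<phi> x = 0"
  shows "((\<lambda>t. integral (cbox a b)
    (conformal_chart.vary_density (M.gmat c) (N.gmat d) (uc c d) \<alpha> w \<phi> t)) has_real_derivative 0) (at 0)"
proof -
  let ?O = "src c d" and ?U = "cmap c ` src c d" and ?V = "cmap d ` cdom d"
  interpret conformal_chart ?U ?V "M.gmat c" "N.gmat d" "uc c d" "Mc c" "liftc c d"
    by (rule conformal_chart_uc[OF c d])
  obtain \<epsilon> where \<epsilon>: "\<epsilon> > 0" "\<And>t x. t \<in> {-\<epsilon><..<\<epsilon>} \<Longrightarrow> x \<in> ?U \<Longrightarrow> vary w \<phi> t x \<in> ?V"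
    using vary_in_V[OF \<phi> ab supp, of w] by blast
  define I where "I = {-\<epsilon><..<\<epsilon>}"
  have I: "open I" "0 \<in> I" using \<epsilon>(1) by (auto simp: I_def)
  have vV: "vary w \<phi> t x \<in> ?V" if "t \<in> I" "x \<in> ?U" for t x using \<epsilon>(2) that by (simp add: I_def)
  \<comment> \<open>The chart formula is used on all of \<open>src c d\<close> and not only on the
    closed box \<open>K\<close>; the two definitions then overlap on an open set.\<close>
  define \<Psi> where "\<Psi> t p = (if p \<in> ?O then cinv d (vary w \<phi> t (cmap c p)) else \<psi> p)" for t p
  define K where "K = {p\<in>cdom c. cmap c p \<in> cbox a b}"
  have Oc: "?O \<subseteq> cdom c" by (auto simp: src_def)
  have Od: "\<psi> p \<in> cdom d" if "p \<in> ?O" for p using that by (simp add: src_def)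
  have O: "open ?O" by (rule open_src[OF c d])
  have UC: "?U \<subseteq> cmap c ` cdom c" using Oc by blast
  have abC: "cbox a b \<subseteq> cmap c ` cdom c" using ab UC by blast
  have K: "closed K" unfolding K_def by (rule M.compact_chart_box(2)[OF c abC])
  have KO: "K \<subseteq> ?O"
  proof
    fix p assume p: "p \<in> K"
    then obtain q where "q \<in> ?O" "cmap c p = cmap c q" using ab by (auto simp: K_def)
    then show "p \<in> ?O" using p Oc M.cinv_cmap[OF c] unfolding K_def by (metis (no_types, lifting) mem_Collect_eq subsetD)
  qed
  have \<Psi>O: "cmap d (\<Psi> t p) = vary w \<phi> t (cmap c p)" "\<Psi> t p \<in> cdom d" if "t \<in> I" "p \<in> ?O" for t p
    using N.cmap_cinv[OF d vV[OF that(1)]] N.cinv_in[OF d vV[OF that(1)]] that(2) by (auto simp: \<Psi>_def)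
  have u_cmap: "uc c d (cmap c p) = cmap d (\<psi> p)" if "p \<in> ?O" for p
    using that Oc by (auto simp: uc_def M.cinv_cmap[OF c])
  have \<Psi>K: "\<Psi> t p = \<psi> p" if "p \<notin> K" for t p
  proof (cases "p \<in> ?O")
    case True
    then have "cmap c p \<notin> cbox a b" using that Oc by (auto simp: K_def)
    then have "vary w \<phi> t (cmap c p) = cmap d (\<psi> p)" using supp u_cmap[OF True] by (simp add: vary_def)
    then show ?thesis using True N.cinv_cmap[OF d Od[OF True]] by (simp add: \<Psi>_def)
  qed (simp add: \<Psi>_def)
  have \<Psi>0: "\<Psi> 0 = \<psi>"
    using N.cinv_cmap[OF d Od] u_cmap by (auto simp: \<Psi>_def vary_0 fun_eq_iff)
  have cont: "continuous_on (I \<times> UNIV) (\<lambda>(t, p). \<Psi> t p)"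
  proof -
    have "continuous_on (I \<times> ?O) (\<lambda>z. cinv d (vary w \<phi> (fst z) (cmap c (snd z))))"
    proof (rule continuous_on_compose2[OF N.continuous_cinv[OF d]])
      show "continuous_on (I \<times> ?O) (\<lambda>z. vary w \<phi> (fst z) (cmap c (snd z)))"
      proof -
        have "continuous_on (I \<times> ?O) (\<lambda>z. cmap c (snd z))"
          by (rule continuous_on_compose2[OF M.continuous_cmap[OF c] continuous_on_snd[OF continuous_on_id]])
            (use Oc in auto)
        then have "continuous_on (I \<times> ?O) (\<lambda>z. (fst z, cmap c (snd z)))"
          by (intro continuous_on_Pair continuous_on_fst continuous_on_id)
        moreover have "(\<lambda>z. (fst z, cmap c (snd z))) ` (I \<times> ?O) \<subseteq> UNIV \<times> ?U" by auto
        ultimately show ?thesis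
          using continuous_on_compose2[OF smooth_on_imp_continuous_on[OF smooth_vary[OF \<phi>]], of "I \<times> ?O" _ w]
          by fastforce
      qed
      show "(\<lambda>z. vary w \<phi> (fst z) (cmap c (snd z))) ` (I \<times> ?O) \<subseteq> ?V" using vV by auto
    qed
    then have 1: "continuous_on (I \<times> ?O) (\<lambda>(t, p). \<Psi> t p)"
      by (rule continuous_on_eq) (auto simp: \<Psi>_def)
    have "continuous_on (I \<times> - K) (\<lambda>z. \<psi> (snd z))"
      by (rule continuous_on_compose2[OF continuous_psi]) (auto intro!: continuous_intros)
    then have 2: "continuous_on (I \<times> - K) (\<lambda>(t, p). \<Psi> t p)"
      by (rule continuous_on_eq) (auto simp: \<Psi>K)
    \<comment> \<open>Since \<open>K\<close> lies inside the open set \<open>?O\<close>, the chart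
      formula and the unchanged map describe the variation on two open sets that cover
      everything.\<close>
    have "I \<times> UNIV = I \<times> ?O \<union> I \<times> - K" using KO by auto
    then show ?thesis
      using continuous_on_open_Un[OF open_Times[OF I(1) O] open_Times[OF I(1) open_Compl[OF K]] 1 2] by simp
  qed
  have smooth: "smooth_on {(t, x). t \<in> I \<and> x \<in> cmap c' ` cdom c' \<and> \<Psi> t (cinv c' x) \<in> cdom d'}
      (\<lambda>(t, x). cmap d' (\<Psi> t (cinv c' x)))" (is "smooth_on ?S ?f") if c': "c' \<in> A" and d': "d' \<in> B" for c' d'
  proof (rule smooth_on_local)
    fix z assume "z \<in> ?S"
    then obtain t0 x0 where z: "z = (t0, x0)" "t0 \<in> I" "x0 \<in> cmap c' ` cdom c'" "\<Psi> t0 (cinv c' x0) \<in> cdom d'"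
      by auto
    let ?q = "cinv c' x0"
    have q: "?q \<in> cdom c'" by (rule M.cinv_in[OF c' z(3)])
    have xq: "x0 = cmap c' ?q" by (simp add: M.cmap_cinv[OF c' z(3)])
    show "\<exists>T. open T \<and> z \<in> T \<and> smooth_on T ?f"
    proof (cases "?q \<in> ?O")
      case True
      \<comment> \<open>Over \<open>?O\<close> the variation, read in arbitrary charts c' and d', is
        the chart formula composed with one transition on each side.\<close>
      let ?Y = "cmap c' ` (cdom c' \<inter> ?O)"
      have Y: "open ?Y"
        by (rule M.open_cmap_image[OF c']) (use M.chart(1)[OF c'] O in \<open>auto simp: open_Int\<close>)
      have IY: "open (I \<times> ?Y)" by (rule open_Times[OF I(1) Y])
      define Q where "Q z = vary w \<phi> (fst z) ((cmap c \<circ> cinv c') (snd z))" for z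
      have tr: "smooth_on ?Y (cmap c \<circ> cinv c')"
        by (rule smooth_on_subset[OF M.transition(2)[OF c' c]]) (use Oc in auto)
      have trU: "(cmap c \<circ> cinv c') ` ?Y \<subseteq> ?U" using M.cinv_cmap[OF c'] by auto
      have "smooth_on (I \<times> ?Y) (\<lambda>z. (fst z, (cmap c \<circ> cinv c') (snd z)))"
      proof -
        have 1: "smooth_on (I \<times> ?Y) (\<lambda>z. (cmap c \<circ> cinv c') (snd z))"
          by (rule smooth_on_compose[OF IY _ tr]) (auto intro!: smooth_on_bounded_linear bounded_linear_snd)
        have "smooth_on (I \<times> ?Y) (\<lambda>z. (fst z, 0) + (0, (cmap c \<circ> cinv c') (snd z)))"
          by (intro smooth_on_add[OF IY] smooth_on_linear_comp[OF _ IY 1, of "\<lambda>y. (0, y)"]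
              smooth_on_bounded_linear bounded_linear_Pair bounded_linear_fst bounded_linear_zero bounded_linear_ident)
        then show ?thesis by simp
      qed
      moreover have "(\<lambda>z. (fst z, (cmap c \<circ> cinv c') (snd z))) ` (I \<times> ?Y) \<subseteq> UNIV \<times> ?U"
        using trU by auto
      ultimately have "smooth_on (I \<times> ?Y) (\<lambda>z. vary w \<phi> (fst (fst z, (cmap c \<circ> cinv c') (snd z)))
          (snd (fst z, (cmap c \<circ> cinv c') (snd z))))"
        by (rule smooth_on_compose[OF IY _ smooth_vary[OF \<phi>], rotated])
      then have Qs: "smooth_on (I \<times> ?Y) Q" unfolding Q_def[abs_def] fst_conv snd_conv .
      let ?Z = "cmap d ` (cdom d \<inter> cdom d')"
      \<comment> \<open>Only where the perturbed point lies in both target charts is the transition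
        from d to d' available.\<close>
      define T where "T = (I \<times> ?Y) \<inter> Q -` ?Z"
      have T: "open T"
        unfolding T_def
        by (rule continuous_open_preimage[OF smooth_on_imp_continuous_on[OF Qs] IY N.transition(1)[OF d d']])
      have Q\<Psi>: "Q (t, x) = vary w \<phi> t (cmap c (cinv c' x))" for t x by (simp add: Q_def)
      have "z \<in> T"
      proof -
        have "Q z = cmap d (\<Psi> t0 ?q)" by (simp add: z(1) Q\<Psi> \<Psi>O[OF z(2) True])
        moreover have "\<Psi> t0 ?q \<in> cdom d \<inter> cdom d'" using \<Psi>O[OF z(2) True] z(4) by simp
        moreover have "x0 \<in> ?Y" using xq q True by auto
        ultimately show ?thesis using z by (simp add: T_def)
      qed
      moreover have "smooth_on T (\<lambda>z. (cmap d' \<circ> cinv d) (Q z))"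
        by (rule smooth_on_compose[OF T _ N.transition(2)[OF d d'] smooth_on_subset[OF Qs]]) (auto simp: T_def)
      then have "smooth_on T ?f"
      proof (rule smooth_on_cong[OF _ T])
        fix y assume "y \<in> T"
        then obtain t x where y: "y = (t, x)" "t \<in> I" "x \<in> ?Y" by (auto simp: T_def)
        then have "cinv c' x \<in> ?O" using M.cinv_cmap[OF c'] by auto
        then show "(cmap d' \<circ> cinv d) (Q y) = ?f y" by (simp add: y(1) Q\<Psi> \<Psi>_def)
      qed
      ultimately show ?thesis using T by blast
    next
      case False
      then have qK: "?q \<notin> K" using KO by blast
      let ?Y = "cmap c' ` (cdom c' \<inter> \<psi> -` cdom d' \<inter> - K)"
      have "open (cdom c' \<inter> \<psi> -` cdom d')" using open_src[OF c' d'] by (simp add: src_def)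
      then have Y: "open ?Y"
        by (intro M.open_cmap_image[OF c'] open_Int[OF _ open_Compl[OF K]]) auto
      have IY: "open (I \<times> ?Y)" by (rule open_Times[OF I(1) Y])
      have Ys: "smooth_on ?Y (cmap d' \<circ> \<psi> \<circ> cinv c')"
        by (rule smooth_on_subset[of "cmap c' ` (cdom c' \<inter> \<psi> -` cdom d')"])
          (use smooth_psi c' d' in \<open>auto simp: smooth_map_def\<close>)
      have "smooth_on (I \<times> ?Y) (\<lambda>z. (cmap d' \<circ> \<psi> \<circ> cinv c') (snd z))"
        by (rule smooth_on_compose[OF IY _ Ys smooth_on_bounded_linear[OF bounded_linear_snd]]) auto
      then have "smooth_on (I \<times> ?Y) ?f"
      proof (rule smooth_on_cong[OF _ IY])
        fix y assume "y \<in> I \<times> ?Y"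
        then obtain t x where y: "y = (t, x)" "x \<in> ?Y" by auto
        then have "cinv c' x \<notin> K" using M.cinv_cmap[OF c'] by auto
        then show "(cmap d' \<circ> \<psi> \<circ> cinv c') (snd y) = ?f y" by (simp add: y(1) \<Psi>K)
      qed
      moreover have "z \<in> I \<times> ?Y"
        using z q qK xq \<Psi>K[OF qK] by (auto simp: image_iff intro!: bexI[of _ ?q])
      ultimately show ?thesis using IY by blast
    qed
  qed
  have var: "smooth_variation A B \<psi> \<epsilon> \<Psi>"
    unfolding smooth_variation_def using \<epsilon>(1) \<Psi>0 cont smooth by (auto simp: I_def)
  \<comment> \<open>\<open>e\<close> is the density of the perturbed map read in the chart,
    \<open>f\<close> the same density on the manifold.\<close>
  define e where "e t x = (1 + energy_form (M.gmat c x) (N.gmat d (vary w \<phi> t x)) (fd (vary w \<phi> t) x)) powr \<alpha>" for t x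
  define f where "f t p = (1 + (hs_norm A g B h (\<Psi> t) p)\<^sup>2) powr \<alpha>" for t p
  have fO: "f t p = e t (cmap c p)" if t: "t \<in> I" and p: "p \<in> ?O" for t p
  proof -
    have x: "cmap c p \<in> ?U" using p by simp
    have "vary w \<phi> t differentiable (at (cmap c p))"
      by (rule smooth_on_imp_differentiable[OF fd_vary(2)[OF \<phi> x] x])
    note * = differentiable_cong_open[OF this U x, of "cmap d \<circ> \<Psi> t \<circ> cinv c"]
    have eq: "vary w \<phi> t y = (cmap d \<circ> \<Psi> t \<circ> cinv c) y" if y: "y \<in> ?U" for y
    proof -
      obtain q where q: "q \<in> ?O" "y = cmap c q" using y by blast
      then have "q \<in> cdom c" using Oc by blast
      then show ?thesis using \<Psi>O(1)[OF t q(1)] by (simp add: q(2) M.cinv_cmap[OF c])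
    qed
    have "(hs_norm A g B h (\<Psi> t) p)\<^sup>2 = energy_form (M.gmat c (cmap c p)) (N.gmat d (cmap d (\<Psi> t p)))
        (fd (cmap d \<circ> \<Psi> t \<circ> cinv c) (cmap c p))"
      by (rule hs_norm_chart[OF c d O p Oc _ *(1)[OF eq]]) (use \<Psi>O(2)[OF t] in auto)
    then show ?thesis by (simp add: f_def e_def *(2)[OF eq] \<Psi>O(1)[OF t p])
  qed
  \<comment> \<open>All maps of the variation agree with \<psi> on the complement of
    \<open>K\<close>, which is open, so their differentials agree there too.\<close>
  have fK: "f t p = f 0 p" if p: "p \<notin> K" for t p
  proof -
    let ?c = "chart_at A p" and ?d = "chart_at B (\<psi> p)"
    note pc = M.chart_at[of p] and pd = N.chart_at[of "\<psi> p"]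
    have "cmap ?c p \<in> cmap ?c ` src ?c ?d" using pc pd by (auto simp: src_def)
    from smooth_on_imp_differentiable[OF uc_smooth[OF pc(1) pd(1)] this]
    have diff: "(cmap ?d \<circ> \<psi> \<circ> cinv ?c) differentiable (at (cmap ?c p))" by (simp add: uc_def)
    have W: "open (cmap ?c ` (cdom ?c \<inter> - K))"
      by (rule M.open_cmap_image[OF pc(1)]) (use M.chart(1)[OF pc(1)] K in \<open>auto simp: open_Int open_Compl\<close>)
    have "tangent_map A B (\<Psi> t) p = tangent_map A B \<psi> p"
      unfolding tangent_map_def \<Psi>K[OF p]
    proof (rule differentiable_cong_open(2)[OF diff W])
      show "cmap ?c p \<in> cmap ?c ` (cdom ?c \<inter> - K)" using pc p by auto
      show "(cmap ?d \<circ> \<psi> \<circ> cinv ?c) y = (cmap ?d \<circ> \<Psi> t \<circ> cinv ?c) y" if "y \<in> cmap ?c ` (cdom ?c \<inter> - K)" for y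
        using that M.cinv_cmap[OF pc(1)] by (auto simp: \<Psi>K)
    qed
    then show ?thesis by (simp add: f_def hs_norm_def \<Psi>0 \<Psi>K[OF p])
  qed
  have f0: "integrable dV (f 0)"
  proof (rule M.integrable_continuous_compact[OF dV cpt])
    have "1 + real CARD('n) * (\<mu> p)\<^sup>2 \<noteq> 0" for p
      by (metis add_pos_nonneg zero_less_one mult_nonneg_nonneg of_nat_0_le_iff zero_le_power2 less_irrefl)
    then show "continuous_on UNIV (f 0)"
      unfolding f_def \<Psi>0 hs_norm_psi
      by (intro continuous_on_powr continuous_intros continuous_mu) auto
  qed
  \<comment> \<open>Subtracting the unvaried density leaves a function supported in the chart box,
    whose integral is computed in the chart. The remaining terms do not involve t.\<close>
  have E: "alpha_energy A g dV B h \<alpha> (\<Psi> t) = integral\<^sup>L dV (f 0) - integral (cbox a b) (vary_density \<alpha> w \<phi> 0)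
      + integral (cbox a b) (vary_density \<alpha> w \<phi> t)" if t: "t \<in> I" for t
  proof -
    define k where "k x = e t x - e 0 x" for x
    define F where "F p = (if p \<in> cdom c \<and> cmap c p \<in> cbox a b then k (cmap c p) else 0)" for p
    have ec: "continuous_on (cbox a b) (e s)" if "s \<in> I" for s
      unfolding e_def
      by (rule continuous_on_subset[OF continuous_energy_vary[OF \<phi> vV[OF that]] ab])
    have k: "continuous_on (cbox a b) k"
      unfolding k_def by (intro continuous_intros ec t I)
    note F = M.chart_integral[OF dV c abC k, folded F_def[abs_def]]
    have fF: "f t p = f 0 p + F p" for p
    proof (cases "p \<in> K")
      case True
      then have "p \<in> ?O" using KO by blast
      then show ?thesis using True fO[OF t] fO[OF I(2)] by (simp add: F_def K_def k_def)
    next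
      case False
      then have "F p = 0" by (auto simp: F_def K_def)
      then show ?thesis using fK[OF False] by simp
    qed
    have "alpha_energy A g dV B h \<alpha> (\<Psi> t) = integral\<^sup>L dV (f t)" by (simp add: alpha_energy_def f_def[abs_def])
    also have "\<dots> = integral\<^sup>L dV (f 0) + integral\<^sup>L dV F"
      using Bochner_Integration.integral_add[OF f0 F(1)] by (simp add: fF[abs_def])
    also have "integral\<^sup>L dV F = integral (cbox a b) (\<lambda>x. k x * sqrt (det (M.gmat c x)))" by (rule F(2))
    also have "\<dots> = integral (cbox a b) (\<lambda>x. vary_density \<alpha> w \<phi> t x - vary_density \<alpha> w \<phi> 0 x)"
      by (simp add: k_def e_def vary_density_def algebra_simps)
    also have "\<dots> = integral (cbox a b) (vary_density \<alpha> w \<phi> t) - integral (cbox a b) (vary_density \<alpha> w \<phi> 0)"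
    proof (rule integral_diff)
      have S: "continuous_on (cbox a b) (\<lambda>x. sqrt (det (M.gmat c x)))"
        by (intro continuous_on_subset[OF _ ab] smooth_on_imp_continuous_on smooth_on_sqrt[OF U] smooth_on_det[OF U]
            smooth_on_matrix_nth[OF U G] spd_det_pos spdG)
      have "continuous_on (cbox a b) (vary_density \<alpha> w \<phi> s)" if "s \<in> I" for s
        using continuous_on_mult[OF ec[OF that] S] by (simp add: e_def vary_density_def[abs_def])
      then show "vary_density \<alpha> w \<phi> t integrable_on cbox a b" "vary_density \<alpha> w \<phi> 0 integrable_on cbox a b"
        using t I by (auto intro: integrable_continuous)
    qed
    finally show ?thesis by simp
  qed
  have "((\<lambda>t. alpha_energy A g dV B h \<alpha> (\<Psi> t)) has_real_derivative 0) (at 0)"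
    using ah var unfolding alpha_harmonic_def by blast
  then have "((\<lambda>t. integral\<^sup>L dV (f 0) - integral (cbox a b) (vary_density \<alpha> w \<phi> 0)
      + integral (cbox a b) (vary_density \<alpha> w \<phi> t)) has_real_derivative 0) (at 0)"
    by (rule has_field_derivative_transform_within_open[OF _ I]) (rule E)
  from DERIV_diff[OF this DERIV_const[of "integral\<^sup>L dV (f 0) - integral (cbox a b) (vary_density \<alpha> w \<phi> 0)"]]
  show ?thesis by simp
qed

end

section \<open>Adapted frames\<close>

context conformal_chart
begin

lemma lift_linear:
  assumes x: "x \<in> U"
  shows "lift w x = (\<Sum>a\<in>UNIV. w $ a *\<^sub>R lift (axis a 1) x)"
proof -
  have "linear (\<lambda>w. lift w x)"
  proof (rule linearI)
    have "(\<chi> k. mform (H (u x)) (v + w) (fd u x (axis k 1))) =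
        (\<chi> k. mform (H (u x)) v (fd u x (axis k 1))) + (\<chi> k. mform (H (u x)) w (fd u x (axis k 1)))" for v w
      by (simp add: vec_eq_iff mform_simps)
    then show "lift (v + w) x = lift v x + lift w x" for v w
      by (simp add: lift_def matrix_vector.add_right)
    have "(\<chi> k. mform (H (u x)) (r *\<^sub>R v) (fd u x (axis k 1))) =
        r *\<^sub>R (\<chi> k. mform (H (u x)) v (fd u x (axis k 1)))" for r v
      by (simp add: vec_eq_iff mform_simps)
    then show "lift (r *\<^sub>R v) x = r *\<^sub>R lift v x" for r v
      by (simp add: lift_def matrix_vector.scaleR_right)
  qed
  from linear_expand[OF this] show ?thesis .
qed

lemma smooth_lift_variable:
  assumes "smooth_on U w"
  shows "smooth_on U (\<lambda>x. lift (w x) x)"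
proof -
  have "smooth_on U (\<lambda>x. \<Sum>a\<in>UNIV. w x $ a *\<^sub>R lift (axis a 1) x)"
    by (intro smooth_on_sum[OF U] smooth_on_scaleR[OF U] smooth_on_vec_nth[OF U assms] smooth_lift)
  then show ?thesis
    by (rule smooth_on_cong[OF _ U]) (simp add: lift_linear[symmetric])
qed

text \<open>Lifts satisfy G(du* v, du* w) = M H(v, w), so lifting an orthonormal basis of the target
  and dividing by the square root of M gives orthonormal vectors. Vectors orthogonal to all these
  lifts are sent to 0 by du.\<close>

lemma adapted_basis:
  assumes x: "x \<in> U" and mn: "CARD('n) < CARD('m)"
  shows "\<exists>f e. orthonormal_on (G x) {1..CARD('m)} e \<and>
    (\<forall>i\<in>{1..CARD('n)}. e i = inverse (sqrt (M x)) *\<^sub>R lift (f i) x) \<and>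
    (\<forall>i\<in>{CARD('n)+1..CARD('m)}. fd u x (e i) = 0)"
proof -
  note sH = spdH[OF uV'[OF x]] and sG = spdG[OF x]
  have Mx: "0 < M x" by (rule Mpos[OF x])
  obtain f where f: "orthonormal_on (H (u x)) {1..CARD('n)} f"
    using orthonormal_exists(1)[OF sH] by blast
  define e0 where "e0 i = inverse (sqrt (M x)) *\<^sub>R lift (f i) x" for i :: nat
  have "orthonormal_on (G x) {1..CARD('n)} e0"
    unfolding orthonormal_on_def
  proof (intro ballI)
    fix i j assume ij: "i \<in> {1..CARD('n)}" "j \<in> {1..CARD('n)}"
    have "inverse (sqrt (M x)) * M x = sqrt (M x)"
      using real_div_sqrt[of "M x"] Mx by (simp add: divide_inverse mult.commute)
    then have r: "inverse (sqrt (M x)) * (inverse (sqrt (M x)) * M x) = 1"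
      using Mx by simp
    have "mform (G x) (e0 i) (e0 j) =
        inverse (sqrt (M x)) * (inverse (sqrt (M x)) * M x) * mform (H (u x)) (f i) (f j)"
      by (simp only: e0_def mform_simps mform_lift[OF x] conformal[OF x] mult.assoc)
    also have "\<dots> = mform (H (u x)) (f i) (f j)" unfolding r by simp
    also have "\<dots> = (if i = j then 1 else 0)" using f ij by (simp add: orthonormal_on_def)
    finally show "mform (G x) (e0 i) (e0 j) = (if i = j then 1 else 0)" .
  qed
  from orthonormal_complete[OF sG this] mn obtain e where e:
    "\<forall>i\<in>{1..CARD('n)}. e i = e0 i" "orthonormal_on (G x) {1..CARD('m)} e" by auto
  have "fd u x (e i) = 0" if i: "i \<in> {CARD('n)+1..CARD('m)}" for i
  proof -
    have "mform (H (u x)) (f j) (fd u x (e i)) = 0" if j: "j \<in> {1..CARD('n)}" for j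
    proof -
      have "mform (G x) (e j) (e i) = 0"
        using e(2) i j mn by (simp add: orthonormal_on_def)
      moreover have "e j = inverse (sqrt (M x)) *\<^sub>R lift (f j) x" using e(1) j by (simp add: e0_def)
      ultimately show ?thesis using Mx by (simp add: mform_simps mform_lift[OF x])
    qed
    then show ?thesis
      using orthonormal_expand[OF sH f, of "fd u x (e i)"] by simp
  qed
  then show ?thesis using e by (intro exI[of _ f] exI[of _ e]) (auto simp: e0_def)
qed

definition horizontal :: "real ^ 'm \<Rightarrow> real ^ 'm \<Rightarrow> bool" where
  "horizontal y v \<longleftrightarrow> (\<forall>w. fd u y w = 0 \<longrightarrow> mform (G y) v w = 0)"

lemma horizontal_lift: "y \<in> U \<Longrightarrow> horizontal y (lift w y)"
  by (simp add: horizontal_def mform_lift mform_simps)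

text \<open>Gram-Schmidt with smooth coefficients. At x the fields are orthonormal from the start,
  so nothing changes there; this is why \<open>E i x = Y i x\<close> is carried along. Horizontal
  and vertical type survive because the two kinds of vectors are orthogonal to each other.\<close>

lemma adapted_gram_schmidt:
  assumes x: "x \<in> U" and k: "k \<le> CARD('m)"
    and Ys: "\<And>i. i \<in> {1..CARD('m)} \<Longrightarrow> smooth_on U (Y i)"
    and o: "orthonormal_on (G x) {1..CARD('m)} (\<lambda>i. Y i x)"
    and hor: "\<forall>i\<in>{1..CARD('n)}. \<forall>y\<in>U. horizontal y (Y i y)"
    and ver: "\<forall>i\<in>{CARD('n)+1..CARD('m)}. \<forall>y\<in>U. fd u y (Y i y) = 0"
  shows "\<exists>U' E. open U' \<and> x \<in> U' \<and> U' \<subseteq> U \<and>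
    (\<forall>i\<in>{1..k}. smooth_on U' (E i) \<and> E i x = Y i x) \<and>
    (\<forall>y\<in>U'. orthonormal_on (G y) {1..k} (\<lambda>i. E i y) \<and>
      (\<forall>i\<in>{1..k}. (i \<le> CARD('n) \<longrightarrow> horizontal y (E i y)) \<and> (CARD('n) < i \<longrightarrow> fd u y (E i y) = 0)))"
  using k
proof (induction k)
  case 0
  show ?case using U x by (intro exI[of _ U]) (auto simp: orthonormal_on_def)
next
  case (Suc k)
  obtain U' E where U': "open U'" "x \<in> U'" "U' \<subseteq> U"
    and E1: "\<forall>i\<in>{1..k}. smooth_on U' (E i) \<and> E i x = Y i x"
    and E2: "\<forall>y\<in>U'. orthonormal_on (G y) {1..k} (\<lambda>i. E i y) \<and>
      (\<forall>i\<in>{1..k}. (i \<le> CARD('n) \<longrightarrow> horizontal y (E i y)) \<and> (CARD('n) < i \<longrightarrow> fd u y (E i y) = 0))"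
    using Suc.IH[OF Suc_leD[OF Suc.prems]] by (elim exE conjE) (rule that)
  have Es: "smooth_on U' (E i)" and Ex: "E i x = Y i x" if "i \<in> {1..k}" for i
    using E1 that by blast+
  have Eo: "orthonormal_on (G y) {1..k} (\<lambda>i. E i y)"
    and Eh: "i \<in> {1..k} \<Longrightarrow> i \<le> CARD('n) \<Longrightarrow> horizontal y (E i y)"
    and Ev: "i \<in> {1..k} \<Longrightarrow> CARD('n) < i \<Longrightarrow> fd u y (E i y) = 0" if "y \<in> U'" for y i
    using E2 that by blast+
  let ?k = "Suc k"
  have kk: "?k \<in> {1..CARD('m)}" using Suc.prems by auto
  define Z where "Z y = Y ?k y - (\<Sum>i\<in>{1..k}. mform (G y) (E i y) (Y ?k y) *\<^sub>R E i y)" for y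
  define N where "N y = mform (G y) (Z y) (Z y)" for y
  define E' where "E' i = (if i = ?k then (\<lambda>y. (N y powr (-1/2)) *\<^sub>R Z y) else E i)" for i
  have GU': "smooth_on U' G" by (rule smooth_on_subset[OF G U'(3)])
  have YU': "smooth_on U' (Y ?k)" by (rule smooth_on_subset[OF Ys[OF kk] U'(3)])
  have Zs: "smooth_on U' Z"
    unfolding Z_def[abs_def]
    by (intro smooth_on_diff[OF U'(1)] YU' smooth_on_sum[OF U'(1)] smooth_on_scaleR[OF U'(1)]
        smooth_on_mform[OF U'(1) GU'] Es)
  have Ns: "smooth_on U' N"
    unfolding N_def[abs_def] by (intro smooth_on_mform[OF U'(1) GU'] Zs)
  have oi: "mform (G x) (Y i x) (Y j x) = (if i = j then 1 else 0)"
    if "i \<in> {1..CARD('m)}" "j \<in> {1..CARD('m)}" for i j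
    using o that by (simp add: orthonormal_on_def)
  have Zx: "Z x = Y ?k x"
  proof -
    have "mform (G x) (E i x) (Y ?k x) = 0" if "i \<in> {1..k}" for i
      using oi[OF _ kk, of i] Ex[OF that] that kk by auto
    then show ?thesis by (simp add: Z_def)
  qed
  have Nx: "N x = 1" using oi[OF kk kk] by (simp add: N_def Zx)
  \<comment> \<open>The squared length \<open>N\<close> of the new vector is 1 at x; the
    neighbourhood shrinks to where it stays positive and can be normalised.\<close>
  define U'' where "U'' = U' \<inter> N -` {0<..}"
  have U'': "open U''" "x \<in> U''" "U'' \<subseteq> U'"
    using continuous_open_preimage[OF smooth_on_imp_continuous_on[OF Ns] U'(1) open_greaterThan[of 0]] U'(2) Nx
    by (auto simp: U''_def)
  have U''U: "U'' \<subseteq> U" using U''(3) U'(3) by blast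
  have Npos: "0 < N y" if "y \<in> U''" for y using that by (simp add: U''_def)
  have "smooth_on U'' (\<lambda>y. (N y powr (-1/2)) *\<^sub>R Z y)"
    by (intro smooth_on_scaleR[OF U''(1)] smooth_on_powr_compose[OF U''(1)] smooth_on_subset[OF Ns U''(3)]
        smooth_on_subset[OF Zs U''(3)] Npos)
  then have E's: "smooth_on U'' (E' i)" if "i \<in> {1..?k}" for i
    using that smooth_on_subset[OF Es U''(3), of i] by (auto simp: E'_def le_Suc_eq)
  have E'x: "E' i x = Y i x" if "i \<in> {1..?k}" for i
    using that Ex by (auto simp: E'_def Zx Nx le_Suc_eq)
  have E'o: "orthonormal_on (G y) {1..?k} (\<lambda>i. E' i y)" if y: "y \<in> U''" for y
  proof -
    have yU': "y \<in> U'" and yU: "y \<in> U" using y U''(3) U''U by auto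
    have Eij: "mform (G y) (E i y) (E j y) = (if i = j then 1 else 0)" if "i \<in> {1..k}" "j \<in> {1..k}" for i j
      using Eo[OF yU'] that by (simp add: orthonormal_on_def)
    have EZ: "mform (G y) (E i y) (Z y) = 0" if i: "i \<in> {1..k}" for i
    proof -
      have "mform (G y) (E i y) (\<Sum>j\<in>{1..k}. mform (G y) (E j y) (Y ?k y) *\<^sub>R E j y) =
          (\<Sum>j\<in>{1..k}. if i = j then mform (G y) (E j y) (Y ?k y) else 0)"
        unfolding mform_sum mform_simps by (rule sum.cong[OF refl]) (simp add: Eij[OF i])
      then show ?thesis using i by (simp add: Z_def mform_simps)
    qed
    have NN: "N y powr (-1/2) * (N y powr (-1/2) * N y) = 1"
    proof -
      have "N y powr (-1/2) * (N y powr (-1/2) * N y) = N y powr (-1/2 + -1/2) * N y"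
        by (simp only: powr_add mult.assoc)
      also have "\<dots> = 1" using Npos[OF y] by (simp add: powr_minus)
      finally show ?thesis .
    qed
    have "mform (G y) (E' ?k y) (E' ?k y) = 1"
      using NN by (simp add: E'_def mform_simps N_def)
    moreover have "mform (G y) (E' i y) (E' ?k y) = 0" "mform (G y) (E' ?k y) (E' i y) = 0" if "i \<in> {1..k}" for i
      using EZ[OF that] spd_sym[OF spdG[OF yU], of "Z y"] that by (auto simp: E'_def mform_simps)
    moreover have "mform (G y) (E' i y) (E' j y) = (if i = j then 1 else 0)" if "i \<in> {1..k}" "j \<in> {1..k}" for i j
      using Eij[OF that] that by (simp add: E'_def)
    ultimately show ?thesis
      unfolding orthonormal_on_def by (auto simp: le_Suc_eq)
  qed
  have E'h: "(i \<le> CARD('n) \<longrightarrow> horizontal y (E' i y)) \<and> (CARD('n) < i \<longrightarrow> fd u y (E' i y) = 0)"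
    if y: "y \<in> U''" and i: "i \<in> {1..?k}" for y i
  proof (cases "i = ?k")
    case False
    then show ?thesis using Eh Ev y i U''(3) by (auto simp: E'_def le_Suc_eq)
  next
    case True
    have yU': "y \<in> U'" and yU: "y \<in> U" using y U''(3) U''U by auto
    have lin: "linear (fd u y)" by (rule smooth_on_linear[OF u yU])
    \<comment> \<open>The horizontal members come first, so a horizontal field is corrected by
      horizontal ones only.\<close>
    have "horizontal y (E' ?k y)" if kn: "?k \<le> CARD('n)"
    proof -
      have "mform (G y) (Z y) w = 0" if w: "fd u y w = 0" for w
      proof -
        have "mform (G y) (Y ?k y) w = 0" using hor yU kn w by (simp add: horizontal_def)
        moreover have "mform (G y) (E j y) w = 0" if "j \<in> {1..k}" for j
          using Eh[OF yU' that] that kn w by (simp add: horizontal_def)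
        ultimately show ?thesis by (simp add: Z_def mform_simps mform_sum)
      qed
      then show ?thesis by (simp add: horizontal_def E'_def mform_simps)
    qed
    moreover have "fd u y (E' ?k y) = 0" if kn: "CARD('n) < ?k"
    proof -
      have v: "fd u y (Y ?k y) = 0" using ver yU kn Suc.prems by simp
      \<comment> \<open>For horizontal E_j the coefficient vanishes, for vertical E_j its image
        under du does.\<close>
      have "mform (G y) (E j y) (Y ?k y) *\<^sub>R fd u y (E j y) = 0" if j: "j \<in> {1..k}" for j
        using Eh[OF yU' j] Ev[OF yU' j] v by (cases "j \<le> CARD('n)") (auto simp: horizontal_def)
      then have "(\<Sum>j\<in>{1..k}. mform (G y) (E j y) (Y ?k y) *\<^sub>R fd u y (E j y)) = 0"
        by (intro sum.neutral ballI)
      then have "fd u y (Z y) = 0"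
        by (simp add: Z_def linear_diff[OF lin] linear_sum[OF lin] linear_cmul[OF lin] v)
      then show ?thesis by (simp add: E'_def linear_cmul[OF lin])
    qed
    ultimately show ?thesis using True by simp
  qed
  show ?case
    by (intro exI[of _ U''] exI[of _ E'] conjI ballI U''(1,2) U''U E's E'x E'o) (use E'h in blast)+
qed

lemma local_adapted_frame:
  assumes x: "x \<in> U" and mn: "CARD('n) < CARD('m)"
  shows "\<exists>U' E. open U' \<and> x \<in> U' \<and> U' \<subseteq> U \<and> (\<forall>i\<in>{1..CARD('m)}. smooth_on U' (E i)) \<and>
    (\<forall>y\<in>U'. orthonormal_on (G y) {1..CARD('m)} (\<lambda>i. E i y) \<and>
      (\<forall>i\<in>{1..CARD('n)}. horizontal y (E i y)) \<and> (\<forall>i\<in>{CARD('n)+1..CARD('m)}. fd u y (E i y) = 0))"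
proof -
  obtain f e where e: "orthonormal_on (G x) {1..CARD('m)} e"
    and eh: "\<forall>i\<in>{1..CARD('n)}. e i = inverse (sqrt (M x)) *\<^sub>R lift (f i) x"
    and ev: "\<forall>i\<in>{CARD('n)+1..CARD('m)}. fd u x (e i) = 0"
    using adapted_basis[OF assms] by blast
  \<comment> \<open>Horizontal vectors are extended as lifts of constant target vectors. Vertical
    ones are extended constantly and then freed of their horizontal component, which is du* du (e_i)
    / M.\<close>
  define Y where "Y i y = (if i \<le> CARD('n) then inverse (sqrt (M x)) *\<^sub>R lift (f i) y
      else e i - inverse (M y) *\<^sub>R lift (fd u y (e i)) y)" for i y
  have Ys: "smooth_on U (Y i)" for i
  proof (cases "i \<le> CARD('n)")
    case True
    have "smooth_on U (\<lambda>y. inverse (sqrt (M x)) *\<^sub>R lift (f i) y)"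
      by (intro smooth_on_scaleR[OF U] smooth_on_const smooth_lift)
    then show ?thesis using True by (simp add: Y_def[abs_def])
  next
    case False
    have "smooth_on U (\<lambda>y. e i - inverse (M y) *\<^sub>R lift (fd u y (e i)) y)"
      by (intro smooth_on_diff[OF U] smooth_on_scaleR[OF U] smooth_on_inverse[OF U M Mpos] smooth_on_const
          smooth_lift_variable smooth_on_frechet_derivative[OF u])
    then show ?thesis using False by (simp add: Y_def[abs_def])
  qed
  have Yx: "Y i x = e i" if "i \<in> {1..CARD('m)}" for i
  proof (cases "i \<le> CARD('n)")
    case False
    then have "fd u x (e i) = 0" using ev that by auto
    then show ?thesis using False lift_linear[OF x, of 0] by (simp add: Y_def)
  qed (use eh that in \<open>simp add: Y_def\<close>)
  have o: "orthonormal_on (G x) {1..CARD('m)} (\<lambda>i. Y i x)"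
    using e Yx by (simp add: orthonormal_on_def)
  have hor: "\<forall>i\<in>{1..CARD('n)}. \<forall>y\<in>U. horizontal y (Y i y)"
  proof (intro ballI)
    fix i y assume that: "i \<in> {1..CARD('n)}" "y \<in> U"
    show "horizontal y (Y i y)"
      using horizontal_lift[OF that(2)] that(1) by (simp add: Y_def horizontal_def mform_simps)
  qed
  have ver: "\<forall>i\<in>{CARD('n)+1..CARD('m)}. \<forall>y\<in>U. fd u y (Y i y) = 0"
  proof (intro ballI)
    fix i y assume that: "i \<in> {CARD('n)+1..CARD('m)}" "y \<in> U"
    show "fd u y (Y i y) = 0"
      using that smooth_on_linear[OF u that(2)] Mpos[OF that(2)]
      by (simp add: Y_def linear_diff linear_cmul conformal)
  qed
  obtain U' E where U': "open U'" "x \<in> U'" "U' \<subseteq> U"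
    and E1: "\<forall>i\<in>{1..CARD('m)}. smooth_on U' (E i) \<and> E i x = Y i x"
    and E2: "\<forall>y\<in>U'. orthonormal_on (G y) {1..CARD('m)} (\<lambda>i. E i y) \<and>
      (\<forall>i\<in>{1..CARD('m)}. (i \<le> CARD('n) \<longrightarrow> horizontal y (E i y)) \<and> (CARD('n) < i \<longrightarrow> fd u y (E i y) = 0))"
    using adapted_gram_schmidt[OF x order_refl Ys o hor ver] by (elim exE conjE) (rule that)
  have E3: "horizontal y (E i y)" if "y \<in> U'" "i \<in> {1..CARD('n)}" for y i
    using bspec[OF E2 that(1)] that(2) mn by auto
  have E4: "fd u y (E i y) = 0" if "y \<in> U'" "i \<in> {CARD('n)+1..CARD('m)}" for y i
    using bspec[OF E2 that(1)] that(2) by auto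
  show ?thesis
    by (intro exI[of _ U'] exI[of _ E] conjI ballI U' E3 E4) (use E1 E2 in blast)+
qed

end

section \<open>Christoffel symbols\<close>

lemma mform_derivative_expand:
  fixes L :: "real ^ 'm::finite \<Rightarrow> real ^ 'm ^ 'm"
  assumes "linear L"
  shows "mform (L z) v w = (\<Sum>i\<in>UNIV. \<Sum>j\<in>UNIV. \<Sum>l\<in>UNIV. z $ i * v $ j * w $ l * L (axis i 1) $ j $ l)"
proof -
  have "mform (L z) v w = (\<Sum>j\<in>UNIV. \<Sum>l\<in>UNIV. v $ j * w $ l * L z $ j $ l)"
    by (simp add: bilinear_expand[OF bilinear_mform, of _ v w] mform_axis)
  also have "\<dots> = (\<Sum>j\<in>UNIV. \<Sum>l\<in>UNIV. \<Sum>i\<in>UNIV. z $ i * v $ j * w $ l * L (axis i 1) $ j $ l)"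
    by (simp add: linear_expand[OF assms, of z] sum_distrib_left mult_ac)
  also have "\<dots> = (\<Sum>j\<in>UNIV. \<Sum>i\<in>UNIV. \<Sum>l\<in>UNIV. z $ i * v $ j * w $ l * L (axis i 1) $ j $ l)"
    by (intro sum.cong refl sum.swap)
  also have "\<dots> = (\<Sum>i\<in>UNIV. \<Sum>j\<in>UNIV. \<Sum>l\<in>UNIV. z $ i * v $ j * w $ l * L (axis i 1) $ j $ l)"
    by (rule sum.swap)
  finally show ?thesis .
qed

context riemannian
begin

text \<open>Pairing with v lowers the upper index and cancels the inverse matrix. What remains is
  the Koszul formula for fields with constant components, so the connection enters later only
  through derivatives of the metric.\<close>

lemma christoffel_metric:
  assumes c: "c \<in> A" and x: "x \<in> cmap c ` cdom c"
  shows "mform (gmat c x) v (\<chi> k. \<Sum>i\<in>UNIV. \<Sum>j\<in>UNIV. christoffel A g c x k i j * X $ i * Y $ j) =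
    (mform (fd (gmat c) x X) Y v + mform (fd (gmat c) x Y) X v - mform (fd (gmat c) x v) X Y) / 2"
proof -
  note sm = smooth_metric_matrix[OF c] and s = spd_metric_matrix[OF c x]
  let ?L = "fd (gmat c) x" and ?B = "matrix_inv (gmat c x)"
  have lin: "linear ?L" by (rule smooth_on_linear[OF sm x])
  have pd: "partial_deriv i (\<lambda>y. gmat c y $ j $ l) x = ?L (axis i 1) $ j $ l" for i j l
    unfolding partial_deriv_def
    by (rule fun_cong[OF frechet_derivative_eq[OF has_derivative_matrix_nth[OF smooth_on_has_derivative[OF sm x]]]])
  \<comment> \<open>Twice the Christoffel symbol with its upper index lowered to l.\<close>
  define T where "T i j l = ?L (axis i 1) $ j $ l + ?L (axis j 1) $ i $ l - ?L (axis l 1) $ i $ j" for i j l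
  define t where "t = (\<chi> l. (\<Sum>i\<in>UNIV. \<Sum>j\<in>UNIV. T i j l * X $ i * Y $ j) / 2)"
  have "(\<Sum>i\<in>UNIV. \<Sum>j\<in>UNIV. christoffel A g c x k i j * X $ i * Y $ j) = (?B *v t) $ k" for k
  proof -
    have "(\<Sum>i\<in>UNIV. \<Sum>j\<in>UNIV. christoffel A g c x k i j * X $ i * Y $ j) =
        (\<Sum>i\<in>UNIV. \<Sum>j\<in>UNIV. \<Sum>l\<in>UNIV. ?B $ k $ l * (T i j l * X $ i * Y $ j) / 2)"
      by (simp add: christoffel_def pd T_def sum_distrib_right sum_distrib_left sum_divide_distrib mult_ac)
    also have "\<dots> = (\<Sum>i\<in>UNIV. \<Sum>l\<in>UNIV. \<Sum>j\<in>UNIV. ?B $ k $ l * (T i j l * X $ i * Y $ j) / 2)"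
      by (intro sum.cong refl sum.swap)
    also have "\<dots> = (\<Sum>l\<in>UNIV. \<Sum>i\<in>UNIV. \<Sum>j\<in>UNIV. ?B $ k $ l * (T i j l * X $ i * Y $ j) / 2)"
      by (rule sum.swap)
    finally show ?thesis
      by (simp add: matrix_vector_mult_def t_def sum_distrib_left sum_divide_distrib)
  qed
  then have "(\<chi> k. \<Sum>i\<in>UNIV. \<Sum>j\<in>UNIV. christoffel A g c x k i j * X $ i * Y $ j) = ?B *v t"
    by (simp add: vec_eq_iff)
  then have "mform (gmat c x) v (\<chi> k. \<Sum>i\<in>UNIV. \<Sum>j\<in>UNIV. christoffel A g c x k i j * X $ i * Y $ j) = v \<bullet> t"
    by (simp add: mform_def spd_invertible(4)[OF s])
  also have "\<dots> = (\<Sum>l\<in>UNIV. \<Sum>i\<in>UNIV. \<Sum>j\<in>UNIV. v $ l * (T i j l * X $ i * Y $ j)) / 2"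
    by (simp add: inner_vec_def t_def sum_distrib_left sum_divide_distrib)
  also have "(\<Sum>l\<in>UNIV. \<Sum>i\<in>UNIV. \<Sum>j\<in>UNIV. v $ l * (T i j l * X $ i * Y $ j)) =
      (\<Sum>l\<in>UNIV. \<Sum>i\<in>UNIV. \<Sum>j\<in>UNIV. X $ i * Y $ j * v $ l * ?L (axis i 1) $ j $ l) +
      (\<Sum>l\<in>UNIV. \<Sum>i\<in>UNIV. \<Sum>j\<in>UNIV. Y $ j * X $ i * v $ l * ?L (axis j 1) $ i $ l) -
      (\<Sum>l\<in>UNIV. \<Sum>i\<in>UNIV. \<Sum>j\<in>UNIV. v $ l * X $ i * Y $ j * ?L (axis l 1) $ i $ j)"
    by (simp add: T_def sum.distrib[symmetric] sum_subtractf[symmetric] algebra_simps)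
  also have "(\<Sum>l\<in>UNIV. \<Sum>i\<in>UNIV. \<Sum>j\<in>UNIV. X $ i * Y $ j * v $ l * ?L (axis i 1) $ j $ l) =
      mform (?L X) Y v"
  proof -
    have "(\<Sum>l\<in>UNIV. \<Sum>i\<in>UNIV. \<Sum>j\<in>UNIV. X $ i * Y $ j * v $ l * ?L (axis i 1) $ j $ l) =
        (\<Sum>i\<in>UNIV. \<Sum>l\<in>UNIV. \<Sum>j\<in>UNIV. X $ i * Y $ j * v $ l * ?L (axis i 1) $ j $ l)"
      by (rule sum.swap)
    also have "\<dots> = (\<Sum>i\<in>UNIV. \<Sum>j\<in>UNIV. \<Sum>l\<in>UNIV. X $ i * Y $ j * v $ l * ?L (axis i 1) $ j $ l)"
      by (intro sum.cong refl sum.swap)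
    finally show ?thesis by (simp add: mform_derivative_expand[OF lin])
  qed
  also have "(\<Sum>l\<in>UNIV. \<Sum>i\<in>UNIV. \<Sum>j\<in>UNIV. Y $ j * X $ i * v $ l * ?L (axis j 1) $ i $ l) =
      mform (?L Y) X v"
  proof -
    have "(\<Sum>l\<in>UNIV. \<Sum>i\<in>UNIV. \<Sum>j\<in>UNIV. Y $ j * X $ i * v $ l * ?L (axis j 1) $ i $ l) =
        (\<Sum>l\<in>UNIV. \<Sum>j\<in>UNIV. \<Sum>i\<in>UNIV. Y $ j * X $ i * v $ l * ?L (axis j 1) $ i $ l)"
      by (intro sum.cong refl sum.swap)
    also have "\<dots> = (\<Sum>j\<in>UNIV. \<Sum>l\<in>UNIV. \<Sum>i\<in>UNIV. Y $ j * X $ i * v $ l * ?L (axis j 1) $ i $ l)"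
      by (rule sum.swap)
    also have "\<dots> = (\<Sum>j\<in>UNIV. \<Sum>i\<in>UNIV. \<Sum>l\<in>UNIV. Y $ j * X $ i * v $ l * ?L (axis j 1) $ i $ l)"
      by (intro sum.cong refl sum.swap)
    finally show ?thesis by (simp add: mform_derivative_expand[OF lin])
  qed
  also have "(\<Sum>l\<in>UNIV. \<Sum>i\<in>UNIV. \<Sum>j\<in>UNIV. v $ l * X $ i * Y $ j * ?L (axis l 1) $ i $ j) =
      mform (?L v) X Y"
    by (simp add: mform_derivative_expand[OF lin])
  finally show ?thesis .
qed

end

section \<open>The mean curvature of the fibers\<close>

context conformal_map
begin

text \<open>\<open>minimal_fibers\<close> quantifies over adapted frames and would be empty at a
  point without one. The frame found in coordinates is carried to the manifold by
  \<open>vect\<close>.\<close>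

lemma adapted_frame_exists:
  assumes mn: "CARD('n) < CARD('m)"
  shows "\<exists>W e. p \<in> W \<and> adapted_frame A g B \<psi> W e"
proof -
  let ?c = "chart_at A p" and ?d = "chart_at B (\<psi> p)"
  have c: "?c \<in> A" "p \<in> cdom ?c" and d: "?d \<in> B" "\<psi> p \<in> cdom ?d"
    using M.chart_at N.chart_at by auto
  have p: "p \<in> src ?c ?d" using c d by (simp add: src_def)
  interpret conformal_chart "cmap ?c ` src ?c ?d" "cmap ?d ` cdom ?d" "M.gmat ?c" "N.gmat ?d" "uc ?c ?d"
    "Mc ?c" "liftc ?c ?d"
    by (rule conformal_chart_uc[OF c(1) d(1)])
  obtain U' E where U': "open U'" "cmap ?c p \<in> U'" "U' \<subseteq> cmap ?c ` src ?c ?d"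
    and Es: "\<forall>i\<in>{1..CARD('m)}. smooth_on U' (E i)"
    and E2: "\<forall>y\<in>U'. orthonormal_on (M.gmat ?c y) {1..CARD('m)} (\<lambda>i. E i y) \<and>
      (\<forall>i\<in>{1..CARD('n)}. horizontal y (E i y)) \<and> (\<forall>i\<in>{CARD('n)+1..CARD('m)}. fd (uc ?c ?d) y (E i y) = 0)"
    using local_adapted_frame[OF imageI[OF p] mn] by (elim exE conjE) (rule that)
  have U'c: "U' \<subseteq> cmap ?c ` cdom ?c" using U'(3) by (auto simp: src_def)
  define W where "W = cinv ?c ` U'"
  define e where "e i q = M.vect ?c q (E i (cmap ?c q))" for i q
  have W: "open W" unfolding W_def by (rule M.open_cinv_image[OF c(1) U'(1) U'c])
  have Wq: "q \<in> cdom ?c" "q \<in> src ?c ?d" "cmap ?c q \<in> U'" if q: "q \<in> W" for q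
  proof -
    obtain y where y: "y \<in> U'" "q = cinv ?c y" using q unfolding W_def by blast
    obtain r where r: "r \<in> src ?c ?d" "y = cmap ?c r" using y(1) U'(3) by blast
    have "q = r" using r by (simp add: y(2) M.cinv_cmap[OF c(1)] src_def)
    then show "q \<in> cdom ?c" "q \<in> src ?c ?d" "cmap ?c q \<in> U'" using r y by (auto simp: src_def)
  qed
  have "adapted_frame A g B \<psi> W e"
    unfolding adapted_frame_def
  proof (intro conjI ballI W)
    fix i assume i: "i \<in> {1..CARD('m)}"
    show "smooth_field_on A W (e i)"
      unfolding smooth_field_on_def
    proof
      fix c' assume c': "c' \<in> A"
      let ?Y = "cmap c' ` (W \<inter> cdom c')" and ?Z = "cmap ?c ` (W \<inter> cdom c')"
      have Y: "open ?Y"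
        by (rule M.open_cmap_image[OF c']) (use W M.chart(1)[OF c'] in \<open>auto simp: open_Int\<close>)
      have Z: "open ?Z"
        by (rule M.open_cmap_image[OF c(1)]) (use W M.chart(1)[OF c'] Wq in \<open>auto simp: open_Int\<close>)
      \<comment> \<open>In another chart the components of the field are the derivative of the
        transition map applied to E_i.\<close>
      have "smooth_on ?Z (\<lambda>z. fd (cmap c' \<circ> cinv ?c) z (E i z))"
      proof (rule smooth_on_fd_apply[OF Z])
        show "smooth_on ?Z (cmap c' \<circ> cinv ?c)"
          by (rule smooth_on_subset[OF M.transition(2)[OF c(1) c']]) (use Wq in auto)
        show "smooth_on ?Z (E i)"
          by (rule smooth_on_subset[OF bspec[OF Es i]]) (use Wq in auto)
      qed
      moreover have "smooth_on ?Y (cmap ?c \<circ> cinv c')"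
        by (rule smooth_on_subset[OF M.transition(2)[OF c' c(1)]]) (use Wq in auto)
      moreover have "(cmap ?c \<circ> cinv c') ` ?Y \<subseteq> ?Z" using M.cinv_cmap[OF c'] by auto
      ultimately have "smooth_on ?Y (\<lambda>y. fd (cmap c' \<circ> cinv ?c) ((cmap ?c \<circ> cinv c') y) (E i ((cmap ?c \<circ> cinv c') y)))"
        using smooth_on_compose[OF Y] by blast
      then show "smooth_on ?Y (field_in_chart A c' (e i))"
      proof (rule smooth_on_cong[OF _ Y])
        fix y assume "y \<in> ?Y"
        then obtain q where q: "q \<in> W" "q \<in> cdom c'" "y = cmap c' q" by blast
        then show "fd (cmap c' \<circ> cinv ?c) ((cmap ?c \<circ> cinv c') y) (E i ((cmap ?c \<circ> cinv c') y)) =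
            field_in_chart A c' (e i) y"
          using M.dtrans_compose[OF c(1) Wq(1)[OF q(1)] M.chart_at c' q(2)]
          by (simp add: M.field_in_chart_eq e_def M.cinv_cmap[OF c'])
      qed
    qed
  next
    fix q i j assume q: "q \<in> W" and ij: "i \<in> {1..CARD('m)}" "j \<in> {1..CARD('m)}"
    show "g q (e i q) (e j q) = (if i = j then 1 else 0)"
      using bspec[OF E2 Wq(3)[OF q]] ij
      by (simp add: e_def M.metric_vect[OF c(1) Wq(1)[OF q]] orthonormal_on_def)
  next
    fix q i assume q: "q \<in> W" and i: "i \<in> {1..CARD('n)}"
    have "g q (e i q) w = 0" if w: "tangent_map A B \<psi> q w = 0" for w
    proof -
      have "fd (uc ?c ?d) (cmap ?c q) (M.comps ?c q w) = N.comps ?d (\<psi> q) 0"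
        unfolding tangent_map_src(1)[OF c(1) d(1) Wq(2)[OF q], symmetric] w ..
      also have "\<dots> = 0"
        by (rule linear_0[OF N.linear_comps[OF d(1)]]) (use Wq(2)[OF q] in \<open>simp add: src_def\<close>)
      finally have "mform (M.gmat ?c (cmap ?c q)) (E i (cmap ?c q)) (M.comps ?c q w) = 0"
        using bspec[OF E2 Wq(3)[OF q]] i unfolding horizontal_def by blast
      then show ?thesis
        unfolding M.metric_comps[OF c(1) Wq(1)[OF q]] e_def M.comps_vect[OF c(1) Wq(1)[OF q]] .
    qed
    then show "e i q \<in> horizontal_space A g B \<psi> q"
      by (simp add: horizontal_space_def vertical_space_def)
  next
    fix q i assume q: "q \<in> W" and i: "i \<in> {CARD('n)+1..CARD('m)}"
    have qd: "\<psi> q \<in> cdom ?d" using Wq(2)[OF q] by (simp add: src_def)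
    have "N.comps ?d (\<psi> q) (tangent_map A B \<psi> q (e i q)) = fd (uc ?c ?d) (cmap ?c q) (E i (cmap ?c q))"
      unfolding tangent_map_src(1)[OF c(1) d(1) Wq(2)[OF q]] e_def M.comps_vect[OF c(1) Wq(1)[OF q]] ..
    also have "\<dots> = 0" using bspec[OF E2 Wq(3)[OF q]] i by blast
    finally have "N.vect ?d (\<psi> q) (N.comps ?d (\<psi> q) (tangent_map A B \<psi> q (e i q))) = 0"
      by (simp only: linear_0[OF N.linear_vect[OF d(1) qd]])
    then have "tangent_map A B \<psi> q (e i q) = 0"
      unfolding N.vect_comps[OF d(1) qd] .
    then show "e i q \<in> vertical_space A B \<psi> q" by (simp add: vertical_space_def)
  qed
  moreover have "p \<in> W"
    using U'(2) M.cinv_cmap[OF c] by (auto simp: W_def image_iff intro!: bexI[of _ "cmap ?c p"])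
  ultimately show ?thesis by blast
qed

text \<open>The derivative of the frame field is removed with the help of du (e_i) = 0 for vertical
  i, after which each g(nabla_{e_i} e_i, e_a) consists of the metric and second derivative terms of
  \<open>vertical_trace\<close>.\<close>

lemma mean_curvature_gradient:
  assumes dV: "riemannian_measure A g dV" and cpt: "compact (UNIV :: 'a set)" and mn: "CARD('n) < CARD('m)"
    and ah: "alpha_harmonic A g dV B h \<alpha> \<psi>" and "\<alpha> \<noteq> 0"
    and fr: "adapted_frame A g B \<psi> W e" and p: "p \<in> W" and a: "a \<in> {1..CARD('n)}"
  shows "(\<mu> p)\<^sup>2 * (\<Sum>i\<in>{CARD('n)+1..CARD('m)}. g p (levi_civita A g (e i) (e i) p) (e a p)) =
    ((\<alpha> - 1) * real CARD('n) * (\<mu> p)\<^sup>2 / (1 + real CARD('n) * (\<mu> p)\<^sup>2) + 1 - real CARD('n) / 2) *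
      function_differential A (\<lambda>p. (\<mu> p)\<^sup>2) p (e a p)"
proof -
  \<comment> \<open>The chart preferred at p is the one used by \<open>levi_civita\<close> and the
    one in which vectors at p are stored, so \<open>comps c p\<close> is the identity.\<close>
  define c where "c = chart_at A p"
  define d where "d = chart_at B (\<psi> p)"
  have c: "c \<in> A" "p \<in> cdom c" and d: "d \<in> B" "\<psi> p \<in> cdom d"
    using M.chart_at N.chart_at by (auto simp: c_def d_def)
  have ps: "p \<in> src c d" using c d by (simp add: src_def)
  interpret conformal_chart "cmap c ` src c d" "cmap d ` cdom d" "M.gmat c" "N.gmat d" "uc c d"
    "Mc c" "liftc c d"
    by (rule conformal_chart_uc[OF c(1) d(1)])
  define x where "x = cmap c p"
  have x: "x \<in> cmap c ` src c d" using ps by (simp add: x_def)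
  have xc: "x \<in> cmap c ` cdom c" using c by (simp add: x_def)
  have cid: "M.comps c p v = v" for v unfolding c_def by (rule M.comps_chart_at)
  have gx: "g p v w = mform (M.gmat c x) v w" for v w
    using M.metric_comps[OF c] by (simp add: cid x_def)
  have Mx: "Mc c x = (\<mu> p)\<^sup>2" by (simp add: Mc_def x_def M.cinv_cmap[OF c])
  have W: "open W" and esm: "\<And>i. i \<in> {1..CARD('m)} \<Longrightarrow> smooth_field_on A W (e i)"
    and eo: "\<And>i j. i \<in> {1..CARD('m)} \<Longrightarrow> j \<in> {1..CARD('m)} \<Longrightarrow> g p (e i p) (e j p) = (if i = j then 1 else 0)"
    and eh: "\<And>i. i \<in> {1..CARD('n)} \<Longrightarrow> e i p \<in> horizontal_space A g B \<psi> p"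
    and ev: "\<And>i q. q \<in> W \<Longrightarrow> i \<in> {CARD('n)+1..CARD('m)} \<Longrightarrow> e i q \<in> vertical_space A B \<psi> q"
    using fr p unfolding adapted_frame_def by blast+
  have o: "orthonormal_on (M.gmat c x) {1..CARD('m)} (\<lambda>i. e i p)"
    using eo by (simp add: orthonormal_on_def gx)
  have ver: "fd (uc c d) (cmap c q) (M.comps c q (e i q)) = 0"
    if "q \<in> W" "q \<in> src c d" "i \<in> {CARD('n)+1..CARD('m)}" for q i
  proof -
    have "fd (uc c d) (cmap c q) (M.comps c q (e i q)) = N.comps d (\<psi> q) 0"
      using tangent_map_src(1)[OF c(1) d(1) that(2), of "e i q"] ev[OF that(1,3)]
      by (simp add: vertical_space_def)
    also have "\<dots> = 0"
      by (rule linear_0[OF N.linear_comps[OF d(1)]]) (use that(2) in \<open>simp add: src_def\<close>)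
    finally show ?thesis .
  qed
  have verp: "fd (uc c d) x (e i p) = 0" if "i \<in> {CARD('n)+1..CARD('m)}" for i
    using ver[OF p ps that] by (simp add: cid x_def)
  have du: "fd (uc c d) x v = N.comps d (\<psi> p) (tangent_map A B \<psi> p v)" for v
    using tangent_map_src(1)[OF c(1) d(1) ps, of v] by (simp add: cid x_def)
  have ux: "uc c d x = cmap d (\<psi> p)" by (simp add: uc_def x_def M.cinv_cmap[OF c])
  \<comment> \<open>The lift is expanded in the frame. Its coefficients are the products of du (e_i)
    and du (e_j), which are M or 0 by conformality and vanish for vertical j.\<close>
  have hor: "liftc c d (fd (uc c d) x (e i p)) x = Mc c x *\<^sub>R e i p" if i: "i \<in> {1..CARD('n)}" for i
  proof -
    let ?X = "liftc c d (fd (uc c d) x (e i p)) x"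
    have im: "i \<in> {1..CARD('m)}" using i mn by auto
    have coef: "mform (M.gmat c x) (e j p) ?X = (if i = j then Mc c x else 0)" if j: "j \<in> {1..CARD('m)}" for j
    proof -
      have "mform (M.gmat c x) (e j p) ?X = mform (M.gmat c x) ?X (e j p)"
        by (rule spd_sym[OF spdG[OF x]])
      also have "\<dots> = mform (N.gmat d (cmap d (\<psi> p))) (fd (uc c d) x (e i p)) (fd (uc c d) x (e j p))"
        unfolding mform_lift[OF x] ux ..
      also have "\<dots> = (if i = j then Mc c x else 0)"
      proof (cases "j \<le> CARD('n)")
        case True
        then have "j \<in> {1..CARD('n)}" using j by simp
        from dilation[OF eh[OF i] eh[OF this]] show ?thesis
          unfolding du N.metric_comps[OF d] by (simp add: eo[OF im j] Mx)
      next
        case False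
        then show ?thesis using verp[of j] j i by (auto simp: mform_simps)
      qed
      finally show ?thesis .
    qed
    have "?X = (\<Sum>j\<in>{1..CARD('m)}. mform (M.gmat c x) (e j p) ?X *\<^sub>R e j p)"
      by (rule orthonormal_expand[OF spdG[OF x] o]) simp_all
    also have "\<dots> = (\<Sum>j\<in>{1..CARD('m)}. if i = j then Mc c x *\<^sub>R e j p else 0)"
      by (rule sum.cong[OF refl]) (simp add: coef)
    also have "\<dots> = Mc c x *\<^sub>R e i p" using im by simp
    finally show ?thesis .
  qed
  have summand: "Mc c x * g p (levi_civita A g (e i) (e i) p) (e a p) =
      Mc c x * (mform (fd (M.gmat c) x (e i p)) (e i p) (e a p) - mform (fd (M.gmat c) x (e a p)) (e i p) (e i p) / 2)
      - mform (N.gmat d (uc c d x)) (fd (uc c d) x (e a p)) (fd (\<lambda>y. fd (uc c d) y (e i p)) x (e i p))"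
    if i: "i \<in> {CARD('n)+1..CARD('m)}" for i
  proof -
    let ?E = "field_in_chart A c (e i)" and ?e = "e i p" and ?G = "M.gmat c x"
    let ?\<Gamma> = "\<chi> k. \<Sum>j\<in>UNIV. \<Sum>l\<in>UNIV. christoffel A g c x k j l * ?e $ j * ?e $ l"
    have Ex: "?E x = ?e" by (simp add: M.field_in_chart_eq x_def M.cinv_cmap[OF c] cid)
    have im: "i \<in> {1..CARD('m)}" using i by auto
    have "smooth_on (cmap c ` (W \<inter> cdom c)) ?E" using esm[OF im] c(1) by (simp add: smooth_field_on_def)
    then have E': "(?E has_derivative fd ?E x) (at x)"
      by (rule smooth_on_has_derivative) (use p c in \<open>simp add: x_def\<close>)
    have "((\<lambda>y. fd (uc c d) y (?E y)) has_derivative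
        (\<lambda>z. fd (\<lambda>y. fd (uc c d) y (?E x)) x z + fd (uc c d) x (fd ?E x z))) (at x)"
      by (rule has_derivative_fd_apply[OF U x u E'])
    \<comment> \<open>The field is vertical in a whole neighbourhood, so du (E_i) = 0 can be
      differentiated; du of the derivative of E_i is thereby minus the second derivative of
      u.\<close>
    moreover have "((\<lambda>y. fd (uc c d) y (?E y)) has_derivative (\<lambda>z. 0)) (at x)"
    proof (rule has_derivative_transform_within_open[OF has_derivative_const[of 0]])
      show "open (cmap c ` (W \<inter> src c d))"
        by (rule M.open_cmap_image[OF c(1)]) (use W open_src[OF c(1) d(1)] in \<open>auto simp: open_Int src_def\<close>)
      show "x \<in> cmap c ` (W \<inter> src c d)" using p ps by (simp add: x_def)
      fix y assume "y \<in> cmap c ` (W \<inter> src c d)"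
      then obtain q where q: "q \<in> W" "q \<in> src c d" "y = cmap c q" by blast
      then have "q \<in> cdom c" by (simp add: src_def)
      then show "0 = fd (uc c d) y (?E y)"
        using ver[OF q(1,2) i] by (simp add: q(3) M.field_in_chart_eq M.cinv_cmap[OF c(1)])
    qed
    ultimately have 0: "fd (\<lambda>y. fd (uc c d) y ?e) x ?e + fd (uc c d) x (fd ?E x ?e) = 0"
      using fun_cong[OF has_derivative_unique, of _ _ _ _ ?e] unfolding Ex by blast
    have lc: "levi_civita A g (e i) (e i) p = fd ?E x ?e + ?\<Gamma>"
      unfolding levi_civita_def Let_def c_def[symmetric] x_def[symmetric] ..
    \<comment> \<open>As M e_a is the lift of du (e_a), pairing with it moves the product to the
      target.\<close>
    have "Mc c x * mform ?G (fd ?E x ?e) (e a p) = mform ?G (Mc c x *\<^sub>R e a p) (fd ?E x ?e)"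
      using spd_sym[OF spdG[OF x]] by (simp add: mform_simps)
    also have "\<dots> = mform (N.gmat d (uc c d x)) (fd (uc c d) x (e a p)) (fd (uc c d) x (fd ?E x ?e))"
      unfolding hor[OF a, symmetric] by (rule mform_lift[OF x])
    also have "fd (uc c d) x (fd ?E x ?e) = - fd (\<lambda>y. fd (uc c d) y ?e) x ?e"
      using 0 by (simp add: eq_neg_iff_add_eq_0 add.commute)
    finally have 1: "Mc c x * mform ?G (fd ?E x ?e) (e a p) =
        - mform (N.gmat d (uc c d x)) (fd (uc c d) x (e a p)) (fd (\<lambda>y. fd (uc c d) y ?e) x ?e)"
      by (simp add: mform_simps)
    \<comment> \<open>With both arguments equal to e_i the first two terms of the Christoffel
      formula coincide, which removes the factor 1/2 from them.\<close>
    have 2: "mform ?G ?\<Gamma> (e a p) =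
        mform (fd (M.gmat c) x ?e) ?e (e a p) - mform (fd (M.gmat c) x (e a p)) ?e ?e / 2"
      unfolding spd_sym[OF spdG[OF x], of ?\<Gamma>] M.christoffel_metric[OF c(1) xc] by simp
    have "Mc c x * g p (levi_civita A g (e i) (e i) p) (e a p) =
        Mc c x * mform ?G (fd ?E x ?e) (e a p) + Mc c x * mform ?G ?\<Gamma> (e a p)"
      unfolding gx lc by (simp only: mform_simps distrib_left)
    then show ?thesis unfolding 1 2 by simp
  qed
  have "(\<mu> p)\<^sup>2 * (\<Sum>i\<in>{CARD('n)+1..CARD('m)}. g p (levi_civita A g (e i) (e i) p) (e a p)) =
      (\<Sum>i\<in>{CARD('n)+1..CARD('m)}. Mc c x * g p (levi_civita A g (e i) (e i) p) (e a p))"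
    by (simp add: Mx sum_distrib_left)
  also have "\<dots> = (\<Sum>i\<in>{CARD('n)+1..CARD('m)}. Mc c x * (mform (fd (M.gmat c) x (e i p)) (e i p) (e a p)
      - mform (fd (M.gmat c) x (e a p)) (e i p) (e i p) / 2)
      - mform (N.gmat d (uc c d x)) (fd (uc c d) x (e a p)) (fd (\<lambda>y. fd (uc c d) y (e i p)) x (e i p)))"
    by (rule sum.cong[OF refl]) (rule summand)
  also have "\<dots> = ((\<alpha> - 1) * real CARD('n) * Mc c x / (1 + real CARD('n) * Mc c x) + 1 - real CARD('n) / 2) *
      fd (Mc c) x (e a p)"
    by (rule vertical_trace[OF x \<open>\<alpha> \<noteq> 0\<close> _ o mn verp hor a])
      (use weak_equation[OF dV cpt ah c(1) d(1)] in blast)+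
  also have "fd (Mc c) x (e a p) = function_differential A (\<lambda>p. (\<mu> p)\<^sup>2) p (e a p)"
    unfolding M.function_differential_eq[OF c smooth_mu2] by (simp add: Mc_def x_def cid)
  finally show ?thesis unfolding Mx .
qed

section \<open>The equivalence\<close>

lemma minimal_fibers_iff:
  assumes dV: "riemannian_measure A g dV" and cpt: "compact (UNIV :: 'a set)" and mn: "CARD('n) < CARD('m)"
    and ah: "alpha_harmonic A g dV B h \<alpha> \<psi>" and \<alpha>: "1 < \<alpha>" "2 * \<alpha> < real CARD('n)"
  shows "minimal_fibers A g B \<psi> \<longleftrightarrow> vertical_field A B \<psi> (gradient A g (\<lambda>p. (\<mu> p)\<^sup>2))"
proof -
  let ?m = "CARD('m)" and ?n = "CARD('n)"
  define D where "D p = function_differential A (\<lambda>p. (\<mu> p)\<^sup>2) p" for p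
  define \<kappa> where "\<kappa> p = (\<alpha> - 1) * real ?n * (\<mu> p)\<^sup>2 / (1 + real ?n * (\<mu> p)\<^sup>2) + 1 - real ?n / 2" for p
  \<comment> \<open>The quotient n M / (1 + n M) is at most 1, so the coefficient is at most
    \<alpha> - n / 2. The hypothesis \<alpha> > 1 enters to preserve the inequality under
    multiplication by \<alpha> - 1.\<close>
  have \<kappa>: "\<kappa> p < 0" for p
  proof -
    let ?s = "real ?n * (\<mu> p)\<^sup>2"
    have le: "s / (1 + s) \<le> 1" if "0 \<le> s" for s :: real
      using that by (simp add: divide_le_eq_1)
    define t where "t = ?s / (1 + ?s)"
    have "t \<le> 1" unfolding t_def by (rule le) simp
    then have "(\<alpha> - 1) * t \<le> (\<alpha> - 1) * 1" using \<alpha> by (intro mult_left_mono) auto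
    moreover have "\<kappa> p = (\<alpha> - 1) * t + 1 - real ?n / 2"
      by (simp add: \<kappa>_def t_def mult.assoc)
    ultimately have "\<kappa> p \<le> \<alpha> - real ?n / 2" by simp
    also have "\<dots> < 0" using \<alpha>(2) by simp
    finally show ?thesis .
  qed
  have \<mu>: "0 < (\<mu> p)\<^sup>2" for p using mu_pos[of p] by simp
  \<comment> \<open>By orthonormality the mean curvature vanishes exactly when each of its n
    coefficients does, and these are nonzero multiples of dM(e_a).\<close>
  have Hm: "fiber_mean_curvature A g TYPE('n) e p = 0 \<longleftrightarrow> (\<forall>a\<in>{1..?n}. D p (e a p) = 0)"
    if fr: "adapted_frame A g B \<psi> W e" and p: "p \<in> W" for W e p
  proof -
    define S where "S j = (\<Sum>i\<in>{?n+1..?m}. g p (levi_civita A g (e i) (e i) p) (e j p))" for j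
    have S: "(\<mu> p)\<^sup>2 * S a = \<kappa> p * D p (e a p)" if "a \<in> {1..?n}" for a
      unfolding S_def \<kappa>_def D_def
      by (rule mean_curvature_gradient[OF dV cpt mn ah _ fr p that]) (use \<alpha> in simp)
    have S0: "S a = 0 \<longleftrightarrow> D p (e a p) = 0" if "a \<in> {1..?n}" for a
      using S[OF that] \<kappa>[of p] \<mu>[of p] by (metis mult_eq_0_iff less_irrefl)
    have fmc: "fiber_mean_curvature A g TYPE('n) e p = (1 / (real ?m - real ?n)) *\<^sub>R (\<Sum>j\<in>{1..?n}. S j *\<^sub>R e j p)"
      by (simp add: fiber_mean_curvature_def S_def scaleR_sum_left)
    have eo: "g p (e i p) (e j p) = (if i = j then 1 else 0)" if "i \<in> {1..?n}" "j \<in> {1..?n}" for i j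
      using fr p that mn unfolding adapted_frame_def by auto
    have "(\<Sum>j\<in>{1..?n}. S j *\<^sub>R e j p) = 0 \<longleftrightarrow> (\<forall>a\<in>{1..?n}. S a = 0)"
    proof
      assume z: "(\<Sum>j\<in>{1..?n}. S j *\<^sub>R e j p) = 0"
      show "\<forall>a\<in>{1..?n}. S a = 0"
      proof
        fix a assume a: "a \<in> {1..?n}"
        have lin: "linear (g p (e a p))" using M.bilinear_metric[of p] by (simp add: bilinear_def)
        have "0 = g p (e a p) (\<Sum>j\<in>{1..?n}. S j *\<^sub>R e j p)" using linear_0[OF lin] z by simp
        also have "\<dots> = (\<Sum>j\<in>{1..?n}. if a = j then S j else 0)"
          unfolding linear_sum[OF lin] linear_cmul[OF lin]
          by (rule sum.cong[OF refl]) (simp add: eo[OF a])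
        finally show "S a = 0" using a by simp
      qed
    qed simp
    then show ?thesis using S0 mn by (simp add: fmc)
  qed
  \<comment> \<open>The frame coefficients of the gradient are the values dM(e_i); the gradient is
    vertical exactly when the horizontal ones among them vanish.\<close>
  have V: "gradient A g (\<lambda>p. (\<mu> p)\<^sup>2) p \<in> vertical_space A B \<psi> p \<longleftrightarrow> (\<forall>a\<in>{1..?n}. D p (e a p) = 0)"
    if fr: "adapted_frame A g B \<psi> W e" and p: "p \<in> W" for W e p
  proof -
    let ?v = "gradient A g (\<lambda>p. (\<mu> p)\<^sup>2) p"
    have grad: "g p ?v w = D p w" for w unfolding D_def by (rule M.gradient[OF smooth_mu2])
    let ?c = "chart_at A p"
    have geq: "g p v w = mform (M.gmat ?c (cmap ?c p)) v w" for v w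
      using M.metric_comps[OF M.chart_at] by (simp add: M.comps_chart_at)
    have sG: "spd (M.gmat ?c (cmap ?c p))"
      by (rule M.spd_metric_matrix[OF M.chart_at(1)]) (use M.chart_at(2) in auto)
    have o: "orthonormal_on (M.gmat ?c (cmap ?c p)) {1..?m} (\<lambda>i. e i p)"
      using fr p unfolding adapted_frame_def orthonormal_on_def geq[symmetric] by blast
    have eh: "e i p \<in> horizontal_space A g B \<psi> p" if "i \<in> {1..?n}" for i
      using fr p that unfolding adapted_frame_def by blast
    have ev: "tangent_map A B \<psi> p (e i p) = 0" if "i \<in> {?n+1..?m}" for i
      using fr p that unfolding adapted_frame_def vertical_space_def by blast
    show ?thesis
    proof
      assume v: "?v \<in> vertical_space A B \<psi> p"
      show "\<forall>a\<in>{1..?n}. D p (e a p) = 0"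
        using eh v M.metric_sym[of p ?v] by (simp add: grad[symmetric] horizontal_space_def)
    next
      assume 0: "\<forall>a\<in>{1..?n}. D p (e a p) = 0"
      have lin: "linear (tangent_map A B \<psi> p)"
        by (rule tangent_map_src(2)[OF M.chart_at(1) N.chart_at(1)])
          (use M.chart_at(2) N.chart_at(2) in \<open>auto simp: src_def\<close>)
      have ex: "?v = (\<Sum>i\<in>{1..?m}. g p (e i p) ?v *\<^sub>R e i p)"
        unfolding geq by (rule orthonormal_expand[OF sG o]) simp_all
      have co: "g p (e i p) ?v = D p (e i p)" for i
        unfolding M.metric_sym[of p "e i p"] by (rule grad)
      have "tangent_map A B \<psi> p ?v = tangent_map A B \<psi> p (\<Sum>i\<in>{1..?m}. D p (e i p) *\<^sub>R e i p)"
        by (rule arg_cong[OF ex[unfolded co]])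
      also have "\<dots> = (\<Sum>i\<in>{1..?m}. D p (e i p) *\<^sub>R tangent_map A B \<psi> p (e i p))"
        by (simp only: linear_sum[OF lin] linear_cmul[OF lin])
      also have "\<dots> = 0"
      proof (rule sum.neutral, rule ballI)
        fix i assume "i \<in> {1..?m}"
        then show "D p (e i p) *\<^sub>R tangent_map A B \<psi> p (e i p) = 0"
          using 0 ev[of i] by (cases "i \<le> ?n") auto
      qed
      finally show "?v \<in> vertical_space A B \<psi> p" by (simp add: vertical_space_def)
    qed
  qed
  show ?thesis
  proof
    assume min: "minimal_fibers A g B \<psi>"
    show "vertical_field A B \<psi> (gradient A g (\<lambda>p. (\<mu> p)\<^sup>2))"
      unfolding vertical_field_def
    proof
      fix p
      obtain W e where We: "p \<in> W" "adapted_frame A g B \<psi> W e"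
        using adapted_frame_exists[OF mn] by blast
      then have "fiber_mean_curvature A g TYPE('n) e p = 0"
        using min unfolding minimal_fibers_def by blast
      then show "gradient A g (\<lambda>p. (\<mu> p)\<^sup>2) p \<in> vertical_space A B \<psi> p"
        unfolding V[OF We(2,1)] Hm[OF We(2,1)] .
    qed
  next
    assume "vertical_field A B \<psi> (gradient A g (\<lambda>p. (\<mu> p)\<^sup>2))"
    then show "minimal_fibers A g B \<psi>"
      unfolding minimal_fibers_def vertical_field_def using Hm V by blast
  qed
qed

end

theorem theorem7:
  fixes A :: "('a::{t2_space, second_countable_topology}, 'm::finite) chart set"
    and g :: "('a, 'm) metric_tensor"
    and dV :: "'a measure"
    and B :: "('b::{t2_space, second_countable_topology}, 'n::finite) chart set"
    and h :: "('b, 'n) metric_tensor"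
    and \<psi> :: "'a \<Rightarrow> 'b"
    and \<mu> :: "'a \<Rightarrow> real"
    and \<alpha> :: real
  assumes "\<alpha> > 1"
    and "riemannian_manifold A g"
    and "compact (UNIV :: 'a set)"
    and "riemannian_measure A g dV"
    and "riemannian_manifold B h"
    and "CARD('m) > CARD('n)"
    and "real CARD('n) > 2 * \<alpha>"
    and "horizontally_conformal A g B h \<psi> \<mu>"
    and "alpha_harmonic A g dV B h \<alpha> \<psi>"
  shows "minimal_fibers A g B \<psi> \<longleftrightarrow>
    vertical_field A B \<psi> (gradient A g (\<lambda>p. (\<mu> p)\<^sup>2))"
proof -
  interpret conformal_map A g B h \<psi> \<mu>
    using assms unfolding riemannian_manifold_def by unfold_locales blast+
  show ?thesis using assms by (intro minimal_fibers_iff) auto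
qed

end
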